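(* Consider $\min_{u\in\mathbb R^d}\sum_{i=1}^m F_i(u)$ with $F_i=\frac1n\sum_{j=1}^n f_{ij}$, where: each $f_{ij}:\mathbb R^d\to\mathbb R$ is convex and $L_{ij}$-smooth; each $F_i$ is $L$-smooth and $\mu$-strongly convex ($\mu>0$); and the gossip matrices $W(k)$ satisfy the gossip assumption with constant $\chi\ge1$ (see context). Let $\overline L=\max_i\frac1n\sum_{j=1}^nL_{ij}$. Run algorithm ADOM+VR described in the context with integer batch size $b\ge\overline L/L$, $b\sim\max\{\sqrt{n\overline L/L},\,n\sqrt{\mu/L}\}$, with $\sim\chi$ communications per iteration (multi-stage consensus, see context), and with a suitable choice of its scalar parameters (depending only on $L,\overline L,\mu,\chi,n,b$). Then, to reach $\mathbb E\|x^N-x^*\|^2\le\varepsilon$, the algorithm requires $$\mathcal O\left(\left(n+\sqrt{\frac{n\overline L}{\mu}}\right)\log\frac1\varepsilon\right)$$ oracle calls per node (in expectation) and $$\mathcal O\left(\chi\sqrt{\frac L\mu}\,\log\frac1\varepsilon\right)$$ communication iterations.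
   Context: Notation: $g$ is $\ell$-smooth if $\|\nabla g(u)-\nabla g(v)\|\le \ell\|u-v\|$ for all $u,v$. Variables of the algorithm are $x=(x_1,\dots,x_m)\in(\mathbb R^d)^m$, $x_i$ held by node $i$, with the Euclidean norm. $\mathcal L=\{x: x_1=\dots=x_m\}$, $\mathcal L^\perp=\{x:\sum_i x_i=0\}$. $x^*=(u^*,\dots,u^* )\in\mathcal L$, where $u^*$ is the minimizer of $\sum_i F_i$. One oracle call of node $i$ is the evaluation of one gradient $\nabla f_{ij}$ at one point (so $\nabla F_i$ costs $n$ calls). $A\sim B$ means equality up to absolute constant factors. Gossip assumption with constant $\chi\ge1$: there are graphs $\mathcal G^k=(\{1,\dots,m\},\mathcal E^k)$, $k=0,1,2,\dots$, and matrices $W(k)\in\mathbb R^{m\times m}$ such that for every $k$: (1) $[W(k)]_{ij}\ne0$ iff $(i,j)\in\mathcal E^k$ or $i=j$; (2) $\ker W(k)\supset\{(c,\dots,c):c\in\mathbb R\}$; (3) $\mathrm{range}\,W(k)\subset\{a\in\mathbb R^m:\sum_i a_i=0\}$; (4) $\|(W(k)\otimes I_d)x-x\|^2\le(1-\chi^{-1})\|x\|^2$ for all $x\in\mathcal L^\perp$. Multi-stage consensus with $T$ communications per iteration, $T\sim\chi$ (e.g. $T=\lceil\chi\rceil$): in iteration $k$ of the algorithm the matrix $W(k)$ is replaced by $W(k;T)=I_m-\prod_{q=kT}^{(k+1)T-1}(I_m-W(q))$ (factors with larger $q$ on the left); applying it costs $T$ communication iterations. Algorithm ADOM+VR. Scalar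 parameters: $\eta,\alpha,\nu,\tau_0,\tau_1,\tau_2,\theta,\beta,\sigma_1,\sigma_2,\gamma,\delta,\zeta,p_1,p_2$; integer batch size $b$. Input $x^0,y^0,m^0\in(\mathbb R^d)^m$, $z^0\in\mathcal L^\perp$; set $x_f^0=\omega^0=x^0$, $y_f^0=y^0$, $z_f^0=z^0$. For $k=0,1,\dots,N-1$: $x_g^k=\tau_1x^k+\tau_0\omega^k+(1-\tau_1-\tau_0)x_f^k$; each node $i$ samples a batch $S_i^k$ of $b$ independent indices from $\{1,\dots,n\}$ with $\Pr(j)=p_{ij}=L_{ij}/\sum_{l=1}^nL_{il}$, and sets $(\nabla^k)_i=\frac1b\sum_{j\in S_i^k}\frac1{np_{ij}}[\nabla f_{ij}(x_{g,i}^k)-\nabla f_{ij}(\omega_i^k)]+\nabla F_i(\omega_i^k)$ (the full gradient $\nabla F_i(\omega_i^k)$ is recomputed only when $\omega_i^k$ changes); $x^{k+1}=x^k+\eta\alpha(x_g^k-x^{k+1})-\eta[\nabla^k-\nu x_g^k-y^{k+1}]$; $x_f^{k+1}=x_g^k+\tau_2(x^{k+1}-x^k)$; $\omega_i^{k+1}=x_{f,i}^k$ with probability $p_1$, $x_{g,i}^k$ with probability $p_2$, $\omega_i^k$ with probability $1-p_1-p_2$; $y_g^k=\sigma_1y^k+(1-\sigma_1)y_f^k$; $y^{k+1}=y^k+\theta\beta(\nabla^k-\nu x_g^k-y^{k+1})-\theta[\nu^{-1}(y_g^k+z_g^k)+x^{k+1}]$; $y_f^{k+1}=y_g^k+\sigma_2(y^{k+1}-y^k)$;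 $z_g^k=\sigma_1z^k+(1-\sigma_1)z_f^k$; $z^{k+1}=z^k+\gamma\delta(z_g^k-z^k)-(W(k)\otimes I_d)[\gamma\nu^{-1}(y_g^k+z_g^k)+m^k]$; $m^{k+1}=\gamma\nu^{-1}(y_g^k+z_g^k)+m^k-(W(k)\otimes I_d)[\gamma\nu^{-1}(y_g^k+z_g^k)+m^k]$; $z_f^{k+1}=z_g^k-\zeta(W(k)\otimes I_d)(y_g^k+z_g^k)$. (The updates of $x^{k+1}$ and $y^{k+1}$ are implicit and form a linear system in $(x^{k+1},y^{k+1})$.) Output $x^N$. Convention: $\mathcal O(A\log\frac1\varepsilon)$ means at most $cA\log(C/\varepsilon)$, where $c$ is an absolute constant and $C>0$ may depend on the problem and the initial point but not on $\varepsilon$. *)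

theory Defs
  imports "HOL-Probability.Probability"
begin

text \<open>
  The complexity bound has an absolute constant, uniform in the dimension \<open>d\<close>, so \<open>d\<close> must be
  quantifiable inside a formula and cannot be a type. The type \<open>fvec\<close> of finitely supported real
  sequences contains an isometric copy of every Euclidean space, namely \<open>Rd d\<close> below.
  (\<open>nat \<Rightarrow>\<^sub>0 real\<close> is not used because the library equips it with the \<open>\<ell>\<^sub>1\<close> norm.)
\<close>

typedef fvec = "{v :: nat \<Rightarrow> real. finite {i. v i \<noteq> 0}}"
  morphisms coord Fvec
  by (rule exI[of _ "\<lambda>_. 0"]) simp

setup_lifting type_definition_fvec

lemma fvec_eqI: "(\<And>i. coord u i = coord v i) \<Longrightarrow> u = v"
  by (simp add: coord_inject[symmetric] ext)

lemma finite_coord: "finite {i. coord v i \<noteq> 0}"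
  using coord[of v] by simp

instantiation fvec :: real_vector
begin

lift_definition zero_fvec :: fvec is "\<lambda>_. 0" by simp

lift_definition plus_fvec :: "fvec \<Rightarrow> fvec \<Rightarrow> fvec" is "\<lambda>u v i. u i + v i"
  subgoal for u v
    by (rule finite_subset[of _ "{i. u i \<noteq> 0} \<union> {i. v i \<noteq> 0}"]) auto
  done

lift_definition uminus_fvec :: "fvec \<Rightarrow> fvec" is "\<lambda>u i. - u i" by simp

lift_definition minus_fvec :: "fvec \<Rightarrow> fvec \<Rightarrow> fvec" is "\<lambda>u v i. u i - v i"
  subgoal for u v
    by (rule finite_subset[of _ "{i. u i \<noteq> 0} \<union> {i. v i \<noteq> 0}"]) auto
  done

lift_definition scaleR_fvec :: "real \<Rightarrow> fvec \<Rightarrow> fvec" is "\<lambda>r u i. r * u i"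
  subgoal for r u
    by (rule finite_subset[of _ "{i. u i \<noteq> 0}"]) auto
  done

instance
  by standard (transfer; simp add: algebra_simps)+

end

lemmas coord_simps [simp] = zero_fvec.rep_eq plus_fvec.rep_eq uminus_fvec.rep_eq
  minus_fvec.rep_eq scaleR_fvec.rep_eq

instantiation fvec :: real_inner
begin

definition inner_fvec :: "fvec \<Rightarrow> fvec \<Rightarrow> real" where
  "inner_fvec u v = (\<Sum>i | coord u i \<noteq> 0. coord u i * coord v i)"

definition norm_fvec :: "fvec \<Rightarrow> real" where
  "norm_fvec u = sqrt (inner u u)"

definition sgn_fvec :: "fvec \<Rightarrow> fvec" where
  "sgn_fvec u = u /\<^sub>R norm u"

definition dist_fvec :: "fvec \<Rightarrow> fvec \<Rightarrow> real" where
  "dist_fvec u v = norm (u - v)"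

definition uniformity_fvec :: "(fvec \<times> fvec) filter" where
  "uniformity_fvec = (INF e\<in>{0<..}. principal {(u, v). dist u v < e})"

definition open_fvec :: "fvec set \<Rightarrow> bool" where
  "open_fvec U \<longleftrightarrow> (\<forall>u\<in>U. \<forall>\<^sub>F (u', v) in uniformity. u' = u \<longrightarrow> v \<in> U)"

lemma inner_fvec_superset:
  assumes "finite A" "{i. coord u i \<noteq> 0} \<subseteq> A"
  shows "inner u v = (\<Sum>i\<in>A. coord u i * coord v i)"
  unfolding inner_fvec_def using assms by (intro sum.mono_neutral_left) auto

instance
proof
  fix u v w :: fvec and r :: real
  define A where "A = {i. coord u i \<noteq> 0} \<union> {i. coord v i \<noteq> 0}"
  have A: "finite A" "{i. coord u i \<noteq> 0} \<subseteq> A" "{i. coord v i \<noteq> 0} \<subseteq> A"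
    "{i. coord (u + v) i \<noteq> 0} \<subseteq> A" "{i. coord (r *\<^sub>R u) i \<noteq> 0} \<subseteq> A"
    by (auto simp: A_def finite_coord)
  show "inner u v = inner v u"
    using A by (simp add: inner_fvec_superset[where A = A] mult.commute)
  show "inner (u + v) w = inner u w + inner v w"
    using A by (simp add: inner_fvec_superset[where A = A] sum.distrib algebra_simps
        del: coord_simps) (simp add: sum.distrib algebra_simps)
  show "inner (r *\<^sub>R u) v = r * inner u v"
    using A by (simp add: inner_fvec_superset[where A = A] sum_distrib_left algebra_simps
        del: coord_simps) (simp add: sum_distrib_left algebra_simps)
  show "0 \<le> inner u u"
    by (auto simp: inner_fvec_def intro!: sum_nonneg)
  show "inner u u = 0 \<longleftrightarrow> u = 0"
  proof
    assume "inner u u = 0"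
    then have "coord u i = 0" for i
      by (auto simp: inner_fvec_def sum_nonneg_eq_0_iff[OF finite_coord])
    then show "u = 0" by (intro fvec_eqI) simp
  qed (simp add: inner_fvec_def)
qed (simp_all add: norm_fvec_def sgn_fvec_def dist_fvec_def uniformity_fvec_def open_fvec_def)

end

definition Rd :: "nat \<Rightarrow> fvec set" where
  "Rd d = {u. \<forall>i\<ge>d. coord u i = 0}"

lemma subspace_Rd: "subspace (Rd d)"
  by (auto simp: subspace_def Rd_def)

lemma inner_Rd: "u \<in> Rd d \<Longrightarrow> inner u v = (\<Sum>i<d. coord u i * coord v i)"
  by (intro inner_fvec_superset) (auto simp: Rd_def not_le[symmetric])

lemma bij_betw_Rd: "bij_betw (\<lambda>u. restrict (coord u) {..<d}) (Rd d) ({..<d} \<rightarrow>\<^sub>E UNIV)"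
proof (rule bij_betwI')
  fix u v assume uv: "u \<in> Rd d" "v \<in> Rd d"
  show "restrict (coord u) {..<d} = restrict (coord v) {..<d} \<longleftrightarrow> u = v"
  proof
    assume eq: "restrict (coord u) {..<d} = restrict (coord v) {..<d}"
    show "u = v"
    proof (rule fvec_eqI)
      fix i show "coord u i = coord v i"
        using uv fun_cong[OF eq, of i] by (cases "i < d") (auto simp: Rd_def)
    qed
  qed simp
next
  fix a :: "nat \<Rightarrow> real" assume a: "a \<in> {..<d} \<rightarrow>\<^sub>E UNIV"
  define u where "u = Fvec (\<lambda>i. if i < d then a i else 0)"
  have "finite {i. (if i < d then a i else 0) \<noteq> 0}"
    by (rule finite_subset[of _ "{..<d}"]) auto
  then have u: "coord u = (\<lambda>i. if i < d then a i else 0)"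
    by (simp add: u_def Fvec_inverse)
  have "a = restrict (coord u) {..<d}"
    using a by (auto simp: u fun_eq_iff PiE_def extensional_def)
  moreover have "u \<in> Rd d" by (simp add: Rd_def u)
  ultimately show "\<exists>u\<in>Rd d. a = restrict (coord u) {..<d}" by blast
qed auto


section \<open>Smooth and strongly convex functions on \<open>\<real>\<^sup>d\<close>\<close>

text \<open>Functions are total on \<open>fvec\<close>, but only their values on \<open>Rd d\<close> enter.\<close>

definition is_grad :: "nat \<Rightarrow> (fvec \<Rightarrow> real) \<Rightarrow> fvec \<Rightarrow> fvec \<Rightarrow> bool" where
  "is_grad d g u v \<longleftrightarrow> v \<in> Rd d \<and> (g has_derivative (\<lambda>h. inner v h)) (at u within Rd d)"

definition grad :: "nat \<Rightarrow> (fvec \<Rightarrow> real) \<Rightarrow> fvec \<Rightarrow> fvec" where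
  "grad d g u = (THE v. is_grad d g u v)"

definition smooth_fun :: "nat \<Rightarrow> real \<Rightarrow> (fvec \<Rightarrow> real) \<Rightarrow> bool" where
  "smooth_fun d l g \<longleftrightarrow>
     (\<forall>u\<in>Rd d. \<exists>v. is_grad d g u v) \<and>
     (\<forall>u\<in>Rd d. \<forall>v\<in>Rd d. norm (grad d g u - grad d g v) \<le> l * norm (u - v))"

definition strongly_convex :: "nat \<Rightarrow> real \<Rightarrow> (fvec \<Rightarrow> real) \<Rightarrow> bool" where
  "strongly_convex d \<mu> g \<longleftrightarrow>
     (\<forall>u\<in>Rd d. \<forall>v\<in>Rd d. \<forall>t\<in>{0..1}.
        g (t *\<^sub>R u + (1 - t) *\<^sub>R v)
          \<le> t * g u + (1 - t) * g v - \<mu> / 2 * t * (1 - t) * (norm (u - v))\<^sup>2)"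


section \<open>The finite-sum problem\<close>

record problem =
  dim_of :: nat                                  \<comment> \<open>\<open>d\<close>\<close>
  nodes :: nat                                   \<comment> \<open>\<open>m\<close>\<close>
  comps :: nat                                   \<comment> \<open>\<open>n\<close>\<close>
  comp_fun :: "nat \<Rightarrow> nat \<Rightarrow> fvec \<Rightarrow> real"    \<comment> \<open>\<open>f\<^sub>i\<^sub>j\<close> for \<open>i \<in> {1..m}\<close>, \<open>j \<in> {1..n}\<close>\<close>
  comp_lip :: "nat \<Rightarrow> nat \<Rightarrow> real"            \<comment> \<open>\<open>L\<^sub>i\<^sub>j\<close>\<close>

definition node_fun :: "problem \<Rightarrow> nat \<Rightarrow> fvec \<Rightarrow> real" where
  "node_fun P i u = (\<Sum>j=1..comps P. comp_fun P i j u) / real (comps P)"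

definition Lbar :: "problem \<Rightarrow> real" where
  "Lbar P = Max ((\<lambda>i. (\<Sum>j=1..comps P. comp_lip P i j) / real (comps P)) ` {1..nodes P})"

definition problem_assms :: "problem \<Rightarrow> real \<Rightarrow> real \<Rightarrow> bool" where
  "problem_assms P L \<mu> \<longleftrightarrow>
     1 \<le> dim_of P \<and> 1 \<le> nodes P \<and> 1 \<le> comps P \<and> 0 < \<mu> \<and>
     (\<forall>i\<in>{1..nodes P}. \<forall>j\<in>{1..comps P}.
        convex_on (Rd (dim_of P)) (comp_fun P i j) \<and>
        smooth_fun (dim_of P) (comp_lip P i j) (comp_fun P i j)) \<and>
     (\<forall>i\<in>{1..nodes P}.
        smooth_fun (dim_of P) L (node_fun P i) \<and>
        strongly_convex (dim_of P) \<mu> (node_fun P i))"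

definition is_minimizer :: "problem \<Rightarrow> fvec \<Rightarrow> bool" where
  "is_minimizer P u \<longleftrightarrow>
     is_arg_min (\<lambda>v. \<Sum>i=1..nodes P. node_fun P i v) (\<lambda>v. v \<in> Rd (dim_of P)) u"


section \<open>Stacked variables and gossip matrices\<close>

text \<open>
  A stacked variable \<open>x \<in> (\<real>\<^sup>d)\<^sup>m\<close> is a function of the node \<open>i \<in> {1..m}\<close>, and an \<open>m \<times> m\<close> matrix is
  a function of its row and column index in \<open>{1..m}\<close>; values outside these ranges are irrelevant.
\<close>

type_synonym stacked = "nat \<Rightarrow> fvec"
type_synonym matrix = "nat \<Rightarrow> nat \<Rightarrow> real"

definition stacked_space :: "nat \<Rightarrow> nat \<Rightarrow> stacked set" where
  "stacked_space d m = {x. \<forall>i\<in>{1..m}. x i \<in> Rd d}"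

definition consensus_perp :: "nat \<Rightarrow> nat \<Rightarrow> stacked set" where
  "consensus_perp d m = {x \<in> stacked_space d m. (\<Sum>i=1..m. x i) = 0}"

definition sqnorm :: "nat \<Rightarrow> stacked \<Rightarrow> real" where
  "sqnorm m x = (\<Sum>i=1..m. (norm (x i))\<^sup>2)"

text \<open>The action of \<open>A \<otimes> I\<^sub>d\<close>.\<close>

definition kron_apply :: "nat \<Rightarrow> matrix \<Rightarrow> stacked \<Rightarrow> stacked" where
  "kron_apply m A x = (\<lambda>i. \<Sum>j=1..m. A i j *\<^sub>R x j)"

definition gossip_assms ::
    "nat \<Rightarrow> nat \<Rightarrow> real \<Rightarrow> (nat \<Rightarrow> (nat \<times> nat) set) \<Rightarrow> (nat \<Rightarrow> matrix) \<Rightarrow> bool" where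
  "gossip_assms d m chi E W \<longleftrightarrow>
     1 \<le> chi \<and>
     (\<forall>k. E k \<subseteq> {1..m} \<times> {1..m} \<and>
       (\<forall>i\<in>{1..m}. \<forall>j\<in>{1..m}. W k i j \<noteq> 0 \<longleftrightarrow> (i, j) \<in> E k \<or> i = j) \<and>
       (\<forall>c::real. \<forall>i\<in>{1..m}. (\<Sum>j=1..m. W k i j * c) = 0) \<and>
       (\<forall>a :: nat \<Rightarrow> real. (\<Sum>i=1..m. \<Sum>j=1..m. W k i j * a j) = 0) \<and>
       (\<forall>x\<in>consensus_perp d m.
          sqnorm m (\<lambda>i. kron_apply m (W k) x i - x i) \<le> (1 - 1 / chi) * sqnorm m x))"

definition id_mat :: matrix where
  "id_mat = (\<lambda>i j. if i = j then 1 else 0)"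

definition mat_diff :: "matrix \<Rightarrow> matrix \<Rightarrow> matrix" where
  "mat_diff A B = (\<lambda>i j. A i j - B i j)"

definition mat_mult :: "nat \<Rightarrow> matrix \<Rightarrow> matrix \<Rightarrow> matrix" where
  "mat_mult m A B = (\<lambda>i j. \<Sum>l=1..m. A i l * B l j)"

text \<open>\<open>(I - W (s + t - 1)) \<cdots> (I - W (s + 1)) (I - W s)\<close>\<close>

primrec consensus_prod :: "nat \<Rightarrow> (nat \<Rightarrow> matrix) \<Rightarrow> nat \<Rightarrow> nat \<Rightarrow> matrix" where
  "consensus_prod m W s 0 = id_mat"
| "consensus_prod m W s (Suc t) =
     mat_mult m (mat_diff id_mat (W (s + t))) (consensus_prod m W s t)"

definition multi_stage :: "nat \<Rightarrow> (nat \<Rightarrow> matrix) \<Rightarrow> nat \<Rightarrow> nat \<Rightarrow> matrix" where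
  "multi_stage m W T k = mat_diff id_mat (consensus_prod m W (k * T) T)"


section \<open>ADOM+VR\<close>

record adom_params =
  eta :: real
  alpha :: real
  nu :: real
  tau0 :: real
  tau1 :: real
  tau2 :: real
  theta :: real
  beta :: real
  sigma1 :: real
  sigma2 :: real
  gamma :: real
  delta :: real
  zeta :: real
  p1 :: real
  p2 :: real

text \<open>
  The implicit updates decouple over the nodes: at one node, \<open>x'\<close> and \<open>y'\<close> are the new iterates
  and \<open>g\<close> is the gradient estimate.
\<close>

definition implicit_system ::
    "adom_params \<Rightarrow> fvec \<Rightarrow> fvec \<Rightarrow> fvec \<Rightarrow> fvec \<Rightarrow> fvec \<Rightarrow> fvec \<Rightarrow> fvec \<times> fvec \<Rightarrow> bool" where
  "implicit_system p x y xg yg zg g = (\<lambda>(x', y').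
     x' = x + (eta p * alpha p) *\<^sub>R (xg - x') - eta p *\<^sub>R (g - nu p *\<^sub>R xg - y') \<and>
     y' = y + (theta p * beta p) *\<^sub>R (g - nu p *\<^sub>R xg - y')
            - theta p *\<^sub>R ((1 / nu p) *\<^sub>R (yg + zg) + x'))"

text \<open>What the parameters must satisfy for the algorithm to be executable at all.\<close>

definition admissible :: "adom_params \<Rightarrow> bool" where
  "admissible p \<longleftrightarrow>
     nu p \<noteq> 0 \<and> 0 \<le> p1 p \<and> 0 \<le> p2 p \<and> p1 p + p2 p \<le> 1 \<and>
     (\<forall>x y xg yg zg g. \<exists>!q. implicit_system p x y xg yg zg g q)"

record adom_state =
  st_x :: stacked
  st_xf :: stacked
  st_om :: stacked
  st_y :: stacked
  st_yf :: stacked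
  st_z :: stacked
  st_zf :: stacked
  st_m :: stacked
  st_calls :: "nat \<Rightarrow> nat"                \<comment> \<open>oracle calls made so far by each node\<close>

definition index_prob :: "problem \<Rightarrow> nat \<Rightarrow> nat \<Rightarrow> real" where
  "index_prob P i j = comp_lip P i j / (\<Sum>l=1..comps P. comp_lip P i l)"

definition batch_pmf :: "problem \<Rightarrow> nat \<Rightarrow> nat \<Rightarrow> nat list pmf" where
  "batch_pmf P b i =
     replicate_pmf b (pmf_of_list (map (\<lambda>j. (j, index_prob P i j)) [1..<Suc (comps P)]))"

definition grad_estimate :: "problem \<Rightarrow> nat \<Rightarrow> nat \<Rightarrow> nat list \<Rightarrow> fvec \<Rightarrow> fvec \<Rightarrow> fvec" where
  "grad_estimate P b i S xg om =
     (1 / real b) *\<^sub>R (\<Sum>j\<leftarrow>S. (1 / (real (comps P) * index_prob P i j)) *\<^sub>R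
        (grad (dim_of P) (comp_fun P i j) xg - grad (dim_of P) (comp_fun P i j) om))
     + grad (dim_of P) (node_fun P i) om"

text \<open>
  One iteration with gossip matrix \<open>A\<close>. All draws are independent over the nodes and of each other.
  Oracle calls of a node: \<open>2 b\<close> for the two gradients of every sampled component, and \<open>n\<close> for the
  full gradient at a new point \<open>\<omega>\<^sub>i\<close>, charged as soon as \<open>\<omega>\<^sub>i\<close> changes.
\<close>

definition adom_step ::
    "problem \<Rightarrow> adom_params \<Rightarrow> nat \<Rightarrow> matrix \<Rightarrow> adom_state \<Rightarrow> adom_state pmf" where
  "adom_step P p b A s =
    (let x = st_x s; xf = st_xf s; om = st_om s; y = st_y s; yf = st_yf s;
         z = st_z s; zf = st_zf s; mm = st_m s;
         xg = (\<lambda>i. tau1 p *\<^sub>R x i + tau0 p *\<^sub>R om i + (1 - tau1 p - tau0 p) *\<^sub>R xf i);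
         yg = (\<lambda>i. sigma1 p *\<^sub>R y i + (1 - sigma1 p) *\<^sub>R yf i);
         zg = (\<lambda>i. sigma1 p *\<^sub>R z i + (1 - sigma1 p) *\<^sub>R zf i);
         r = (\<lambda>i. (gamma p / nu p) *\<^sub>R (yg i + zg i) + mm i);
         Wr = kron_apply (nodes P) A r;
         Wyz = kron_apply (nodes P) A (\<lambda>i. yg i + zg i)
     in do {
       S \<leftarrow> Pi_pmf {1..nodes P} [] (batch_pmf P b);
       om' \<leftarrow> Pi_pmf {1..nodes P} 0
         (\<lambda>i. pmf_of_list [(xf i, p1 p), (xg i, p2 p), (om i, 1 - p1 p - p2 p)]);
       let g = (\<lambda>i. grad_estimate P b i (S i) (xg i) (om i));
       let xy' = (\<lambda>i. THE q. implicit_system p (x i) (y i) (xg i) (yg i) (zg i) (g i) q);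
       let x' = (\<lambda>i. fst (xy' i));
       let y' = (\<lambda>i. snd (xy' i));
       return_pmf \<lparr>
         st_x = x',
         st_xf = (\<lambda>i. xg i + tau2 p *\<^sub>R (x' i - x i)),
         st_om = om',
         st_y = y',
         st_yf = (\<lambda>i. yg i + sigma2 p *\<^sub>R (y' i - y i)),
         st_z = (\<lambda>i. z i + (gamma p * delta p) *\<^sub>R (zg i - z i) - Wr i),
         st_zf = (\<lambda>i. zg i - zeta p *\<^sub>R Wyz i),
         st_m = (\<lambda>i. r i - Wr i),
         st_calls = (\<lambda>i. st_calls s i + 2 * b + (if om' i \<noteq> om i then comps P else 0))\<rparr>
     })"

definition adom_init ::
    "problem \<Rightarrow> stacked \<Rightarrow> stacked \<Rightarrow> stacked \<Rightarrow> stacked \<Rightarrow> adom_state" where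
  "adom_init P x0 y0 z0 m0 =
     \<lparr>st_x = x0, st_xf = x0, st_om = x0, st_y = y0, st_yf = y0, st_z = z0, st_zf = z0,
      st_m = m0, st_calls = (\<lambda>_. comps P)\<rparr>"

text \<open>Law of the state after \<open>N\<close> iterations with \<open>T\<close> communications each.\<close>

primrec adom_vr ::
    "problem \<Rightarrow> adom_params \<Rightarrow> nat \<Rightarrow> (nat \<Rightarrow> matrix) \<Rightarrow> nat \<Rightarrow> adom_state \<Rightarrow> nat
       \<Rightarrow> adom_state pmf" where
  "adom_vr P p b W T s0 0 = return_pmf s0"
| "adom_vr P p b W T s0 (Suc k) =
     bind_pmf (adom_vr P p b W T s0 k) (adom_step P p b (multi_stage (nodes P) W T k))"


section \<open>Comparison up to constant factors\<close>

definition same_order :: "real \<Rightarrow> real \<Rightarrow> real \<Rightarrow> bool" where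
  "same_order \<kappa> A B \<longleftrightarrow> A \<le> \<kappa> * B \<and> B \<le> \<kappa> * A"

end

theory Submission
  imports Defs
begin

text \<open>
  The problem is equivalent to the saddle point problem \<open>min\<^sub>x max\<^sub>y max\<^sub>z F(x) -
  \<nu>/2 |x|\<^sup>2 - \<langle>x, y\<rangle> - 1/(2\<nu>) |y + z|\<^sup>2\<close> with \<open>z\<close>
  ranging over the orthogonal complement of the consensus space and \<open>\<nu> = \<mu>/2\<close>. Its solution
  is \<open>x\<^sub>* = (u\<^sub>*, \<dots>, u\<^sub>*)\<close>, \<open>y\<^sub>* = \<nabla>F(x\<^sub>*) - \<nu>
  x\<^sub>*\<close>, \<open>z\<^sub>* = - \<nabla>F(x\<^sub>*)\<close>. ADOM+VR runs an accelerated method on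
  each of the three variables, and a single Lyapunov function, a weighted sum of squared distances and Bregman
  divergences of the iterates to the solution, contracts in expectation by a factor \<open>1 - \<rho>\<close> in
  every iteration, where \<open>\<rho>\<close> is \<open>sqrt (\<mu> / L)\<close> up to a factor that depends
  only on \<open>\<kappa>\<close> (lemma \<open>lyapunov_step\<close>).

  In the primal variable (\<open>accelerated_node_step\<close>) progress is measured by the Bregman divergence
  \<open>D\<close> of \<open>F - \<nu>/2 |x|\<^sup>2\<close>. The three-point identity, applied to the convex
  combination that defines \<open>x\<^sub>g\<close>, leaves a negative term \<open>- (2 \<tau>\<^sub>0 / \<tau>)
  D(\<omega>, x\<^sub>g)\<close>. Importance sampling and cocoercivity of the component gradients bound the
  variance of the gradient estimate by \<open>2 Lbar / b\<close> times the divergence of \<open>F\<close>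
  (\<open>noise_variance\<close>), which is at most \<open>(4 Lbar / b) D(\<omega>, x\<^sub>g)\<close>, so
  \<open>\<tau>\<^sub>0 = Lbar / (2 b L)\<close> pays for the noise; \<open>\<tau>\<^sub>0 \<le> 1/2\<close> is
  the condition \<open>b \<ge> Lbar / L\<close>. Snapshots \<open>\<omega>\<close> jump to
  \<open>x\<^sub>f\<close> with probability \<open>min 1 (b / n)\<close>, which makes recomputing full gradients
  as cheap as sampling the batches; the prescribed order of \<open>b\<close> says that
  \<open>\<tau>\<^sub>0\<close> and \<open>\<tau>\<close> are both at most this probability up to a constant, so
  the snapshot term contracts as fast as the others (\<open>Lambda_le\<close>).

  In the dual variables (\<open>dual_consensus_step\<close>) the gossip matrix \<open>W\<close> is not the
  orthogonal projection, only \<open>I - W\<close> is a contraction, and using \<open>W\<close> in its place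
  biases the gradient step for \<open>z\<close>. The variable \<open>m\<close> stores what \<open>W\<close>
  failed to transmit, and \<open>z - m\<close>, with \<open>m\<close> projected, follows the unbiased projected
  gradient step (error feedback). With \<open>T\<close> of order \<open>\<chi>\<close> communications per
  iteration the contraction factor is at most \<open>1 - 1 / (\<kappa> + 1)\<close>, free of
  \<open>\<chi>\<close> (\<open>multi_stage_gossip_step\<close>).

  Hence \<open>N\<close> of order \<open>sqrt (L / \<mu>) ln (C / \<epsilon>)\<close> suffices; multiplying by
  \<open>T\<close> gives the communication bound, and multiplying by the expected cost per iteration, at most
  \<open>3 b\<close>, gives the oracle bound because \<open>b sqrt (L / \<mu>)\<close> is at most of order
  \<open>max n (sqrt (n Lbar / \<mu>))\<close>.
\<close>

section \<open>One step of the accelerated primal-dual method\<close>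

definition bregman :: "('a::real_inner \<Rightarrow> real) \<Rightarrow> ('a \<Rightarrow> 'a) \<Rightarrow> 'a \<Rightarrow> 'a \<Rightarrow> real" where
  "bregman f g u v = f u - f v - inner (g v) (u - v)"

lemma bregman_three_point:
  "inner (g u - g v) (u - w) = bregman f g u v - bregman f g w v + bregman f g w u"
  by (simp add: bregman_def inner_simps)

lemma norm_add_sq: "(norm (a + b :: 'a::real_inner))\<^sup>2 = (norm a)\<^sup>2 + 2 * inner a b + (norm b)\<^sup>2"
  by (simp add: power2_norm_eq_inner inner_simps inner_commute)

lemma norm_diff_sq: "(norm (a - b :: 'a::real_inner))\<^sup>2 = (norm a)\<^sup>2 - 2 * inner a b + (norm b)\<^sup>2"
  by (simp add: power2_norm_eq_inner inner_simps inner_commute)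

lemma norm_scaleR_sq: "(norm (c *\<^sub>R a :: 'a::real_inner))\<^sup>2 = c\<^sup>2 * (norm a)\<^sup>2"
  by (simp add: power_mult_distrib)

lemma young_inner:
  fixes a b :: "'a::real_inner"
  assumes "0 < c"
  shows "2 * inner a b \<le> c * (norm a)\<^sup>2 + (norm b)\<^sup>2 / c"
proof -
  have "0 \<le> (norm (c *\<^sub>R a - b))\<^sup>2 / c" using assms by simp
  also have "\<dots> = c * (norm a)\<^sup>2 - 2 * inner a b + (norm b)\<^sup>2 / c"
    unfolding norm_diff_sq norm_scaleR_sq
    using assms by (simp add: field_simps power2_eq_square)
  finally show ?thesis by simp
qed

lemma norm_add_sq_le: "(norm (a + b :: 'a::real_inner))\<^sup>2 \<le> 2 * (norm a)\<^sup>2 + 2 * (norm b)\<^sup>2"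
  using young_inner[of 1 a b] by (simp add: norm_add_sq)

lemma norm_diff_sq_le: "(norm (a - b :: 'a::real_inner))\<^sup>2 \<le> 2 * (norm a)\<^sup>2 + 2 * (norm b)\<^sup>2"
  using norm_add_sq_le[of a "- b"] by simp

lemma norm_convex_comb_sq:
  fixes a b :: "'a::real_inner"
  assumes "0 \<le> t" "t \<le> 1"
  shows "(norm (t *\<^sub>R a + (1 - t) *\<^sub>R b))\<^sup>2 \<le> t * (norm a)\<^sup>2 + (1 - t) * (norm b)\<^sup>2"
proof -
  have "t * (norm a)\<^sup>2 + (1 - t) * (norm b)\<^sup>2 - (norm (t *\<^sub>R a + (1 - t) *\<^sub>R b))\<^sup>2
      = t * (1 - t) * (norm (a - b))\<^sup>2"
    by (simp add: norm_diff_sq norm_add_sq norm_scaleR_sq) (simp add: algebra_simps power2_eq_square)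
  moreover have "0 \<le> t * (1 - t) * (norm (a - b))\<^sup>2" using assms by simp
  ultimately show ?thesis by linarith
qed

text \<open>
  The \<open>x\<close> and \<open>y\<close> updates are implicit in each other, and this is what makes the
  bilinear terms \<open>\<langle>x' - x\<^sub>*, y' - y\<^sub>*\<rangle>\<close> of the two distance expansions
  cancel. The vector \<open>h + \<xi>\<close> is the error of the gradient estimate against its value at the
  solution, with \<open>\<xi>\<close> the sampling noise.
\<close>

lemma primal_dual_step:
  fixes x x' xg xs y y' ys ug us h \<xi> :: "'a::real_inner"
  assumes pos: "0 < \<eta>" "0 < \<theta>" "0 \<le> \<alpha>" "0 \<le> \<beta>"
    and x': "x' = x + (\<eta> * \<alpha>) *\<^sub>R (xg - x') - \<eta> *\<^sub>R (h + \<xi> + ys - y')"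
    and y': "y' = y + (\<theta> * \<beta>) *\<^sub>R (h + \<xi> + ys - y') - \<theta> *\<^sub>R ((1 / \<nu>) *\<^sub>R ug + x')"
    and us: "(1 / \<nu>) *\<^sub>R us + xs = 0"
  shows "(1 / \<eta> + \<alpha>) * (norm (x' - xs))\<^sup>2 + (norm (x' - x))\<^sup>2 / \<eta>
      + (1 / \<theta> + \<beta>) * (norm (y' - ys))\<^sup>2 + (norm (y' - y))\<^sup>2 / \<theta>
    \<le> (norm (x - xs))\<^sup>2 / \<eta> + (norm (y - ys))\<^sup>2 / \<theta> + \<alpha> * (norm (xg - xs))\<^sup>2
      - 2 * inner (h + \<xi>) (x' - xs) + \<beta> * (norm (h + \<xi>))\<^sup>2
      - 2 / \<nu> * inner (ug - us) (y' - ys)"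
proof -
  define a where "a = h + \<xi>"
  define X where "X = x' - xs"
  define Y where "Y = y' - ys"
  have dx: "(1 / \<eta>) *\<^sub>R (x' - x) = \<alpha> *\<^sub>R (xg - x') - (a - Y)"
  proof -
    have "x' - x = (\<eta> * \<alpha>) *\<^sub>R (xg - x') - \<eta> *\<^sub>R (a - Y)"
      by (subst x') (simp add: a_def Y_def algebra_simps)
    then have "(1 / \<eta>) *\<^sub>R (x' - x) = (1 / \<eta>) *\<^sub>R ((\<eta> * \<alpha>) *\<^sub>R (xg - x') - \<eta> *\<^sub>R (a - Y))" by simp
    then show ?thesis using pos by (simp add: scaleR_right_diff_distrib)
  qed
  have dy: "(1 / \<theta>) *\<^sub>R (y' - y) = \<beta> *\<^sub>R (a - Y) - ((1 / \<nu>) *\<^sub>R (ug - us) + X)"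
  proof -
    have e: "(1 / \<nu>) *\<^sub>R ug + x' = (1 / \<nu>) *\<^sub>R (ug - us) + X"
      using us by (simp add: X_def algebra_simps add_eq_0_iff)
    have "y' - y = (\<theta> * \<beta>) *\<^sub>R (h + \<xi> + ys - y') - \<theta> *\<^sub>R ((1 / \<nu>) *\<^sub>R (ug - us) + X)"
      using y'[unfolded e] by (metis add_diff_cancel_left' add_diff_eq)
    also have "h + \<xi> + ys - y' = a - Y" by (simp add: a_def Y_def)
    finally have "y' - y = (\<theta> * \<beta>) *\<^sub>R (a - Y) - \<theta> *\<^sub>R ((1 / \<nu>) *\<^sub>R (ug - us) + X)" .
    then have "(1 / \<theta>) *\<^sub>R (y' - y)
        = (1 / \<theta>) *\<^sub>R ((\<theta> * \<beta>) *\<^sub>R (a - Y) - \<theta> *\<^sub>R ((1 / \<nu>) *\<^sub>R (ug - us) + X))" by simp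
    then show ?thesis using pos by (simp add: scaleR_right_diff_distrib)
  qed
  have "2 * inner ((1 / \<eta>) *\<^sub>R (x' - x)) X
      = ((norm X)\<^sup>2 + (norm (x' - x))\<^sup>2 - (norm (x - xs))\<^sup>2) / \<eta>"
  proof -
    have "2 * inner (x' - x) X = (norm X)\<^sup>2 + (norm (x' - x))\<^sup>2 - (norm (x - xs))\<^sup>2"
      by (simp add: X_def power2_norm_eq_inner inner_simps inner_commute)
    then show ?thesis by simp
  qed
  moreover have "2 * inner (\<alpha> *\<^sub>R (xg - x') - (a - Y)) X
      = \<alpha> * ((norm (xg - xs))\<^sup>2 - (norm X)\<^sup>2 - (norm (xg - x'))\<^sup>2) - 2 * inner a X + 2 * inner Y X"
    by (simp add: X_def power2_norm_eq_inner inner_simps inner_commute algebra_simps)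
  ultimately have 1: "((norm X)\<^sup>2 + (norm (x' - x))\<^sup>2 - (norm (x - xs))\<^sup>2) / \<eta>
     = \<alpha> * ((norm (xg - xs))\<^sup>2 - (norm X)\<^sup>2 - (norm (xg - x'))\<^sup>2) - 2 * inner a X + 2 * inner Y X"
    using dx by simp
  have "2 * inner ((1 / \<theta>) *\<^sub>R (y' - y)) Y
      = ((norm Y)\<^sup>2 + (norm (y' - y))\<^sup>2 - (norm (y - ys))\<^sup>2) / \<theta>"
  proof -
    have "2 * inner (y' - y) Y = (norm Y)\<^sup>2 + (norm (y' - y))\<^sup>2 - (norm (y - ys))\<^sup>2"
      by (simp add: Y_def power2_norm_eq_inner inner_simps inner_commute)
    then show ?thesis by simp
  qed
  moreover have "2 * inner (\<beta> *\<^sub>R (a - Y) - ((1 / \<nu>) *\<^sub>R (ug - us) + X)) Y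
      = \<beta> * ((norm a)\<^sup>2 - (norm Y)\<^sup>2 - (norm (a - Y))\<^sup>2)
        - 2 / \<nu> * inner (ug - us) Y - 2 * inner Y X"
    by (simp add: power2_norm_eq_inner inner_simps inner_commute algebra_simps)
  ultimately have 2: "((norm Y)\<^sup>2 + (norm (y' - y))\<^sup>2 - (norm (y - ys))\<^sup>2) / \<theta>
      = \<beta> * ((norm a)\<^sup>2 - (norm Y)\<^sup>2 - (norm (a - Y))\<^sup>2)
        - 2 / \<nu> * inner (ug - us) Y - 2 * inner Y X"
    using dy by simp
  have "0 \<le> \<alpha> * (norm (xg - x'))\<^sup>2" "0 \<le> \<beta> * (norm (a - Y))\<^sup>2" using pos by simp_all
  with 1 2 show ?thesis
    unfolding a_def[symmetric] X_def[symmetric] Y_def[symmetric]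
    by (simp add: algebra_simps add_divide_distrib diff_divide_distrib)
qed

text \<open>
  Acceleration at a single node. The identity \<open>\<tau> (x - x\<^sub>*) = \<tau> (x\<^sub>g - x\<^sub>*) +
  \<tau>\<^sub>0 (x\<^sub>g - \<omega>) + (1 - \<tau> - \<tau>\<^sub>0) (x\<^sub>g - x\<^sub>f)\<close> turns
  \<open>\<langle>h, x - x\<^sub>*\<rangle>\<close> into Bregman divergences, and smoothness does the same for
  \<open>\<langle>h, x' - x\<rangle>\<close>. Since the extrapolation and interpolation weights are both
  \<open>\<tau>\<close>, the two occurrences of \<open>D(x\<^sub>g, x\<^sub>*)\<close> cancel. Of the right-hand
  side, \<open>- D(\<omega>, x\<^sub>g)\<close> is kept to absorb the variance of \<open>\<xi>\<close>, and the
  inner product with \<open>\<xi>\<close> has mean zero because its other argument does not depend on the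
  samples of this step.
\<close>

lemma accelerated_node_step:
  fixes x x' xf \<omega> xg xs y y' ys ug us \<xi> :: "'a::real_inner" and f :: "'a \<Rightarrow> real" and g :: "'a \<Rightarrow> 'a"
  defines "D \<equiv> bregman f g"
  assumes pos: "0 < \<eta>" "0 < \<theta>" "0 \<le> \<alpha>" "0 \<le> \<beta>" "0 < \<tau>" "\<tau> + \<tau>0 \<le> 1" "2 * L * \<tau> * \<eta> \<le> 1"
    and xg: "xg = \<tau> *\<^sub>R x + \<tau>0 *\<^sub>R \<omega> + (1 - \<tau> - \<tau>0) *\<^sub>R xf"
    and x': "x' = x + (\<eta> * \<alpha>) *\<^sub>R (xg - x') - \<eta> *\<^sub>R (g xg - g xs + \<xi> + ys - y')"
    and y': "y' = y + (\<theta> * \<beta>) *\<^sub>R (g xg - g xs + \<xi> + ys - y') - \<theta> *\<^sub>R ((1 / \<nu>) *\<^sub>R ug + x')"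
    and us: "(1 / \<nu>) *\<^sub>R us + xs = 0"
    and xf': "xf' = xg + \<tau> *\<^sub>R (x' - x)"
    and conv: "0 \<le> D xf xg"
    and smooth: "D xf' xg \<le> L / 2 * (norm (xf' - xg))\<^sup>2"
    and coer: "\<alpha> * (norm (xg - xs))\<^sup>2 + \<beta> * (norm (g xg - g xs))\<^sup>2 \<le> 2 * D xs xg"
  shows "(1 / \<eta> + \<alpha>) * (norm (x' - xs))\<^sup>2 + 2 / \<tau> * D xf' xs
      + (1 / \<theta> + \<beta>) * (norm (y' - ys))\<^sup>2 + (norm (y' - y))\<^sup>2 / \<theta>
    \<le> (norm (x - xs))\<^sup>2 / \<eta> + 2 * (1 - \<tau> - \<tau>0) / \<tau> * D xf xs
      + 2 * \<tau>0 / \<tau> * (D \<omega> xs - D \<omega> xg) + (norm (y - ys))\<^sup>2 / \<theta>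
      - 2 / \<nu> * inner (ug - us) (y' - ys)
      + 2 * inner \<xi> (\<beta> *\<^sub>R (g xg - g xs) - (x - xs)) + (2 * \<eta> + \<beta>) * (norm \<xi>)\<^sup>2"
proof -
  define h where "h = g xg - g xs"
  note base = primal_dual_step[OF pos(1-4) x' y' us]
  have tp: "inner h (xg - w) = D xg xs - D w xs + D w xg" for w
    unfolding h_def D_def by (rule bregman_three_point)
  have "D xs xs = 0" by (simp add: D_def bregman_def)
  with tp[of xs] have tps: "inner h (xg - xs) = D xg xs + D xs xg" by simp
  have lin: "\<tau> * inner h (x - xs) = \<tau> * inner h (xg - xs) + \<tau>0 * inner h (xg - \<omega>)
      + (1 - \<tau> - \<tau>0) * inner h (xg - xf)"
  proof -
    have "\<tau> *\<^sub>R (x - xs) = \<tau> *\<^sub>R (xg - xs) + \<tau>0 *\<^sub>R (xg - \<omega>) + (1 - \<tau> - \<tau>0) *\<^sub>R (xg - xf)"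
      using xg by (simp add: algebra_simps)
    then have "inner h (\<tau> *\<^sub>R (x - xs))
      = inner h (\<tau> *\<^sub>R (xg - xs) + \<tau>0 *\<^sub>R (xg - \<omega>) + (1 - \<tau> - \<tau>0) *\<^sub>R (xg - xf))" by simp
    then show ?thesis by (simp add: inner_add_right)
  qed
  have hx: "- (2 * inner h (x - xs)) \<le> - (2 / \<tau> * D xg xs) - 2 * D xs xg
      + 2 * \<tau>0 / \<tau> * (D \<omega> xs - D \<omega> xg) + 2 * (1 - \<tau> - \<tau>0) / \<tau> * D xf xs"
  proof -
    have "0 \<le> (1 - \<tau> - \<tau>0) * D xf xg" using pos conv by simp
    then have A: "D xg xs + \<tau> * D xs xg - \<tau>0 * (D \<omega> xs - D \<omega> xg) - (1 - \<tau> - \<tau>0) * D xf xs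
       \<le> \<tau> * inner h (x - xs)"
      unfolding lin tps tp[of \<omega>] tp[of xf] by (simp add: algebra_simps)
    have "- (2 * inner h (x - xs)) = - (2 / \<tau> * (\<tau> * inner h (x - xs)))" using pos by simp
    also have "\<dots> \<le> - (2 / \<tau> * (D xg xs + \<tau> * D xs xg - \<tau>0 * (D \<omega> xs - D \<omega> xg)
        - (1 - \<tau> - \<tau>0) * D xf xs))"
      using mult_left_mono[OF A, of "2 / \<tau>"] pos by simp
    also have "\<dots> = - (2 / \<tau> * D xg xs) - 2 * D xs xg
      + 2 * \<tau>0 / \<tau> * (D \<omega> xs - D \<omega> xg) + 2 * (1 - \<tau> - \<tau>0) / \<tau> * D xf xs"
      using pos by (simp add: field_simps)
    finally show ?thesis .
  qed
  have hd: "- (2 * inner h (x' - x)) \<le> 2 / \<tau> * (D xg xs - D xf' xs) + L * \<tau> * (norm (x' - x))\<^sup>2"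
  proof -
    have d: "xf' - xg = \<tau> *\<^sub>R (x' - x)" by (simp add: xf')
    have "D xf' xs = D xg xs + inner h (xf' - xg) + D xf' xg"
      using tp[of xf'] by (simp add: inner_diff_right)
    also have "\<dots> \<le> D xg xs + \<tau> * inner h (x' - x) + L / 2 * (\<tau>\<^sup>2 * (norm (x' - x))\<^sup>2)"
      using smooth unfolding d norm_scaleR_sq by simp
    finally show ?thesis using pos by (simp add: field_simps power2_eq_square)
  qed
  (* The negative term |x' - x|^2 / \<eta> splits into two halves q: one for the noise, one for smoothness. *)
  define q where "q = (norm (x' - x))\<^sup>2 / (2 * \<eta>)"
  have noise: "- (2 * inner \<xi> (x' - x)) \<le> 2 * \<eta> * (norm \<xi>)\<^sup>2 + q"
    using young_inner[of "2 * \<eta>" \<xi> "- (x' - x)"] pos(1) unfolding inner_minus_right norm_minus_cancel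
    by (simp add: q_def)
  have absorb: "L * \<tau> * (norm (x' - x))\<^sup>2 \<le> q"
  proof -
    have "L * \<tau> \<le> 1 / (2 * \<eta>)" using pos by (simp add: field_simps)
    from mult_right_mono[OF this, of "(norm (x' - x))\<^sup>2"] show ?thesis by (simp add: q_def)
  qed
  have half: "(norm (x' - x))\<^sup>2 / \<eta> = q + q" by (simp add: q_def)
  have e1: "inner (h + \<xi>) (x' - xs)
      = inner h (x - xs) + inner h (x' - x) + inner \<xi> (x' - x) + inner \<xi> (x - xs)"
    by (simp add: inner_simps)
  have e2: "\<beta> * (norm (h + \<xi>))\<^sup>2 = \<beta> * (norm h)\<^sup>2 + 2 * (\<beta> * inner \<xi> h) + \<beta> * (norm \<xi>)\<^sup>2"
    by (simp add: norm_add_sq inner_commute algebra_simps)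
  have e3: "inner \<xi> (\<beta> *\<^sub>R h - (x - xs)) = \<beta> * inner \<xi> h - inner \<xi> (x - xs)"
    by (simp add: inner_diff_right)
  have e4: "(2 * \<eta> + \<beta>) * (norm \<xi>)\<^sup>2 = 2 * \<eta> * (norm \<xi>)\<^sup>2 + \<beta> * (norm \<xi>)\<^sup>2"
    by (simp add: algebra_simps)
  have e5: "2 / \<tau> * (D xg xs - D xf' xs) = 2 / \<tau> * D xg xs - 2 / \<tau> * D xf' xs"
    by (simp add: algebra_simps)
  show ?thesis
    using base hx hd noise absorb coer
    unfolding h_def[symmetric] e1 e2 e3 e4 e5 half by argo
qed

section \<open>One step of the dual variables under a consensus contraction\<close>

text \<open>
  Here \<open>pu\<close> stands for the projection of \<open>U\<close> off the consensus space and
  \<open>wu\<close> for \<open>W U\<close>. Subtracting \<open>W U\<close> removes a \<open>1 / K\<close> share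
  of the projected part of \<open>|U|\<^sup>2\<close>; half of it pays for the interaction of \<open>W U\<close>
  with the step \<open>d\<close>, at a price proportional to \<open>K\<close>.
\<close>

lemma contraction_imp_descent:
  fixes U d pu wu :: "'a::real_inner"
  assumes K: "1 \<le> K"
    and orth: "inner (U - pu) wu = 0"
    and contr: "(norm (pu - wu))\<^sup>2 \<le> (1 - 1 / K) * (norm pu)\<^sup>2"
  shows "(norm (U + \<sigma> *\<^sub>R d - wu))\<^sup>2
    \<le> (norm U)\<^sup>2 + 2 * \<sigma> * inner U d - (norm pu)\<^sup>2 / (2 * K) + 9 * K * \<sigma>\<^sup>2 * (norm d)\<^sup>2"
proof -
  have ow: "inner U wu = inner pu wu" using orth by (simp add: inner_diff_left)
  have 1: "(norm (U - wu))\<^sup>2 \<le> (norm U)\<^sup>2 - (norm pu)\<^sup>2 / K"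
    using contr unfolding norm_diff_sq ow by (simp add: algebra_simps)
  have "wu = pu - (pu - wu)" by simp
  then have "(norm wu)\<^sup>2 \<le> 2 * (norm pu)\<^sup>2 + 2 * (norm (pu - wu))\<^sup>2"
    using norm_diff_sq_le[of pu "pu - wu"] by simp
  also have "(norm (pu - wu))\<^sup>2 \<le> (norm pu)\<^sup>2"
  proof (rule order_trans[OF contr])
    have "(1 - 1 / K) * (norm pu)\<^sup>2 \<le> 1 * (norm pu)\<^sup>2" using K by (intro mult_right_mono) auto
    then show "(1 - 1 / K) * (norm pu)\<^sup>2 \<le> (norm pu)\<^sup>2" by simp
  qed
  finally have wu: "(norm wu)\<^sup>2 \<le> 4 * (norm pu)\<^sup>2" by simp
  have "2 * inner (- wu) (\<sigma> *\<^sub>R d) \<le> 1 / (8 * K) * (norm wu)\<^sup>2 + \<sigma>\<^sup>2 * (norm d)\<^sup>2 / (1 / (8 * K))"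
    using young_inner[of "1 / (8 * K)" "- wu" "\<sigma> *\<^sub>R d"] K unfolding norm_scaleR_sq by simp
  also have "1 / (8 * K) * (norm wu)\<^sup>2 \<le> 1 / (8 * K) * (4 * (norm pu)\<^sup>2)"
    using wu K by (intro mult_left_mono) auto
  finally have 2: "- (2 * \<sigma> * inner wu d) \<le> (norm pu)\<^sup>2 / (2 * K) + 8 * K * \<sigma>\<^sup>2 * (norm d)\<^sup>2"
    by (simp add: algebra_simps)
  have 3: "\<sigma>\<^sup>2 * (norm d)\<^sup>2 \<le> K * \<sigma>\<^sup>2 * (norm d)\<^sup>2"
    using mult_right_mono[of 1 K "\<sigma>\<^sup>2 * (norm d)\<^sup>2"] K by (simp add: mult.assoc)
  have half: "(norm pu)\<^sup>2 / K = (norm pu)\<^sup>2 / (2 * K) + (norm pu)\<^sup>2 / (2 * K)" by simp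
  have "U + \<sigma> *\<^sub>R d - wu = (U - wu) + \<sigma> *\<^sub>R d" by simp
  then have "(norm (U + \<sigma> *\<^sub>R d - wu))\<^sup>2
      = (norm (U - wu))\<^sup>2 + 2 * \<sigma> * inner U d - 2 * \<sigma> * inner wu d + \<sigma>\<^sup>2 * (norm d)\<^sup>2"
    by (simp only: norm_add_sq norm_scaleR_sq) (simp add: inner_diff_left algebra_simps)
  also have "\<dots> \<le> (norm U)\<^sup>2 - (norm pu)\<^sup>2 / K + 2 * \<sigma> * inner U d
      + ((norm pu)\<^sup>2 / (2 * K) + 8 * K * \<sigma>\<^sup>2 * (norm d)\<^sup>2) + K * \<sigma>\<^sup>2 * (norm d)\<^sup>2"
    using 1 2 3 by linarith
  also have "\<dots> = (norm U)\<^sup>2 + 2 * \<sigma> * inner U d - (norm pu)\<^sup>2 / (2 * K) + 9 * K * \<sigma>\<^sup>2 * (norm d)\<^sup>2"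
    unfolding half by (simp add: algebra_simps)
  finally show ?thesis .
qed

lemma extrapolation_inner_le:
  fixes U S Uf :: "'a::real_inner"
  assumes "U = \<sigma> *\<^sub>R S + (1 - \<sigma>) *\<^sub>R Uf" "\<sigma> \<le> 1"
  shows "- (2 * \<sigma> * inner U S) \<le> (1 - \<sigma>) * (norm Uf)\<^sup>2 - (1 + \<sigma>) * (norm U)\<^sup>2"
proof -
  have "\<sigma> *\<^sub>R S = U - (1 - \<sigma>) *\<^sub>R Uf" using assms by simp
  then have "\<sigma> * inner U S = (norm U)\<^sup>2 - (1 - \<sigma>) * inner U Uf"
    by (metis inner_scaleR_right inner_diff_right power2_norm_eq_inner)
  moreover have "(1 - \<sigma>) * (2 * inner U Uf) \<le> (1 - \<sigma>) * ((norm U)\<^sup>2 + (norm Uf)\<^sup>2)"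
    using young_inner[of 1 U Uf] assms by (intro mult_left_mono) auto
  ultimately show ?thesis by (simp add: algebra_simps)
qed

text \<open>The stored error stays bounded by the inputs \<open>w\<close> because only a fraction of it survives each step.\<close>

lemma residual_contraction:
  fixes p w :: "'a::real_inner"
  assumes K: "1 \<le> K" and contr: "(norm p')\<^sup>2 \<le> (1 - 1 / K) * (norm (p + w))\<^sup>2"
  shows "(norm p')\<^sup>2 \<le> (1 - 1 / (2 * K)) * (norm p)\<^sup>2 + 3 * K * (norm w)\<^sup>2"
proof -
  have "2 * inner p w \<le> 1 / (2 * K) * (norm p)\<^sup>2 + (norm w)\<^sup>2 / (1 / (2 * K))"
    using K by (intro young_inner) auto
  then have "(norm (p + w))\<^sup>2 \<le> (1 + 1 / (2 * K)) * (norm p)\<^sup>2 + (1 + 2 * K) * (norm w)\<^sup>2"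
    by (simp add: norm_add_sq algebra_simps)
  then have "(norm p')\<^sup>2
      \<le> (1 - 1 / K) * ((1 + 1 / (2 * K)) * (norm p)\<^sup>2 + (1 + 2 * K) * (norm w)\<^sup>2)"
    using K by (intro order_trans[OF contr] mult_left_mono) auto
  also have "\<dots> = ((1 - 1 / K) * (1 + 1 / (2 * K))) * (norm p)\<^sup>2
      + ((1 - 1 / K) * (1 + 2 * K)) * (norm w)\<^sup>2"
    by (simp only: distrib_left[of _ "_ * (norm p)\<^sup>2"] mult.assoc)
  also have "\<dots> \<le> (1 - 1 / (2 * K)) * (norm p)\<^sup>2 + 3 * K * (norm w)\<^sup>2"
    using K by (intro add_mono mult_right_mono) (auto simp: field_simps)
  finally show ?thesis .
qed

text \<open>
  The corrected iterate \<open>z - pm\<close> receives the exact projected gradient \<open>pu\<close>, so its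
  distance to \<open>zs\<close> obeys the usual expansion; the price is the cross terms with the stored error
  \<open>pm\<close>, which Young's inequality moves to \<open>|pu|\<^sup>2\<close> with an arbitrary weight
  \<open>c\<close> and to \<open>|pm|\<^sup>2\<close>.
\<close>

lemma error_feedback_step:
  fixes z zs zg pm pu Y U :: "'a::real_inner"
  assumes pos: "0 < \<gamma>" "0 < \<delta>" "0 < \<nu>" "4 * \<gamma> * \<delta> \<le> 1" "0 < c"
    and zh': "zh' = z - pm + (\<gamma> * \<delta>) *\<^sub>R (zg - z) - (\<gamma> / \<nu>) *\<^sub>R pu"
    and zg: "zg - zs = U - Y"
  shows "(norm (zh' - zs))\<^sup>2 / \<gamma> \<le> (1 / \<gamma> - \<delta> / 2) * (norm (z - pm - zs))\<^sup>2
    + 2 * \<delta> * (norm U)\<^sup>2 + 2 * \<delta> * (norm Y)\<^sup>2 - 2 / \<nu> * inner pu (z - zs)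
    + (c + 2 * \<gamma> / \<nu>\<^sup>2) * (norm pu)\<^sup>2 + (3 * \<delta> + 1 / (\<nu>\<^sup>2 * c)) * (norm pm)\<^sup>2"
proof -
  define e where "e = zg - z"
  define Z where "Z = z - zs"
  define v where "v = \<delta> *\<^sub>R e - (1 / \<nu>) *\<^sub>R pu"
  have "zh' - zs = (Z - pm) + \<gamma> *\<^sub>R v"
    by (simp add: zh' e_def Z_def v_def algebra_simps)
  then have "(norm (zh' - zs))\<^sup>2 = (norm (Z - pm))\<^sup>2 + 2 * (\<gamma> * inner v (Z - pm)) + \<gamma>\<^sup>2 * (norm v)\<^sup>2"
    by (simp only: norm_add_sq norm_scaleR_sq) (simp add: inner_commute)
  then have 0: "(norm (zh' - zs))\<^sup>2 / \<gamma> = 1 / \<gamma> * (norm (Z - pm))\<^sup>2 + 2 * inner v (Z - pm) + \<gamma> * (norm v)\<^sup>2"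
    using pos by (simp add: field_simps power2_eq_square)
  have iv: "2 * inner v (Z - pm) = 2 * (\<delta> * inner e Z) - 2 * (\<delta> * inner e pm)
      - 2 / \<nu> * inner pu Z + 2 / \<nu> * inner pu pm"
    by (simp add: v_def inner_diff_left inner_diff_right algebra_simps)
  have "2 * inner e Z = (norm (zg - zs))\<^sup>2 - (norm Z)\<^sup>2 - (norm e)\<^sup>2"
    by (simp add: e_def Z_def power2_norm_eq_inner inner_simps inner_commute)
  also have "(norm (zg - zs))\<^sup>2 \<le> 2 * (norm U)\<^sup>2 + 2 * (norm Y)\<^sup>2"
    unfolding zg by (rule norm_diff_sq_le)
  finally have "\<delta> * (2 * inner e Z) \<le> \<delta> * (2 * (norm U)\<^sup>2 + 2 * (norm Y)\<^sup>2 - (norm Z)\<^sup>2 - (norm e)\<^sup>2)"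
    using pos by (intro mult_left_mono) auto
  then have 1: "2 * (\<delta> * inner e Z)
      \<le> 2 * \<delta> * (norm U)\<^sup>2 + 2 * \<delta> * (norm Y)\<^sup>2 - \<delta> * (norm Z)\<^sup>2 - \<delta> * (norm e)\<^sup>2"
    by (simp add: algebra_simps)
  have "\<delta> * (2 * inner e (- pm)) \<le> \<delta> * (1 / 2 * (norm e)\<^sup>2 + (norm (- pm))\<^sup>2 / (1 / 2))"
    using pos by (intro mult_left_mono young_inner) auto
  then have 2: "- (2 * (\<delta> * inner e pm)) \<le> \<delta> * (norm e)\<^sup>2 / 2 + 2 * \<delta> * (norm pm)\<^sup>2"
    by (simp add: algebra_simps)
  have "\<delta> * (norm (Z - pm))\<^sup>2 \<le> \<delta> * (2 * (norm Z)\<^sup>2 + 2 * (norm pm)\<^sup>2)"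
    using pos by (intro mult_left_mono norm_diff_sq_le) auto
  then have 3: "\<delta> / 2 * (norm (Z - pm))\<^sup>2 \<le> \<delta> * (norm Z)\<^sup>2 + \<delta> * (norm pm)\<^sup>2"
    by (simp add: algebra_simps)
  have "\<gamma> * (norm v)\<^sup>2 \<le> \<gamma> * (2 * (\<delta>\<^sup>2 * (norm e)\<^sup>2) + 2 * ((1 / \<nu>)\<^sup>2 * (norm pu)\<^sup>2))"
    using norm_diff_sq_le[of "\<delta> *\<^sub>R e" "(1 / \<nu>) *\<^sub>R pu"] pos unfolding v_def norm_scaleR_sq
    by (intro mult_left_mono) auto
  also have "\<dots> = 2 * \<gamma> * \<delta> * \<delta> * (norm e)\<^sup>2 + 2 * \<gamma> / \<nu>\<^sup>2 * (norm pu)\<^sup>2"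
    by (simp add: algebra_simps power2_eq_square)
  also have "2 * \<gamma> * \<delta> * \<delta> * (norm e)\<^sup>2 \<le> \<delta> * (norm e)\<^sup>2 / 2"
    using mult_right_mono[OF pos(4), of "\<delta> * (norm e)\<^sup>2 / 2"] pos by (simp add: algebra_simps)
  finally have 4: "\<gamma> * (norm v)\<^sup>2 \<le> \<delta> * (norm e)\<^sup>2 / 2 + 2 * \<gamma> / \<nu>\<^sup>2 * (norm pu)\<^sup>2" by simp
  have "2 * inner pu ((1 / \<nu>) *\<^sub>R pm) \<le> c * (norm pu)\<^sup>2 + (1 / \<nu>)\<^sup>2 * (norm pm)\<^sup>2 / c"
    using young_inner[OF pos(5), of pu "(1 / \<nu>) *\<^sub>R pm"] unfolding norm_scaleR_sq .
  then have 5: "2 / \<nu> * inner pu pm \<le> c * (norm pu)\<^sup>2 + 1 / (\<nu>\<^sup>2 * c) * (norm pm)\<^sup>2"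
    by (simp add: power_divide)
  have e: "z - pm - zs = Z - pm" by (simp add: Z_def)
  show ?thesis
    unfolding e Z_def[symmetric] 0 iv using 1 2 3 4 5
    by argo
qed

text \<open>
  All dual estimates together. The gradient of the coupling term \<open>|y + z|\<^sup>2\<close> is tested
  against \<open>y' - y\<^sub>*\<close> in the \<open>y\<close> update but against \<open>z - z\<^sub>*\<close>
  in the \<open>z\<close> update; the difference is accounted for by \<open>contraction_imp_descent\<close>. The
  values of \<open>\<gamma>\<close>, \<open>\<delta>\<close> and \<open>C\<close> balance four budgets:
  \<open>|pu|\<^sup>2\<close> (supplied by the consensus descent), \<open>|pm|\<^sup>2\<close> (by the decay of
  the stored error), \<open>|U|\<^sup>2\<close> (by the coupling term) and \<open>|y\<^sub>g -
  y\<^sub>*|\<^sup>2\<close> (by one half of the decrease \<open>\<beta> |y' - y\<^sub>*|\<^sup>2\<close>).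
\<close>

lemma dual_consensus_step:
  fixes y y' yf ys z zf zs pm pm' pu wu :: "'a::real_inner" and \<sigma> \<nu> \<beta> K :: real
  assumes ug_def: "ug = \<sigma> *\<^sub>R (y + z) + (1 - \<sigma>) *\<^sub>R (yf + zf)"
    and yg_def: "yg = \<sigma> *\<^sub>R y + (1 - \<sigma>) *\<^sub>R yf"
    and us_def: "us = ys + zs"
    and \<gamma>_def: "\<gamma> = \<nu> / (40 * K\<^sup>2 * \<sigma>)"
    and \<delta>_def: "\<delta> = \<beta> / 16"
    and C_def: "C = 36 * K\<^sup>2 * \<sigma> / \<nu>"
    and par: "0 < \<sigma>" "\<sigma> \<le> 1" "0 < \<nu>" "0 < \<beta>" "\<beta> \<le> \<sigma> / \<nu>" "1 \<le> K"
    and uf': "uf' = ug + \<sigma> *\<^sub>R (y' - y) - wu"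
    and yf': "yf' = yg + \<sigma> *\<^sub>R (y' - y)"
    and zh': "zh' = z - pm + (\<gamma> * \<delta>) *\<^sub>R (ug - yg - z) - (\<gamma> / \<nu>) *\<^sub>R pu"
    and orth: "inner (ug - us - pu) wu = 0" "inner (ug - us - pu) (z - zs) = 0"
    and contr: "(norm (pu - wu))\<^sup>2 \<le> (1 - 1 / K) * (norm pu)\<^sup>2"
      "(norm pm')\<^sup>2 \<le> (1 - 1 / K) * (norm (pm + (\<gamma> / \<nu>) *\<^sub>R pu))\<^sup>2"
  shows "(norm (uf' - us))\<^sup>2 / (\<nu> * \<sigma>) + \<beta> / (2 * \<sigma>) * (1 - \<sigma> / 2) * (norm (yf' - ys))\<^sup>2
      + (norm (zh' - zs))\<^sup>2 / \<gamma> + C * (norm pm')\<^sup>2 - 2 / \<nu> * inner (ug - us) (y' - ys)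
    \<le> (1 - \<sigma>) * (norm (yf + zf - us))\<^sup>2 / (\<nu> * \<sigma>)
      + \<beta> / (2 * \<sigma>) * (1 - \<sigma>) * (norm (yf - ys))\<^sup>2
      + (1 / \<gamma> - \<delta> / 2) * (norm (z - pm - zs))\<^sup>2
      + C * (1 - 1 / (4 * K)) * (norm pm)\<^sup>2
      + \<beta> / 2 * (norm (y' - ys))\<^sup>2 + 10 * K * \<sigma> / \<nu> * (norm (y' - y))\<^sup>2"
proof -
  define U where "U = ug - us"
  define S where "S = y + z - us"
  define Uf where "Uf = yf + zf - us"
  define d where "d = y' - y"
  define Y where "Y = yg - ys"
  define a where "a = 1 / (\<nu> * \<sigma>)"
  have a: "0 < a" using par by (simp add: a_def)
  have U: "U = \<sigma> *\<^sub>R S + (1 - \<sigma>) *\<^sub>R Uf"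
    by (simp add: U_def S_def Uf_def ug_def algebra_simps)
  have ufU: "uf' - us = U + \<sigma> *\<^sub>R d - wu" by (simp add: uf' U_def d_def)
  have s1: "(norm (uf' - us))\<^sup>2
      \<le> (norm U)\<^sup>2 + 2 * \<sigma> * inner U d - (norm pu)\<^sup>2 / (2 * K) + 9 * K * \<sigma>\<^sup>2 * (norm d)\<^sup>2"
    unfolding ufU using orth(1) by (intro contraction_imp_descent[OF par(6) _ contr(1)]) (simp add: U_def)
  have s2: "- (2 * \<sigma> * inner U S) \<le> (1 - \<sigma>) * (norm Uf)\<^sup>2 - (1 + \<sigma>) * (norm U)\<^sup>2"
    by (rule extrapolation_inner_le[OF U par(2)])
  have split: "inner U (y' - ys) = inner U d + inner U S - inner pu (z - zs)"
  proof -
    have "y' - ys = d + S - (z - zs)" by (simp add: d_def S_def us_def)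
    moreover have "inner U (z - zs) = inner pu (z - zs)"
      using orth(2) by (simp add: U_def inner_diff_left)
    ultimately show ?thesis by (simp add: inner_simps)
  qed
  have "a * ((norm (uf' - us))\<^sup>2 - 2 * \<sigma> * inner U d - 2 * \<sigma> * inner U S)
     \<le> a * ((1 - \<sigma>) * (norm Uf)\<^sup>2 - \<sigma> * (norm U)\<^sup>2 - (norm pu)\<^sup>2 / (2 * K) + 9 * K * \<sigma>\<^sup>2 * (norm d)\<^sup>2)"
    using s1 s2 a by (intro mult_left_mono) (auto simp: algebra_simps)
  moreover have "a * (2 * \<sigma> * t) = 2 / \<nu> * t" "a * (\<sigma> * t) = 1 / \<nu> * t"
     "a * (9 * K * \<sigma>\<^sup>2 * t) = 9 * K * \<sigma> / \<nu> * t" for t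
    using par by (simp_all add: a_def power2_eq_square)
  ultimately have A: "a * (norm (uf' - us))\<^sup>2 - 2 / \<nu> * inner U d - 2 / \<nu> * inner U S
     \<le> a * ((1 - \<sigma>) * (norm Uf)\<^sup>2) - 1 / \<nu> * (norm U)\<^sup>2 - a * ((norm pu)\<^sup>2 / (2 * K))
        + 9 * K * \<sigma> / \<nu> * (norm d)\<^sup>2"
    by (simp only: right_diff_distrib distrib_left)
  have gd: "4 * \<gamma> * \<delta> \<le> 1"
  proof -
    have "\<beta> * \<nu> \<le> \<sigma>" using par by (simp add: field_simps)
    moreover have "\<sigma> \<le> 160 * K\<^sup>2 * \<sigma>"
    proof -
      have "1 \<le> 160 * K\<^sup>2" using one_le_power[OF par(6), of 2] by linarith
      from mult_right_mono[OF this, of \<sigma>] show ?thesis using par by simp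
    qed
    ultimately have "\<beta> * \<nu> \<le> 160 * K\<^sup>2 * \<sigma>" by linarith
    then show ?thesis using par by (simp add: \<gamma>_def \<delta>_def field_simps)
  qed
  have \<gamma>: "0 < \<gamma>" and \<delta>: "0 < \<delta>" using par by (simp_all add: \<gamma>_def \<delta>_def)
  define c where "c = a / (8 * K)"
  have c: "0 < c" using a par by (simp add: c_def)
  have "ug - yg - zs = U - Y" by (simp add: U_def Y_def us_def)
  from error_feedback_step[OF \<gamma> \<delta> par(3) gd c zh' this]
  have Z: "(norm (zh' - zs))\<^sup>2 / \<gamma> \<le> (1 / \<gamma> - \<delta> / 2) * (norm (z - pm - zs))\<^sup>2
    + 2 * \<delta> * (norm U)\<^sup>2 + 2 * \<delta> * (norm Y)\<^sup>2 - 2 / \<nu> * inner pu (z - zs)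
    + (c + 2 * \<gamma> / \<nu>\<^sup>2) * (norm pu)\<^sup>2 + (3 * \<delta> + 1 / (\<nu>\<^sup>2 * c)) * (norm pm)\<^sup>2" .
  have C: "0 \<le> C" using par by (simp add: C_def)
  have M: "C * (norm pm')\<^sup>2 \<le> C * (1 - 1 / (2 * K)) * (norm pm)\<^sup>2 + C * (3 * K * (\<gamma> / \<nu>)\<^sup>2) * (norm pu)\<^sup>2"
    using mult_left_mono[OF residual_contraction[OF par(6) contr(2)] C]
    unfolding norm_scaleR_sq by (simp add: algebra_simps)
  have "yf' = \<sigma> *\<^sub>R y' + (1 - \<sigma>) *\<^sub>R yf" by (simp add: yf' yg_def algebra_simps)
  then have "yf' - ys = \<sigma> *\<^sub>R (y' - ys) + (1 - \<sigma>) *\<^sub>R (yf - ys)" by (simp add: algebra_simps)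
  then have "(norm (yf' - ys))\<^sup>2 \<le> \<sigma> * (norm (y' - ys))\<^sup>2 + (1 - \<sigma>) * (norm (yf - ys))\<^sup>2"
    using norm_convex_comb_sq[of \<sigma>] par by simp
  then have "\<beta> / (2 * \<sigma>) * (norm (yf' - ys))\<^sup>2
      \<le> \<beta> / (2 * \<sigma>) * (\<sigma> * (norm (y' - ys))\<^sup>2 + (1 - \<sigma>) * (norm (yf - ys))\<^sup>2)"
    using par by (intro mult_left_mono) auto
  then have Y1: "\<beta> / (2 * \<sigma>) * (norm (yf' - ys))\<^sup>2
      \<le> \<beta> / 2 * (norm (y' - ys))\<^sup>2 + \<beta> / (2 * \<sigma>) * (1 - \<sigma>) * (norm (yf - ys))\<^sup>2"
    using par by (simp add: distrib_left)
  have "Y = (yf' - ys) - \<sigma> *\<^sub>R d" by (simp add: Y_def yf' d_def)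
  then have "(norm Y)\<^sup>2 \<le> 2 * (norm (yf' - ys))\<^sup>2 + 2 * (\<sigma>\<^sup>2 * (norm d)\<^sup>2)"
    using norm_diff_sq_le[of "yf' - ys" "\<sigma> *\<^sub>R d"] unfolding norm_scaleR_sq by simp
  then have "\<beta> / 8 * (norm Y)\<^sup>2 \<le> \<beta> / 8 * (2 * (norm (yf' - ys))\<^sup>2 + 2 * (\<sigma>\<^sup>2 * (norm d)\<^sup>2))"
    using par by (intro mult_left_mono) auto
  then have Y2: "2 * \<delta> * (norm Y)\<^sup>2 \<le> \<beta> / 4 * (norm (yf' - ys))\<^sup>2 + \<beta> * \<sigma>\<^sup>2 / 4 * (norm d)\<^sup>2"
    by (simp add: \<delta>_def algebra_simps)
  have Y3: "\<beta> / (2 * \<sigma>) * (1 - \<sigma> / 2) * (norm (yf' - ys))\<^sup>2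
      = \<beta> / (2 * \<sigma>) * (norm (yf' - ys))\<^sup>2 - \<beta> / 4 * (norm (yf' - ys))\<^sup>2"
    using par by (simp add: field_simps)
  (* What is left over is covered by the supply, in turn for |U|^2, |d|^2, |pm|^2 and |pu|^2. *)
  have cU: "2 * \<delta> * (norm U)\<^sup>2 \<le> 1 / \<nu> * (norm U)\<^sup>2"
  proof (rule mult_right_mono)
    have "\<sigma> / \<nu> \<le> 1 / \<nu>" using par by (intro divide_right_mono) auto
    then have "\<beta> \<le> 1 / \<nu>" using par by linarith
    then show "2 * \<delta> \<le> 1 / \<nu>" using par(4) unfolding \<delta>_def by linarith
  qed simp
  have cd: "\<beta> * \<sigma>\<^sup>2 / 4 * (norm d)\<^sup>2 + 9 * K * \<sigma> / \<nu> * (norm d)\<^sup>2 \<le> 10 * K * \<sigma> / \<nu> * (norm d)\<^sup>2"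
  proof -
    have "\<beta> * \<sigma>\<^sup>2 \<le> \<sigma> / \<nu> * 1" using par by (intro mult_mono) (auto simp: power_le_one)
    also have "\<dots> \<le> K * \<sigma> / \<nu>" using par by (simp add: field_simps)
    finally have "\<beta> * \<sigma>\<^sup>2 \<le> K * \<sigma> / \<nu>" .
    moreover have "0 \<le> \<beta> * \<sigma>\<^sup>2" using par by simp
    ultimately have "\<beta> * \<sigma>\<^sup>2 / 4 \<le> K * \<sigma> / \<nu>" by linarith
    from mult_right_mono[OF this, of "(norm d)\<^sup>2"] show ?thesis by (simp add: algebra_simps)
  qed
  have cpm: "(3 * \<delta> + 1 / (\<nu>\<^sup>2 * c)) * (norm pm)\<^sup>2 + C * (1 - 1 / (2 * K)) * (norm pm)\<^sup>2
     \<le> C * (1 - 1 / (4 * K)) * (norm pm)\<^sup>2"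
  proof -
    have "1 / (\<nu>\<^sup>2 * c) = 8 * (K * \<sigma> / \<nu>)" using par by (simp add: c_def a_def field_simps power2_eq_square)
    moreover have "3 * \<delta> \<le> K * \<sigma> / \<nu>"
    proof -
      have "3 * \<delta> \<le> \<sigma> / \<nu>" using par(4,5) unfolding \<delta>_def by linarith
      also have "\<dots> \<le> K * \<sigma> / \<nu>" using par by (simp add: field_simps)
      finally show ?thesis .
    qed
    moreover have "C * (1 - 1 / (4 * K)) - C * (1 - 1 / (2 * K)) = 9 * (K * \<sigma> / \<nu>)"
      using par by (simp add: C_def field_simps power2_eq_square)
    ultimately have "3 * \<delta> + 1 / (\<nu>\<^sup>2 * c) + C * (1 - 1 / (2 * K)) \<le> C * (1 - 1 / (4 * K))" by argo
    from mult_right_mono[OF this, of "(norm pm)\<^sup>2"] show ?thesis by (simp only: distrib_right) simp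
  qed
  have cpu: "(c + 2 * \<gamma> / \<nu>\<^sup>2) * (norm pu)\<^sup>2 + C * (3 * K * (\<gamma> / \<nu>)\<^sup>2) * (norm pu)\<^sup>2
      \<le> a * ((norm pu)\<^sup>2 / (2 * K))"
  proof -
    define q where "q = a / K"
    have q: "0 \<le> q" using a par by (simp add: q_def)
    have "2 * \<gamma> / \<nu>\<^sup>2 = q / (20 * K)"
      using par by (simp add: \<gamma>_def q_def a_def field_simps power2_eq_square)
    also have "\<dots> \<le> q / 20" using par q by (intro divide_left_mono) auto
    finally have "2 * \<gamma> / \<nu>\<^sup>2 \<le> q / 20" .
    moreover have "C * (3 * K * (\<gamma> / \<nu>)\<^sup>2) = 108 / 1600 * q"
      using par by (simp add: C_def \<gamma>_def q_def a_def field_simps power2_eq_square)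
    moreover have "c = q / 8" by (simp add: c_def q_def)
    ultimately have "c + 2 * \<gamma> / \<nu>\<^sup>2 + C * (3 * K * (\<gamma> / \<nu>)\<^sup>2) \<le> q / 2" using q by linarith
    from mult_right_mono[OF this, of "(norm pu)\<^sup>2"] show ?thesis
      by (simp only: distrib_right) (simp add: q_def)
  qed
  have e1: "(norm (uf' - us))\<^sup>2 / (\<nu> * \<sigma>) = a * (norm (uf' - us))\<^sup>2"
    and e2: "(1 - \<sigma>) * (norm (yf + zf - us))\<^sup>2 / (\<nu> * \<sigma>) = a * ((1 - \<sigma>) * (norm Uf)\<^sup>2)"
    by (simp_all add: a_def Uf_def)
  have e3: "2 / \<nu> * inner (ug - us) (y' - ys)
     = 2 / \<nu> * inner U d + 2 / \<nu> * inner U S - 2 / \<nu> * inner pu (z - zs)"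
    unfolding U_def[symmetric] split by (simp only: right_diff_distrib distrib_left)
  show ?thesis
    unfolding e1 e2 e3 Y3 d_def[symmetric]
    using A Z M Y1 Y2 cU cd cpm cpu by argo
qed

section \<open>Gradients and Bregman divergences on a coordinate subspace\<close>

lemmas Rd_closed [intro, simp] = subspace_0[OF subspace_Rd] subspace_add[OF subspace_Rd]
  subspace_diff[OF subspace_Rd] subspace_scale[OF subspace_Rd] subspace_sum[OF subspace_Rd]

lemma ex_unit_Rd:
  assumes "1 \<le> d"
  obtains e where "e \<in> Rd d" "norm e = 1"
proof -
  define e where "e = Fvec (\<lambda>i. if i = 0 then 1 else 0)"
  have c: "coord e = (\<lambda>i. if i = 0 then 1 else 0)"
    unfolding e_def by (rule Fvec_inverse) simp
  have e: "e \<in> Rd d" using assms by (auto simp: Rd_def c)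
  have "inner e e = (\<Sum>i<d. (if i = 0 then 1 else 0))"
    unfolding inner_Rd[OF e] by (intro sum.cong) (auto simp: c)
  also have "\<dots> = 1" using assms by (subst sum.delta) auto
  finally have "norm e = 1" by (simp add: norm_eq_sqrt_inner)
  with e that show thesis by blast
qed

lemma is_grad_line:
  assumes "is_grad d f (v + t *\<^sub>R h) a" "v \<in> Rd d" "h \<in> Rd d"
  shows "((\<lambda>t. f (v + t *\<^sub>R h)) has_real_derivative inner a h) (at t)"
proof -
  have "((\<lambda>t. f (v + t *\<^sub>R h)) has_derivative (\<lambda>s. inner a (s *\<^sub>R h))) (at t within UNIV)"
  proof (rule has_derivative_in_compose[where f = "\<lambda>t. v + t *\<^sub>R h" and f' = "\<lambda>s. s *\<^sub>R h"])
    show "((\<lambda>t. v + t *\<^sub>R h) has_derivative (\<lambda>s. s *\<^sub>R h)) (at t)"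
      using has_derivative_add[OF has_derivative_const[of v]
          has_derivative_scaleR_left[OF has_derivative_ident, of h]] by simp
    show "(f has_derivative inner a) (at (v + t *\<^sub>R h) within (\<lambda>t. v + t *\<^sub>R h) ` UNIV)"
    proof (rule has_derivative_subset)
      show "(f has_derivative inner a) (at (v + t *\<^sub>R h) within Rd d)"
        using assms(1) unfolding is_grad_def by blast
      show "(\<lambda>t. v + t *\<^sub>R h) ` UNIV \<subseteq> Rd d" using assms(2,3) by auto
    qed
  qed
  then show ?thesis by (simp add: has_field_derivative_def mult_commute_abs)
qed

lemma is_grad_in_Rd: "is_grad d f u a \<Longrightarrow> a \<in> Rd d"
  by (simp add: is_grad_def)

text \<open>Testing along the line in direction \<open>a - b\<close> suffices, since both gradients lie in the subspace.\<close>

lemma is_grad_unique: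
  assumes "is_grad d f u a" "is_grad d f u b" "u \<in> Rd d"
  shows "a = b"
proof -
  define h where "h = a - b"
  have h: "h \<in> Rd d" unfolding h_def by (intro Rd_closed is_grad_in_Rd[OF assms(1)] is_grad_in_Rd[OF assms(2)])
  have "inner a h = inner b h"
  proof (rule DERIV_unique)
    show "((\<lambda>t. f (u + t *\<^sub>R h)) has_real_derivative inner a h) (at 0)"
      by (rule is_grad_line[OF _ assms(3) h]) (simp add: assms(1))
    show "((\<lambda>t. f (u + t *\<^sub>R h)) has_real_derivative inner b h) (at 0)"
      by (rule is_grad_line[OF _ assms(3) h]) (simp add: assms(2))
  qed
  then have "inner (a - b) h = 0" by (simp add: inner_diff_left)
  then show ?thesis unfolding h_def by simp
qed

lemma grad_eq:
  assumes "is_grad d f u a" "u \<in> Rd d"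
  shows "grad d f u = a"
  unfolding grad_def
proof (rule the_equality)
  show "b = a" if "is_grad d f u b" for b using is_grad_unique[OF that assms] .
qed (rule assms)

lemma smooth_is_grad:
  assumes "smooth_fun d l f" "u \<in> Rd d"
  shows "is_grad d f u (grad d f u)"
proof -
  obtain a where a: "is_grad d f u a" using assms unfolding smooth_fun_def by blast
  then show ?thesis using grad_eq[OF a assms(2)] by simp
qed

lemma smooth_grad_in_Rd:
  assumes "smooth_fun d l f" "u \<in> Rd d"
  shows "grad d f u \<in> Rd d"
  by (rule is_grad_in_Rd[OF smooth_is_grad[OF assms]])

lemma smooth_grad_lipschitz:
  "smooth_fun d l f \<Longrightarrow> u \<in> Rd d \<Longrightarrow> v \<in> Rd d \<Longrightarrow> norm (grad d f u - grad d f v) \<le> l * norm (u - v)"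
  unfolding smooth_fun_def by blast

lemma smooth_const_nonneg:
  assumes "smooth_fun d l f" "1 \<le> d"
  shows "0 \<le> l"
proof -
  obtain e where e: "e \<in> Rd d" "norm e = 1" using ex_unit_Rd assms by blast
  have "norm (grad d f e - grad d f 0) \<le> l * norm (e - 0)"
    using assms e unfolding smooth_fun_def by blast
  with e have "norm (grad d f e - grad d f 0) \<le> l" by simp
  then show ?thesis by (rule order_trans[OF norm_ge_zero])
qed

lemma smooth_bregman_le:
  assumes f: "smooth_fun d l f" and uv: "u \<in> Rd d" "v \<in> Rd d"
  shows "bregman f (grad d f) u v \<le> l / 2 * (norm (u - v))\<^sup>2"
proof -
  define h where "h = u - v"
  have h: "h \<in> Rd d" using uv by (simp add: h_def)
  define \<phi> where "\<phi> t = f (v + t *\<^sub>R h) - t * inner (grad d f v) h - l / 2 * t\<^sup>2 * (norm h)\<^sup>2" for t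
  have D: "\<exists>y. (\<phi> has_real_derivative y) (at t) \<and> y \<le> 0" if t: "0 \<le> t" "t \<le> 1" for t
  proof (intro exI conjI)
    have w: "v + t *\<^sub>R h \<in> Rd d" using uv h by simp
    show "(\<phi> has_real_derivative inner (grad d f (v + t *\<^sub>R h)) h - inner (grad d f v) h
        - l * t * (norm h)\<^sup>2) (at t)"
      unfolding \<phi>_def
      by (rule derivative_eq_intros is_grad_line[OF smooth_is_grad[OF f w] uv(2) h] refl | simp)+
    have "inner (grad d f (v + t *\<^sub>R h) - grad d f v) h \<le> norm (grad d f (v + t *\<^sub>R h) - grad d f v) * norm h"
      by (rule norm_cauchy_schwarz)
    also have "\<dots> \<le> (l * norm (t *\<^sub>R h)) * norm h"
      using smooth_grad_lipschitz[OF f w uv(2)] by (intro mult_right_mono) auto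
    finally show "inner (grad d f (v + t *\<^sub>R h)) h - inner (grad d f v) h - l * t * (norm h)\<^sup>2 \<le> 0"
      using t by (simp add: inner_diff_left power2_eq_square algebra_simps)
  qed
  have "\<phi> 1 \<le> \<phi> 0" by (rule DERIV_nonpos_imp_nonincreasing[OF _ D]) simp_all
  then show ?thesis by (simp add: \<phi>_def bregman_def h_def)
qed

lemma strongly_convex_bregman_ge:
  assumes sc: "strongly_convex d \<mu> f" and g: "is_grad d f v (grad d f v)"
    and uv: "u \<in> Rd d" "v \<in> Rd d"
  shows "\<mu> / 2 * (norm (u - v))\<^sup>2 \<le> bregman f (grad d f) u v"
proof (rule ccontr)
  assume neg: "\<not> ?thesis"
  define h where "h = u - v"
  have h: "h \<in> Rd d" using uv by (simp add: h_def)
  define \<phi> where "\<phi> t = t * f u + (1 - t) * f v - \<mu> / 2 * t * (1 - t) * (norm h)\<^sup>2 - f (v + t *\<^sub>R h)" for t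
  have "is_grad d f (v + 0 *\<^sub>R h) (grad d f v)" using g by simp
  note line = is_grad_line[OF this uv(2) h]
  have "(\<phi> has_real_derivative f u - f v - \<mu> / 2 * (norm h)\<^sup>2 - inner (grad d f v) h) (at 0)"
    unfolding \<phi>_def by (rule derivative_eq_intros line refl | simp)+
  moreover have "f u - f v - \<mu> / 2 * (norm h)\<^sup>2 - inner (grad d f v) h < 0"
    using neg by (simp add: bregman_def h_def)
  ultimately obtain r where r: "0 < r" "\<And>t. 0 < t \<Longrightarrow> t < r \<Longrightarrow> \<phi> (0 + t) < \<phi> 0"
    using DERIV_neg_dec_right by blast
  define t where "t = min 1 (r / 2)"
  have t: "0 < t" "t < r" "t \<le> 1" using r by (auto simp: t_def)
  have "\<phi> t < 0" using r(2)[OF t(1,2)] by (simp add: \<phi>_def)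
  moreover have "v + t *\<^sub>R h = t *\<^sub>R u + (1 - t) *\<^sub>R v" by (simp add: h_def algebra_simps)
  then have "0 \<le> \<phi> t" using sc uv t by (auto simp: \<phi>_def strongly_convex_def h_def)
  ultimately show False by simp
qed

lemma convex_imp_strongly_convex_0:
  assumes "convex_on (Rd d) f"
  shows "strongly_convex d 0 f"
  unfolding strongly_convex_def
proof (intro ballI)
  fix u v :: fvec and t :: real assume "u \<in> Rd d" "v \<in> Rd d" "t \<in> {0..1}"
  then show "f (t *\<^sub>R u + (1 - t) *\<^sub>R v) \<le> t * f u + (1 - t) * f v - 0 / 2 * t * (1 - t) * (norm (u - v))\<^sup>2"
    using convex_onD[OF assms, of t v u] by (auto simp: add.commute)
qed

text \<open>
  The Bregman divergence \<open>w \<mapsto> D(w, v)\<close> is nonnegative and smooth; one gradient step of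
  length \<open>1 / l\<close> from \<open>u\<close> decreases it by \<open>|g u - g v|\<^sup>2 / (2 l)\<close>.
\<close>

lemma cocoercive:
  fixes f :: "'a::real_inner \<Rightarrow> real"
  assumes S: "subspace S" "\<And>u. u \<in> S \<Longrightarrow> g u \<in> S" and "0 < l"
    and nonneg: "\<And>u v. u \<in> S \<Longrightarrow> v \<in> S \<Longrightarrow> 0 \<le> bregman f g u v"
    and upper: "\<And>u v. u \<in> S \<Longrightarrow> v \<in> S \<Longrightarrow> bregman f g u v \<le> l / 2 * (norm (u - v))\<^sup>2"
    and uv: "u \<in> S" "v \<in> S"
  shows "(norm (g u - g v))\<^sup>2 \<le> 2 * l * bregman f g u v"
proof -
  define w where "w = u - (1 / l) *\<^sub>R (g u - g v)"
  have w: "w \<in> S" unfolding w_def using S uv by (intro subspace_diff subspace_scale) auto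
  have "0 \<le> bregman f g w v" using nonneg w uv by simp
  also have "\<dots> = bregman f g u v - inner (g u - g v) (u - w) + bregman f g w u"
    using bregman_three_point[of g u v w f] by simp
  also have "inner (g u - g v) (u - w) = (norm (g u - g v))\<^sup>2 / l"
    by (simp add: w_def power2_norm_eq_inner)
  also have "bregman f g w u \<le> l / 2 * (norm (w - u))\<^sup>2" using upper w uv by simp
  also have "(norm (w - u))\<^sup>2 = (norm (g u - g v))\<^sup>2 / l\<^sup>2"
    by (simp add: w_def power_divide)
  finally show ?thesis using \<open>0 < l\<close> by (simp add: field_simps power2_eq_square)
qed

lemma smooth_convex_cocoercive:
  assumes f: "smooth_fun d l f" "convex_on (Rd d) f" "1 \<le> d" and uv: "u \<in> Rd d" "v \<in> Rd d"
  shows "(norm (grad d f u - grad d f v))\<^sup>2 \<le> 2 * l * bregman f (grad d f) u v"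
proof (cases "l = 0")
  case True
  then show ?thesis using smooth_grad_lipschitz[OF f(1) uv] by simp
next
  case False
  then have "0 < l" using smooth_const_nonneg[OF f(1,3)] by simp
  show ?thesis
  proof (rule cocoercive[OF subspace_Rd[of d] _ \<open>0 < l\<close> _ _ uv])
    show "0 \<le> bregman f (grad d f) u v" if "u \<in> Rd d" "v \<in> Rd d" for u v
      using strongly_convex_bregman_ge[OF convex_imp_strongly_convex_0[OF f(2)] smooth_is_grad[OF f(1) that(2)] that]
      by simp
  qed (use smooth_bregman_le[OF f(1)] smooth_grad_in_Rd[OF f(1)] in blast)+
qed

lemma bregman_quadratic_shift:
  "bregman (\<lambda>u. f u - \<nu> / 2 * (norm u)\<^sup>2) (\<lambda>u. g u - \<nu> *\<^sub>R u) u v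
     = bregman f g u v - \<nu> / 2 * (norm (u - v))\<^sup>2"
  by (simp add: bregman_def power2_norm_eq_inner inner_simps inner_commute algebra_simps)

lemma is_grad_average:
  assumes "finite J" "\<And>j. j \<in> J \<Longrightarrow> is_grad d (f j) u (g j)"
  shows "is_grad d (\<lambda>u. (\<Sum>j\<in>J. f j u) / c) u ((1 / c) *\<^sub>R (\<Sum>j\<in>J. g j))"
  unfolding is_grad_def
proof
  show "(1 / c) *\<^sub>R (\<Sum>j\<in>J. g j) \<in> Rd d" using assms by (simp add: is_grad_def)
  have "((\<lambda>u. (1 / c) * (\<Sum>j\<in>J. f j u)) has_derivative (\<lambda>h. (1 / c) * (\<Sum>j\<in>J. inner (g j) h))) (at u within Rd d)"
    using assms by (intro has_derivative_mult_right has_derivative_sum) (auto simp: is_grad_def)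
  then show "((\<lambda>u. (\<Sum>j\<in>J. f j u) / c) has_derivative (\<lambda>h. inner ((1 / c) *\<^sub>R (\<Sum>j\<in>J. g j)) h)) (at u within Rd d)"
    by (simp add: inner_sum_left)
qed

lemma bregman_average:
  assumes "\<And>u. f u = (\<Sum>j\<in>J. fj j u) / c" "g v = (1 / c) *\<^sub>R (\<Sum>j\<in>J. gj j v)"
  shows "bregman f g u v = (\<Sum>j\<in>J. bregman (fj j) (gj j) u v) / c"
  by (simp add: bregman_def assms inner_sum_left sum_subtractf diff_divide_distrib)

lemma is_grad_minimizer:
  assumes "is_grad d f u a" "u \<in> Rd d" "\<And>v. v \<in> Rd d \<Longrightarrow> f u \<le> f v"
  shows "a = 0"
proof -
  have a: "a \<in> Rd d" using assms by (simp add: is_grad_def)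
  have "((\<lambda>t. f (u + t *\<^sub>R a)) has_real_derivative inner a a) (at 0)"
    using is_grad_line[of d f u 0 a a] assms a by simp
  then have "inner a a = 0"
    by (rule DERIV_local_min[of _ _ _ 1]) (use assms a in auto)
  then show ?thesis by simp
qed

section \<open>Stacked variables and gossip matrices\<close>

declare One_nat_def [simp del]

text \<open>
  Encoding the pair of node and coordinate as one natural number embeds the stacked space isometrically into
  \<open>fvec\<close> (\<open>norm_stack\<close>), so the inequalities for inner product spaces apply to stacked
  variables.
\<close>

definition stack :: "nat \<Rightarrow> stacked \<Rightarrow> fvec" where
  "stack m x = Fvec (\<lambda>c. if fst (prod_decode c) \<in> {1..m}
     then coord (x (fst (prod_decode c))) (snd (prod_decode c)) else 0)"

lemma coord_stack:
  "coord (stack m x) c = (if fst (prod_decode c) \<in> {1..m}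
     then coord (x (fst (prod_decode c))) (snd (prod_decode c)) else 0)"
proof -
  have "{c. (if fst (prod_decode c) \<in> {1..m}
     then coord (x (fst (prod_decode c))) (snd (prod_decode c)) else 0) \<noteq> 0}
      \<subseteq> prod_encode ` (SIGMA i:{1..m}. {k. coord (x i) k \<noteq> 0})"
  proof
    fix c assume c: "c \<in> {c. (if fst (prod_decode c) \<in> {1..m}
     then coord (x (fst (prod_decode c))) (snd (prod_decode c)) else 0) \<noteq> 0}"
    have "c = prod_encode (prod_decode c)" by simp
    moreover have "prod_decode c \<in> (SIGMA i:{1..m}. {k. coord (x i) k \<noteq> 0})"
      using c by (cases "prod_decode c") (auto split: if_splits)
    ultimately show "c \<in> prod_encode ` (SIGMA i:{1..m}. {k. coord (x i) k \<noteq> 0})" by (rule image_eqI)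
  qed
  moreover have "finite (prod_encode ` (SIGMA i:{1..m}. {k. coord (x i) k \<noteq> 0}))"
    by (intro finite_imageI finite_SigmaI) (auto simp: finite_coord)
  ultimately have "finite {c. (if fst (prod_decode c) \<in> {1..m}
     then coord (x (fst (prod_decode c))) (snd (prod_decode c)) else 0) \<noteq> 0}"
    by (rule finite_subset)
  then show ?thesis unfolding stack_def by (subst Fvec_inverse[OF CollectI]) (assumption, rule refl)
qed

lemma stack_add: "stack m (\<lambda>i. x i + y i) = stack m x + stack m y"
  and stack_diff: "stack m (\<lambda>i. x i - y i) = stack m x - stack m y"
  and stack_scaleR: "stack m (\<lambda>i. c *\<^sub>R x i) = c *\<^sub>R stack m x"
  by (rule fvec_eqI, simp add: coord_stack)+

lemmas stack_simps = stack_add stack_diff stack_scaleR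

lemma stack_cong: "(\<And>i. i \<in> {1..m} \<Longrightarrow> x i = y i) \<Longrightarrow> stack m x = stack m y"
  by (rule fvec_eqI) (simp add: coord_stack)

lemma inner_stack: "inner (stack m x) (stack m y) = (\<Sum>i=1..m. inner (x i) (y i))"
proof -
  define S where "S = (SIGMA i:{1..m}. {k. coord (x i) k \<noteq> 0})"
  have S: "finite S" unfolding S_def by (intro finite_SigmaI) (auto simp: finite_coord)
  have "{c. coord (stack m x) c \<noteq> 0} \<subseteq> prod_encode ` S"
  proof
    fix c assume c: "c \<in> {c. coord (stack m x) c \<noteq> 0}"
    have "c = prod_encode (prod_decode c)" by simp
    moreover have "prod_decode c \<in> S"
      using c by (cases "prod_decode c") (auto simp: S_def coord_stack split: if_splits)
    ultimately show "c \<in> prod_encode ` S" by (rule image_eqI)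
  qed
  then have "inner (stack m x) (stack m y)
      = (\<Sum>c\<in>prod_encode ` S. coord (stack m x) c * coord (stack m y) c)"
    using S by (intro inner_fvec_superset) auto
  also have "\<dots> = (\<Sum>(i, k)\<in>S. coord (x i) k * coord (y i) k)"
    by (subst sum.reindex) (auto simp: inj_prod_encode coord_stack S_def intro!: sum.cong)
  also have "\<dots> = (\<Sum>i=1..m. inner (x i) (y i))"
    unfolding S_def inner_fvec_def by (subst sum.Sigma) (auto simp: finite_coord)
  finally show ?thesis .
qed

lemma norm_stack: "(norm (stack m x))\<^sup>2 = sqnorm m x"
  by (simp add: power2_norm_eq_inner inner_stack sqnorm_def)

lemma sqnorm_nonneg: "0 \<le> sqnorm m x"
  by (simp add: sqnorm_def sum_nonneg)

lemma sqnorm_cong: "(\<And>i. i \<in> {1..m} \<Longrightarrow> x i = y i) \<Longrightarrow> sqnorm m x = sqnorm m y"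
  by (simp add: sqnorm_def)

lemma kron_diff: "kron_apply m A (\<lambda>i. x i - y i) i = kron_apply m A x i - kron_apply m A y i"
  by (simp add: kron_apply_def scaleR_right_diff_distrib sum_subtractf)

lemma kron_const: "kron_apply m A (\<lambda>_. c) i = (\<Sum>j=1..m. A i j) *\<^sub>R c"
  by (simp add: kron_apply_def scaleR_left.sum)

lemma sum_kron: "(\<Sum>i=1..m. kron_apply m A x i) = (\<Sum>j=1..m. (\<Sum>i=1..m. A i j) *\<^sub>R x j)"
  unfolding kron_apply_def scaleR_left.sum by (rule sum.swap)

lemma kron_mat_mult: "kron_apply m (mat_mult m A B) x = kron_apply m A (kron_apply m B x)"
proof
  fix i
  have "kron_apply m (mat_mult m A B) x i = (\<Sum>j=1..m. \<Sum>l=1..m. (A i l * B l j) *\<^sub>R x j)"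
    by (simp add: kron_apply_def mat_mult_def scaleR_left.sum)
  also have "\<dots> = (\<Sum>l=1..m. \<Sum>j=1..m. (A i l * B l j) *\<^sub>R x j)" by (rule sum.swap)
  also have "\<dots> = kron_apply m A (kron_apply m B x) i"
    by (simp add: kron_apply_def scaleR_right.sum)
  finally show "kron_apply m (mat_mult m A B) x i = kron_apply m A (kron_apply m B x) i" .
qed

lemma kron_id: "i \<in> {1..m} \<Longrightarrow> kron_apply m id_mat x i = x i"
  by (simp add: kron_apply_def id_mat_def if_distrib[of "\<lambda>c. c *\<^sub>R _"] sum.delta cong: if_cong)

lemma kron_mat_diff: "kron_apply m (mat_diff A B) x i = kron_apply m A x i - kron_apply m B x i"
  by (simp add: kron_apply_def mat_diff_def scaleR_left_diff_distrib sum_subtractf)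

lemma kron_in_stacked_space:
  "x \<in> stacked_space d m \<Longrightarrow> kron_apply m A x \<in> stacked_space d m"
  by (auto simp: stacked_space_def kron_apply_def)

text \<open>
  What the analysis uses of a gossip matrix: it annihilates the consensus space, maps into its orthogonal
  complement, and \<open>I - A\<close> contracts on that complement.
\<close>

definition gossip_step :: "nat \<Rightarrow> nat \<Rightarrow> real \<Rightarrow> matrix \<Rightarrow> bool" where
  "gossip_step d m K A \<longleftrightarrow>
     (\<forall>i\<in>{1..m}. (\<Sum>j=1..m. A i j) = 0) \<and> (\<forall>j\<in>{1..m}. (\<Sum>i=1..m. A i j) = 0) \<and>
     (\<forall>x\<in>consensus_perp d m. sqnorm m (\<lambda>i. x i - kron_apply m A x i) \<le> (1 - 1 / K) * sqnorm m x)"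

lemma gossip_assms_imp_step:
  assumes "gossip_assms d m chi E W"
  shows "gossip_step d m chi (W k)"
  unfolding gossip_step_def
proof (intro conjI ballI)
  note G = assms[unfolded gossip_assms_def, THEN conjunct2, rule_format, of k]
  fix i assume i: "i \<in> {1..m}"
  show "(\<Sum>j=1..m. W k i j) = 0"
    using G[THEN conjunct2, THEN conjunct2, THEN conjunct1, rule_format, of i 1] i by simp
  have "(\<Sum>l=1..m. \<Sum>j=1..m. W k l j * (if j = i then 1 else 0)) = 0"
    by (rule G[THEN conjunct2, THEN conjunct2, THEN conjunct2, THEN conjunct1, THEN spec])
  then show "(\<Sum>l=1..m. W k l i) = 0"
    using i by (simp add: sum.delta if_distrib[of "\<lambda>c. _ * c"] cong: if_cong)
next
  note G = assms[unfolded gossip_assms_def, THEN conjunct2, rule_format, of k]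
  fix x assume "x \<in> consensus_perp d m"
  then have "sqnorm m (\<lambda>i. kron_apply m (W k) x i - x i) \<le> (1 - 1 / chi) * sqnorm m x"
    using G by blast
  then show "sqnorm m (\<lambda>i. x i - kron_apply m (W k) x i) \<le> (1 - 1 / chi) * sqnorm m x"
    by (simp add: sqnorm_def norm_minus_commute)
qed

lemma gossip_step_sum_kron:
  assumes "gossip_step d m K A"
  shows "(\<Sum>i=1..m. kron_apply m A x i) = 0"
  unfolding sum_kron using assms by (simp add: gossip_step_def)

lemma consensus_prod_contraction:
  assumes W: "\<And>k. gossip_step d m chi (W k)" and chi: "1 \<le> chi" and x: "x \<in> consensus_perp d m"
  shows "kron_apply m (consensus_prod m W s t) x \<in> consensus_perp d m \<and>
    sqnorm m (kron_apply m (consensus_prod m W s t) x) \<le> (1 - 1 / chi) ^ t * sqnorm m x"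
proof (induction t)
  case 0
  have "(\<Sum>i=1..m. kron_apply m id_mat x i) = (\<Sum>i=1..m. x i)" by (simp add: kron_id)
  then show ?case using x
    by (auto simp: consensus_perp_def kron_in_stacked_space sqnorm_def kron_id)
next
  case (Suc t)
  define v where "v = kron_apply m (consensus_prod m W s t) x"
  have v: "v \<in> consensus_perp d m" and nv: "sqnorm m v \<le> (1 - 1 / chi) ^ t * sqnorm m x"
    using Suc by (simp_all add: v_def)
  have eq: "kron_apply m (consensus_prod m W s (Suc t)) x
      = kron_apply m (mat_diff id_mat (W (s + t))) v"
    by (simp add: kron_mat_mult v_def)
  have at: "kron_apply m (mat_diff id_mat (W (s + t))) v i = v i - kron_apply m (W (s + t)) v i"
    if "i \<in> {1..m}" for i using that by (simp add: kron_mat_diff kron_id)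
  have "(\<Sum>i=1..m. kron_apply m (mat_diff id_mat (W (s + t))) v i) = 0"
    using v gossip_step_sum_kron[OF W, of "s + t" v] by (simp add: at sum_subtractf consensus_perp_def)
  then have 1: "kron_apply m (consensus_prod m W s (Suc t)) x \<in> consensus_perp d m"
    unfolding eq using v by (simp add: consensus_perp_def kron_in_stacked_space)
  have "sqnorm m (kron_apply m (consensus_prod m W s (Suc t)) x)
      = sqnorm m (\<lambda>i. v i - kron_apply m (W (s + t)) v i)"
    unfolding eq by (intro sqnorm_cong at)
  also have "\<dots> \<le> (1 - 1 / chi) * sqnorm m v"
    using W[of "s + t"] v by (simp add: gossip_step_def)
  also have "\<dots> \<le> (1 - 1 / chi) * ((1 - 1 / chi) ^ t * sqnorm m x)"
    using nv chi by (intro mult_left_mono) auto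
  finally show ?case using 1 by simp
qed

lemma consensus_prod_sums:
  assumes W: "\<And>k. gossip_step d m chi (W k)"
  shows "i \<in> {1..m} \<Longrightarrow> (\<Sum>j=1..m. consensus_prod m W s t i j) = 1"
    and "j \<in> {1..m} \<Longrightarrow> (\<Sum>i=1..m. consensus_prod m W s t i j) = 1"
proof -
  have row: "(\<Sum>j=1..m. mat_diff id_mat (W k) i j) = 1" if "i \<in> {1..m}" for i k
    using that W[of k] by (simp add: mat_diff_def id_mat_def sum_subtractf gossip_step_def)
  have col: "(\<Sum>i=1..m. mat_diff id_mat (W k) i j) = 1" if "j \<in> {1..m}" for j k
    using that W[of k] by (simp add: mat_diff_def id_mat_def sum_subtractf gossip_step_def)
  show "(\<Sum>j=1..m. consensus_prod m W s t i j) = 1" if "i \<in> {1..m}"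
    using that
  proof (induction t arbitrary: i)
    case 0
    then show ?case by (simp add: id_mat_def)
  next
    case (Suc t)
    have "(\<Sum>j=1..m. consensus_prod m W s (Suc t) i j)
       = (\<Sum>k=1..m. \<Sum>j=1..m. mat_diff id_mat (W (s + t)) i k * consensus_prod m W s t k j)"
      unfolding consensus_prod.simps mat_mult_def by (rule sum.swap)
    then show ?case using Suc row by (simp flip: sum_distrib_left)
  qed
  show "(\<Sum>i=1..m. consensus_prod m W s t i j) = 1" if "j \<in> {1..m}"
  proof (induction t)
    case 0
    then show ?case using that by (simp add: id_mat_def)
  next
    case (Suc t)
    have "(\<Sum>i=1..m. consensus_prod m W s (Suc t) i j)
       = (\<Sum>k=1..m. \<Sum>i=1..m. mat_diff id_mat (W (s + t)) i k * consensus_prod m W s t k j)"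
      unfolding consensus_prod.simps mat_mult_def by (rule sum.swap)
    then show ?case using Suc col by (simp flip: sum_distrib_right)
  qed
qed

text \<open>
  Since \<open>(1 - 1/\<chi>)\<^sup>T \<le> exp (- T/\<chi>) \<le> exp (- 1/\<kappa>) \<le> 1 / (1 +
  1/\<kappa>)\<close>, running \<open>T \<ge> \<chi> / \<kappa>\<close> stages removes the dependence on
  \<open>\<chi>\<close> from the contraction factor.
\<close>

lemma multi_stage_gossip_step:
  assumes G: "gossip_assms d m chi E W" and \<kappa>: "1 \<le> \<kappa>" and T: "chi \<le> \<kappa> * real T"
  shows "gossip_step d m (\<kappa> + 1) (multi_stage m W T k)"
proof -
  have chi: "1 \<le> chi" using G by (simp add: gossip_assms_def)
  note W = gossip_assms_imp_step[OF G]
  have rate: "(1 - 1 / chi) ^ T \<le> 1 - 1 / (\<kappa> + 1)"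
  proof -
    have "(1 - 1 / chi) ^ T \<le> exp (- (1 / chi)) ^ T"
      using chi exp_ge_add_one_self[of "- (1 / chi)"] by (intro power_mono) auto
    also have "\<dots> = exp (- (real T / chi))" by (simp flip: exp_of_nat_mult)
    also have "\<dots> \<le> exp (- (1 / \<kappa>))" using T chi \<kappa> by (simp add: field_simps)
    also have "\<dots> = 1 / exp (1 / \<kappa>)" by (simp add: exp_minus inverse_eq_divide)
    also have "\<dots> \<le> 1 / (1 + 1 / \<kappa>)"
      using \<kappa> exp_ge_add_one_self[of "1 / \<kappa>"] by (intro divide_left_mono) (auto intro!: mult_pos_pos add_pos_pos)
    also have "\<dots> = 1 - 1 / (\<kappa> + 1)" using \<kappa> by (simp add: field_simps)
    finally show ?thesis .
  qed
  show ?thesis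
    unfolding gossip_step_def
  proof (intro conjI ballI)
    fix i assume i: "i \<in> {1..m}"
    show "(\<Sum>j=1..m. multi_stage m W T k i j) = 0"
      using i consensus_prod_sums(1)[of d m chi W, OF W i]
      by (simp add: multi_stage_def mat_diff_def sum_subtractf id_mat_def)
    show "(\<Sum>l=1..m. multi_stage m W T k l i) = 0"
      using i consensus_prod_sums(2)[of d m chi W, OF W i]
      by (simp add: multi_stage_def mat_diff_def sum_subtractf id_mat_def)
  next
    fix x assume x: "x \<in> consensus_perp d m"
    have "sqnorm m (\<lambda>i. x i - kron_apply m (multi_stage m W T k) x i)
      = sqnorm m (kron_apply m (consensus_prod m W (k * T) T) x)"
      by (intro sqnorm_cong) (simp add: multi_stage_def kron_mat_diff kron_id)
    also have "\<dots> \<le> (1 - 1 / chi) ^ T * sqnorm m x"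
      using consensus_prod_contraction[of d m chi W, OF W chi x] by blast
    also have "\<dots> \<le> (1 - 1 / (\<kappa> + 1)) * sqnorm m x"
      using rate sqnorm_nonneg by (intro mult_right_mono) auto
    finally show "sqnorm m (\<lambda>i. x i - kron_apply m (multi_stage m W T k) x i)
      \<le> (1 - 1 / (\<kappa> + 1)) * sqnorm m x" .
  qed
qed

definition proj_perp :: "nat \<Rightarrow> stacked \<Rightarrow> stacked" where
  "proj_perp m x = (\<lambda>i. x i - (1 / real m) *\<^sub>R (\<Sum>j=1..m. x j))"

lemma proj_perp_in:
  assumes "x \<in> stacked_space d m"
  shows "proj_perp m x \<in> consensus_perp d m"
proof (cases "m = 0")
  case False
  then show ?thesis using assms
    by (auto simp: consensus_perp_def stacked_space_def proj_perp_def sum_subtractf scaleR_scaleR sum_constant_scaleR)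
qed (simp add: consensus_perp_def stacked_space_def)

lemma proj_perp_add: "proj_perp m (\<lambda>i. x i + y i) i = proj_perp m x i + proj_perp m y i"
  and proj_perp_diff: "proj_perp m (\<lambda>i. x i - y i) i = proj_perp m x i - proj_perp m y i"
  and proj_perp_scaleR: "proj_perp m (\<lambda>i. c *\<^sub>R x i) i = c *\<^sub>R proj_perp m x i"
  by (simp_all add: proj_perp_def sum.distrib sum_subtractf scaleR_right_distrib
      scaleR_right_diff_distrib scaleR_right.sum mult.commute)

lemma proj_perp_id: "(\<Sum>i=1..m. x i) = 0 \<Longrightarrow> proj_perp m x i = x i"
  by (simp add: proj_perp_def)

lemma inner_proj_perp:
  assumes "(\<Sum>i=1..m. v i) = 0"
  shows "inner (stack m x - stack m (proj_perp m x)) (stack m v) = 0"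
proof -
  have "inner (stack m x - stack m (proj_perp m x)) (stack m v)
      = (\<Sum>i=1..m. inner ((1 / real m) *\<^sub>R (\<Sum>j=1..m. x j)) (v i))"
    by (simp flip: stack_diff add: inner_stack proj_perp_def)
  also have "\<dots> = 0" unfolding inner_sum_right[symmetric] assms by simp
  finally show ?thesis .
qed

lemma kron_proj_perp:
  assumes "gossip_step d m K A" "i \<in> {1..m}"
  shows "kron_apply m A (proj_perp m x) i = kron_apply m A x i"
  using assms by (simp add: proj_perp_def kron_diff kron_const gossip_step_def)

lemma gossip_contracts_proj:
  assumes "gossip_step d m K A" "x \<in> stacked_space d m"
  shows "(norm (stack m (proj_perp m x) - stack m (kron_apply m A x)))\<^sup>2
    \<le> (1 - 1 / K) * (norm (stack m (proj_perp m x)))\<^sup>2"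
proof -
  have "(norm (stack m (proj_perp m x) - stack m (kron_apply m A x)))\<^sup>2
      = sqnorm m (\<lambda>i. proj_perp m x i - kron_apply m A (proj_perp m x) i)"
    unfolding stack_diff[symmetric] norm_stack
    by (intro sqnorm_cong) (simp add: kron_proj_perp[OF assms(1)])
  then show ?thesis
    using assms(1) proj_perp_in[OF assms(2)] by (simp add: norm_stack gossip_step_def)
qed

section \<open>Finite expectations and mini-batches\<close>

lemma expectation_bind_finite:
  fixes h :: "'b \<Rightarrow> real"
  assumes "finite (set_pmf p)" "\<And>x. x \<in> set_pmf p \<Longrightarrow> finite (set_pmf (f x))"
  shows "measure_pmf.expectation (bind_pmf p f) h
    = measure_pmf.expectation p (\<lambda>x. measure_pmf.expectation (f x) h)"
proof -
  have "measure_pmf.expectation (bind_pmf p f) h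
      = (\<Sum>a\<in>set_pmf p. pmf p a *\<^sub>R measure_pmf.expectation (f a) h)"
    using assms by (intro pmf_expectation_bind) auto
  also have "\<dots> = measure_pmf.expectation p (\<lambda>x. measure_pmf.expectation (f x) h)"
    using assms by (intro integral_measure_pmf[symmetric]) auto
  finally show ?thesis .
qed

lemma expectation_mono_finite:
  fixes f g :: "'a \<Rightarrow> real"
  assumes "finite (set_pmf p)" "\<And>x. x \<in> set_pmf p \<Longrightarrow> f x \<le> g x"
  shows "measure_pmf.expectation p f \<le> measure_pmf.expectation p g"
  using assms by (intro integral_mono_AE integrable_measure_pmf_finite) (auto simp: AE_measure_pmf_iff)

lemma expectation_cong_pmf:
  fixes f g :: "'a \<Rightarrow> real"
  assumes "\<And>x. x \<in> set_pmf p \<Longrightarrow> f x = g x"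
  shows "measure_pmf.expectation p f = measure_pmf.expectation p g"
  using assms by (intro integral_cong_AE) (auto simp: AE_measure_pmf_iff)

lemma expectation_pmf_of_list:
  fixes f :: "'a \<Rightarrow> real"
  assumes wf: "pmf_of_list_wf xs"
  shows "measure_pmf.expectation (pmf_of_list xs) f = (\<Sum>z\<leftarrow>xs. snd z * f (fst z))"
proof -
  have gen: "(\<Sum>x\<in>A. sum_list (map snd (filter (\<lambda>z. fst z = x) ys)) * f x) = (\<Sum>z\<leftarrow>ys. snd z * f (fst z))"
    if "finite A" "fst ` set ys \<subseteq> A" for A and ys :: "('a \<times> real) list"
    using that
  proof (induction ys)
    case (Cons z ys)
    have "(\<Sum>x\<in>A. sum_list (map snd (filter (\<lambda>z. fst z = x) (z # ys))) * f x)
       = (\<Sum>x\<in>A. (if x = fst z then snd z * f x else 0)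
           + sum_list (map snd (filter (\<lambda>z. fst z = x) ys)) * f x)"
      by (intro sum.cong) (auto simp: algebra_simps)
    then show ?case using Cons by (simp add: sum.distrib)
  qed simp
  have "measure_pmf.expectation (pmf_of_list xs) f
      = (\<Sum>x\<in>set (map fst xs). pmf (pmf_of_list xs) x *\<^sub>R f x)"
    using set_pmf_of_list[OF wf] by (intro integral_measure_pmf) auto
  then show ?thesis using gen[of "set (map fst xs)" xs] by (simp add: pmf_pmf_of_list[OF wf])
qed

lemma expectation_Pi_component:
  fixes f :: "'b \<Rightarrow> real"
  assumes "finite A" "i \<in> A"
  shows "measure_pmf.expectation (Pi_pmf A d p) (\<lambda>S. f (S i)) = measure_pmf.expectation (p i) f"
proof -
  have "measure_pmf.expectation (Pi_pmf A d p) (\<lambda>S. f (S i))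
      = measure_pmf.expectation (map_pmf (\<lambda>S. S i) (Pi_pmf A d p)) f" by simp
  then show ?thesis using assms by (simp add: Pi_pmf_component)
qed

lemma set_Pi_pmfD:
  assumes "finite A" "S \<in> set_pmf (Pi_pmf A d p)" "i \<in> A"
  shows "S i \<in> set_pmf (p i)"
  using assms set_Pi_pmf_subset'[of A d p] by (auto simp: PiE_dflt_def)

lemma finite_set_Pi_pmf:
  assumes "finite A" "\<And>i. i \<in> A \<Longrightarrow> finite (set_pmf (p i))"
  shows "finite (set_pmf (Pi_pmf A d p))"
  using assms by (intro finite_subset[OF set_Pi_pmf_subset'] finite_PiE_dflt) auto

lemma finite_set_replicate_pmf: "finite (set_pmf p) \<Longrightarrow> finite (set_pmf (replicate_pmf b p))"
  by (induction b) auto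

lemma expectation_replicate_Suc:
  fixes F :: "'a list \<Rightarrow> real"
  assumes "finite (set_pmf p)"
  shows "measure_pmf.expectation (replicate_pmf (Suc b) p) F
    = measure_pmf.expectation p (\<lambda>x. measure_pmf.expectation (replicate_pmf b p) (\<lambda>xs. F (x # xs)))"
  using assms finite_set_replicate_pmf[OF assms, of b]
  by (simp add: expectation_bind_finite)

text \<open>
  Means of vectors are expressed by testing with every \<open>w\<close>, which requires no completeness of the
  space.
\<close>

lemma replicate_sum_mean:
  fixes h :: "'a \<Rightarrow> 'b::real_inner"
  assumes "finite (set_pmf p)" "\<And>w. measure_pmf.expectation p (\<lambda>x. inner w (h x)) = 0"
  shows "measure_pmf.expectation (replicate_pmf b p) (\<lambda>S. inner w (\<Sum>x\<leftarrow>S. h x)) = 0"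
proof (induction b)
  case (Suc b)
  note int = integrable_measure_pmf_finite[OF finite_set_replicate_pmf[OF assms(1)], of b]
  show ?case
    unfolding expectation_replicate_Suc[OF assms(1)]
    using Suc assms by (simp add: int inner_add_right)
qed simp

lemma replicate_sum_variance:
  fixes h :: "'a \<Rightarrow> 'b::real_inner"
  assumes "finite (set_pmf p)" "\<And>w. measure_pmf.expectation p (\<lambda>x. inner w (h x)) = 0"
  shows "measure_pmf.expectation (replicate_pmf b p) (\<lambda>S. (norm (\<Sum>x\<leftarrow>S. h x))\<^sup>2)
    = real b * measure_pmf.expectation p (\<lambda>x. (norm (h x))\<^sup>2)"
proof (induction b)
  case (Suc b)
  note int = integrable_measure_pmf_finite[OF finite_set_replicate_pmf[OF assms(1)], of b]
  note intp = integrable_measure_pmf_finite[OF assms(1)]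
  show ?case
    unfolding expectation_replicate_Suc[OF assms(1)]
    using Suc replicate_sum_mean[OF assms, of b]
    by (simp add: int intp norm_add_sq algebra_simps)
qed simp

lemma variance_le_second_moment:
  fixes h :: "'a \<Rightarrow> 'b::real_inner"
  assumes "finite (set_pmf p)" "\<And>w. measure_pmf.expectation p (\<lambda>x. inner w (h x)) = inner w c"
  shows "measure_pmf.expectation p (\<lambda>x. (norm (h x - c))\<^sup>2)
    \<le> measure_pmf.expectation p (\<lambda>x. (norm (h x))\<^sup>2)"
proof -
  note intp = integrable_measure_pmf_finite[OF assms(1)]
  have "measure_pmf.expectation p (\<lambda>x. (norm (h x - c))\<^sup>2)
     = measure_pmf.expectation p (\<lambda>x. (norm (h x))\<^sup>2) - 2 * inner c c + (norm c)\<^sup>2"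
    unfolding norm_diff_sq inner_commute[of "h _"] using assms(2)[of c] by (simp add: intp)
  also have "\<dots> \<le> measure_pmf.expectation p (\<lambda>x. (norm (h x))\<^sup>2)"
    by (simp add: power2_norm_eq_inner)
  finally show ?thesis .
qed

lemma sum_list_upt_Suc: "(\<Sum>j\<leftarrow>[k..<Suc n]. f j) = (\<Sum>j=k..n. f j :: real)"
  by (simp only: interv_sum_list_conv_sum_set_nat set_upt atLeastLessThanSuc_atLeastAtMost)


section \<open>Importance sampling in the finite-sum problem\<close>

locale finite_sum_problem =
  fixes P :: problem and L \<mu> :: real
  assumes problem: "problem_assms P L \<mu>"
begin

abbreviation "d \<equiv> dim_of P"
abbreviation "m \<equiv> nodes P"
abbreviation "n \<equiv> comps P"
abbreviation "gradF i \<equiv> grad d (node_fun P i)"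
abbreviation "gradf i j \<equiv> grad d (comp_fun P i j)"

lemma dims: "1 \<le> d" "1 \<le> m" "1 \<le> n" "0 < \<mu>"
  using problem by (auto simp: problem_assms_def)

lemma comp_smooth: "i \<in> {1..m} \<Longrightarrow> j \<in> {1..n} \<Longrightarrow> smooth_fun d (comp_lip P i j) (comp_fun P i j)"
  and comp_convex: "i \<in> {1..m} \<Longrightarrow> j \<in> {1..n} \<Longrightarrow> convex_on (Rd d) (comp_fun P i j)"
  and node_smooth: "i \<in> {1..m} \<Longrightarrow> smooth_fun d L (node_fun P i)"
  and node_strongly_convex: "i \<in> {1..m} \<Longrightarrow> strongly_convex d \<mu> (node_fun P i)"
  using problem unfolding problem_assms_def by blast+

lemma comp_lip_nonneg: "i \<in> {1..m} \<Longrightarrow> j \<in> {1..n} \<Longrightarrow> 0 \<le> comp_lip P i j"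
  using smooth_const_nonneg[OF comp_smooth dims(1)] .

lemma gradF_in: "i \<in> {1..m} \<Longrightarrow> u \<in> Rd d \<Longrightarrow> gradF i u \<in> Rd d"
  using smooth_grad_in_Rd[OF node_smooth] .

lemma gradf_in: "i \<in> {1..m} \<Longrightarrow> j \<in> {1..n} \<Longrightarrow> u \<in> Rd d \<Longrightarrow> gradf i j u \<in> Rd d"
  using smooth_grad_in_Rd[OF comp_smooth] .

lemma gradF_eq:
  assumes "i \<in> {1..m}" "u \<in> Rd d"
  shows "gradF i u = (1 / real n) *\<^sub>R (\<Sum>j=1..n. gradf i j u)"
proof (rule grad_eq[OF _ assms(2)])
  have "is_grad d (\<lambda>u. (\<Sum>j=1..n. comp_fun P i j u) / real n) u ((1 / real n) *\<^sub>R (\<Sum>j=1..n. gradf i j u))"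
    using smooth_is_grad[OF comp_smooth[OF assms(1)] assms(2)] by (intro is_grad_average) auto
  moreover have "node_fun P i = (\<lambda>u. (\<Sum>j=1..n. comp_fun P i j u) / real n)"
    by (rule ext) (simp add: node_fun_def)
  ultimately show "is_grad d (node_fun P i) u ((1 / real n) *\<^sub>R (\<Sum>j=1..n. gradf i j u))" by simp
qed

lemma bregman_node_fun:
  assumes "i \<in> {1..m}" "v \<in> Rd d"
  shows "bregman (node_fun P i) (gradF i) u v
    = (\<Sum>j=1..n. bregman (comp_fun P i j) (gradf i j) u v) / real n"
  by (rule bregman_average, rule node_fun_def, rule gradF_eq[OF assms])

lemma node_bregman_ge:
  assumes "i \<in> {1..m}" "u \<in> Rd d" "v \<in> Rd d"
  shows "\<mu> / 2 * (norm (u - v))\<^sup>2 \<le> bregman (node_fun P i) (gradF i) u v"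
  using strongly_convex_bregman_ge[OF node_strongly_convex[OF assms(1)]
      smooth_is_grad[OF node_smooth[OF assms(1)] assms(3)] assms(2,3)] .

text \<open>Comparing the divergence of a unit vector from \<open>0\<close> in the two bounds.\<close>

lemma mu_le_of_bregman_le:
  assumes "i \<in> {1..m}" "\<And>u. u \<in> Rd d \<Longrightarrow> bregman (node_fun P i) (gradF i) u 0 \<le> l / 2 * (norm (u - 0))\<^sup>2"
  shows "\<mu> \<le> l"
proof -
  obtain e where e: "e \<in> Rd d" "norm e = 1" using ex_unit_Rd[OF dims(1)] .
  have "\<mu> / 2 * (norm (e - 0))\<^sup>2 \<le> l / 2 * (norm (e - 0))\<^sup>2"
    by (rule order_trans[OF node_bregman_ge[OF assms(1) e(1)] assms(2)[OF e(1)]]) simp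
  then show ?thesis using e by simp
qed

lemma mu_le_L: "\<mu> \<le> L"
proof -
  have i: "1 \<in> {1..m}" using dims by simp
  show ?thesis
    by (rule mu_le_of_bregman_le[OF i smooth_bregman_le[OF node_smooth[OF i] _ Rd_closed(1)]])
qed

definition "lip_sum i = (\<Sum>j=1..n. comp_lip P i j)"

lemma lip_avg_le_Lbar: "i \<in> {1..m} \<Longrightarrow> lip_sum i / real n \<le> Lbar P"
  unfolding Lbar_def lip_sum_def by (intro Max_ge) auto

lemma mu_le_lip_avg:
  assumes i: "i \<in> {1..m}"
  shows "\<mu> \<le> lip_sum i / real n"
proof (rule mu_le_of_bregman_le[OF i])
  fix u assume u: "u \<in> Rd d"
  have "(\<Sum>j=1..n. bregman (comp_fun P i j) (gradf i j) u 0) \<le> (\<Sum>j=1..n. comp_lip P i j / 2 * (norm (u - 0))\<^sup>2)"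
    using u by (intro sum_mono smooth_bregman_le comp_smooth i) auto
  then show "bregman (node_fun P i) (gradF i) u 0 \<le> lip_sum i / real n / 2 * (norm (u - 0))\<^sup>2"
    using i dims by (simp add: bregman_node_fun lip_sum_def divide_right_mono
        flip: sum_distrib_right sum_divide_distrib) (simp add: divide_simps)
qed

lemma lip_sum_pos:
  assumes "i \<in> {1..m}"
  shows "0 < lip_sum i"
proof -
  have "0 < lip_sum i / real n" using mu_le_lip_avg[OF assms] dims(4) by linarith
  then show ?thesis by (simp add: zero_less_divide_iff)
qed

lemma mu_le_Lbar: "\<mu> \<le> Lbar P"
proof -
  have i: "1 \<in> {1..m}" using dims by simp
  show ?thesis by (rule order_trans[OF mu_le_lip_avg[OF i] lip_avg_le_Lbar[OF i]])
qed

text \<open>The law of one sampled index of a batch at node \<open>i\<close>.\<close>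

definition "index_pmf i = pmf_of_list (map (\<lambda>j. (j, index_prob P i j)) [1..<Suc n])"

lemma batch_pmf_eq: "batch_pmf P b i = replicate_pmf b (index_pmf i)"
  by (simp add: batch_pmf_def index_pmf_def)

lemma index_wf:
  assumes i: "i \<in> {1..m}"
  shows "pmf_of_list_wf (map (\<lambda>j. (j, index_prob P i j)) [1..<Suc n])"
proof (rule pmf_of_list_wfI)
  have "(\<Sum>j\<leftarrow>[1..<Suc n]. index_prob P i j) = (\<Sum>j=1..n. index_prob P i j)"
    by (rule sum_list_upt_Suc)
  also have "\<dots> = 1"
    using lip_sum_pos[OF i] by (simp add: index_prob_def lip_sum_def flip: sum_divide_distrib)
  finally show "sum_list (map snd (map (\<lambda>j. (j, index_prob P i j)) [1..<Suc n])) = 1"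
    by (simp add: comp_def del: upt_Suc)
  show "0 \<le> x" if "x \<in> set (map snd (map (\<lambda>j. (j, index_prob P i j)) [1..<Suc n]))" for x
    using that lip_sum_pos[OF i] comp_lip_nonneg[OF i]
    by (auto simp: index_prob_def lip_sum_def less_Suc_eq_le intro!: divide_nonneg_nonneg sum_nonneg)
qed

lemma set_index_pmf: "i \<in> {1..m} \<Longrightarrow> set_pmf (index_pmf i) \<subseteq> {1..n}"
  unfolding index_pmf_def by (rule order_trans[OF set_pmf_of_list[OF index_wf]]) auto

lemma finite_index_pmf: "i \<in> {1..m} \<Longrightarrow> finite (set_pmf (index_pmf i))"
  by (rule finite_subset[OF set_index_pmf]) auto

lemma expectation_index_pmf:
  fixes f :: "nat \<Rightarrow> real"
  assumes "i \<in> {1..m}"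
  shows "measure_pmf.expectation (index_pmf i) f = (\<Sum>j=1..n. index_prob P i j * f j)"
  unfolding index_pmf_def expectation_pmf_of_list[OF index_wf[OF assms]]
  by (simp add: comp_def del: upt_Suc add: sum_list_upt_Suc)

definition "weighted_diff i u v j = (1 / (real n * index_prob P i j)) *\<^sub>R (gradf i j u - gradf i j v)"

text \<open>
  Components with \<open>L\<^sub>i\<^sub>j = 0\<close> are never drawn; they do not bias the estimate, as their
  gradients are constant.
\<close>

lemma weighted_diff_mean:
  assumes i: "i \<in> {1..m}" and uv: "u \<in> Rd d" "v \<in> Rd d"
  shows "measure_pmf.expectation (index_pmf i) (\<lambda>j. inner w (weighted_diff i u v j))
    = inner w (gradF i u - gradF i v)"
proof -
  have "index_prob P i j * inner w (weighted_diff i u v j) = inner w (gradf i j u - gradf i j v) / real n"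
    if j: "j \<in> {1..n}" for j
  proof (cases "comp_lip P i j = 0")
    case True
    then have "gradf i j u - gradf i j v = 0"
      using smooth_grad_lipschitz[OF comp_smooth[OF i j] uv] by simp
    then show ?thesis by (simp add: weighted_diff_def)
  next
    case False
    then have "index_prob P i j \<noteq> 0" using lip_sum_pos[OF i] by (simp add: index_prob_def lip_sum_def)
    then show ?thesis by (simp add: weighted_diff_def)
  qed
  then have "measure_pmf.expectation (index_pmf i) (\<lambda>j. inner w (weighted_diff i u v j))
     = (\<Sum>j=1..n. inner w (gradf i j u - gradf i j v) / real n)"
    unfolding expectation_index_pmf[OF i] by (intro sum.cong) auto
  also have "\<dots> = inner w (gradF i u - gradF i v)"
    by (simp add: gradF_eq[OF i uv(1)] gradF_eq[OF i uv(2)] inner_sum_right inner_diff_right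
        sum_subtractf diff_divide_distrib flip: sum_divide_distrib)
  finally show ?thesis .
qed

text \<open>
  With probabilities proportional to \<open>L\<^sub>i\<^sub>j\<close> the factor \<open>1 /
  p\<^sub>i\<^sub>j\<close> of the estimator cancels the factor \<open>L\<^sub>i\<^sub>j\<close> of
  cocoercivity, so that the average of the \<open>L\<^sub>i\<^sub>j\<close>, rather than their maximum, appears.
\<close>

lemma weighted_diff_second_moment:
  assumes i: "i \<in> {1..m}" and uv: "u \<in> Rd d" "v \<in> Rd d"
  shows "measure_pmf.expectation (index_pmf i) (\<lambda>j. (norm (weighted_diff i u v j))\<^sup>2)
    \<le> 2 * Lbar P * bregman (node_fun P i) (gradF i) v u"
proof -
  let ?D = "\<lambda>j. bregman (comp_fun P i j) (gradf i j) v u"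
  have D: "0 \<le> ?D j" if "j \<in> {1..n}" for j
    using strongly_convex_bregman_ge[OF convex_imp_strongly_convex_0[OF comp_convex[OF i that]]
      smooth_is_grad[OF comp_smooth[OF i that] uv(1)] uv(2,1)] by simp
  have "index_prob P i j * (norm (weighted_diff i u v j))\<^sup>2 \<le> 2 * (lip_sum i / (real n)\<^sup>2) * ?D j"
    if j: "j \<in> {1..n}" for j
  proof (cases "comp_lip P i j = 0")
    case True
    then show ?thesis using D[OF j] lip_sum_pos[OF i] by (simp add: index_prob_def)
  next
    case False
    then have l: "0 < comp_lip P i j" using comp_lip_nonneg[OF i j] by simp
    have co: "(norm (gradf i j u - gradf i j v))\<^sup>2 \<le> 2 * comp_lip P i j * ?D j"
      using smooth_convex_cocoercive[OF comp_smooth[OF i j] comp_convex[OF i j] dims(1) uv(2,1)]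
      by (simp add: norm_minus_commute)
    have "index_prob P i j * (norm (weighted_diff i u v j))\<^sup>2
        = lip_sum i / ((real n)\<^sup>2 * comp_lip P i j) * (norm (gradf i j u - gradf i j v))\<^sup>2"
      using l lip_sum_pos[OF i] dims unfolding weighted_diff_def norm_scaleR_sq
      by (simp add: index_prob_def lip_sum_def[symmetric] field_simps power2_eq_square)
    also have "\<dots> \<le> lip_sum i / ((real n)\<^sup>2 * comp_lip P i j) * (2 * comp_lip P i j * ?D j)"
      by (intro mult_left_mono[OF co]) (use l lip_sum_pos[OF i] in simp)
    also have "\<dots> = 2 * (lip_sum i / (real n)\<^sup>2) * ?D j" using l by (simp add: field_simps)
    finally show ?thesis .
  qed
  then have "measure_pmf.expectation (index_pmf i) (\<lambda>j. (norm (weighted_diff i u v j))\<^sup>2)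
      \<le> (\<Sum>j=1..n. 2 * (lip_sum i / (real n)\<^sup>2) * ?D j)"
    unfolding expectation_index_pmf[OF i] by (intro sum_mono)
  also have "\<dots> = 2 * (lip_sum i / real n) * bregman (node_fun P i) (gradF i) v u"
    unfolding bregman_node_fun[OF i uv(1)] sum_distrib_left[symmetric] by (simp add: power2_eq_square)
  also have "\<dots> \<le> 2 * Lbar P * bregman (node_fun P i) (gradF i) v u"
  proof (rule mult_right_mono)
    have "0 \<le> \<mu> / 2 * (norm (v - u))\<^sup>2" using dims by simp
    then show "0 \<le> bregman (node_fun P i) (gradF i) v u"
      using node_bregman_ge[OF i uv(2,1)] by linarith
  qed (use lip_avg_le_Lbar[OF i] in simp)
  finally show ?thesis .
qed

definition "noise b i u v S = grad_estimate P b i S u v - gradF i u"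

lemma noise_eq:
  assumes "S \<in> set_pmf (batch_pmf P b i)" "0 < b"
  shows "noise b i u v S
    = (1 / real b) *\<^sub>R (\<Sum>j\<leftarrow>S. weighted_diff i u v j - (gradF i u - gradF i v))"
proof -
  have len: "length S = b" using assms(1) by (auto simp: batch_pmf_eq set_replicate_pmf)
  have "(\<Sum>j\<leftarrow>S. weighted_diff i u v j - c) = (\<Sum>j\<leftarrow>S. weighted_diff i u v j) - real (length S) *\<^sub>R c" for c
    by (induction S) (simp_all add: algebra_simps)
  with len assms(2) show ?thesis
    by (simp add: noise_def grad_estimate_def weighted_diff_def scaleR_right_diff_distrib)
qed

lemma finite_batch_pmf: "i \<in> {1..m} \<Longrightarrow> finite (set_pmf (batch_pmf P b i))"
  unfolding batch_pmf_eq by (intro finite_set_replicate_pmf finite_index_pmf)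

lemma centered_mean:
  assumes "i \<in> {1..m}" "u \<in> Rd d" "v \<in> Rd d"
  shows "measure_pmf.expectation (index_pmf i)
    (\<lambda>j. inner w (weighted_diff i u v j - (gradF i u - gradF i v))) = 0"
  using weighted_diff_mean[OF assms, of w]
  by (simp add: inner_diff_right integrable_measure_pmf_finite[OF finite_index_pmf[OF assms(1)]])

lemma noise_mean:
  assumes i: "i \<in> {1..m}" and uv: "u \<in> Rd d" "v \<in> Rd d" and b: "0 < b"
  shows "measure_pmf.expectation (batch_pmf P b i) (\<lambda>S. inner (noise b i u v S) w) = 0"
proof -
  have "measure_pmf.expectation (batch_pmf P b i) (\<lambda>S. inner (noise b i u v S) w)
     = measure_pmf.expectation (batch_pmf P b i)
        (\<lambda>S. (1 / real b) * inner w (\<Sum>j\<leftarrow>S. weighted_diff i u v j - (gradF i u - gradF i v)))"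
    using b by (intro expectation_cong_pmf) (simp add: noise_eq inner_commute)
  also have "\<dots> = 0"
    using replicate_sum_mean[OF finite_index_pmf[OF i] centered_mean[OF i uv], of b w]
    by (simp add: batch_pmf_eq)
  finally show ?thesis .
qed

lemma noise_variance:
  assumes i: "i \<in> {1..m}" and uv: "u \<in> Rd d" "v \<in> Rd d" and b: "0 < b"
  shows "measure_pmf.expectation (batch_pmf P b i) (\<lambda>S. (norm (noise b i u v S))\<^sup>2)
    \<le> 2 * Lbar P / real b * bregman (node_fun P i) (gradF i) v u"
proof -
  let ?h = "\<lambda>j. weighted_diff i u v j - (gradF i u - gradF i v)"
  have "measure_pmf.expectation (batch_pmf P b i) (\<lambda>S. (norm (noise b i u v S))\<^sup>2)
     = measure_pmf.expectation (batch_pmf P b i) (\<lambda>S. (1 / real b)\<^sup>2 * (norm (\<Sum>j\<leftarrow>S. ?h j))\<^sup>2)"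
    using b by (intro expectation_cong_pmf) (simp only: noise_eq norm_scaleR_sq)
  also have "\<dots> = (1 / real b)\<^sup>2 * (real b * measure_pmf.expectation (index_pmf i) (\<lambda>j. (norm (?h j))\<^sup>2))"
    using replicate_sum_variance[OF finite_index_pmf[OF i] centered_mean[OF i uv], of b]
    by (simp add: batch_pmf_eq)
  also have "\<dots> = (1 / real b) * measure_pmf.expectation (index_pmf i) (\<lambda>j. (norm (?h j))\<^sup>2)"
    using b by (simp add: power2_eq_square)
  also have "\<dots> \<le> (1 / real b) * (2 * Lbar P * bregman (node_fun P i) (gradF i) v u)"
    by (intro mult_left_mono order_trans[OF
          variance_le_second_moment[OF finite_index_pmf[OF i] weighted_diff_mean[OF i uv]]
          weighted_diff_second_moment[OF i uv]]) simp
  finally show ?thesis by simp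
qed

end

section \<open>Choice of the parameters\<close>

text \<open>
  With \<open>r = sqrt (\<mu> / L)\<close> all momentum parameters are proportional to \<open>r\<close>, the
  rate aimed at. The constant \<open>K = \<kappa> + 1\<close> is the inverse of the contraction margin of the
  multi-stage gossip matrices.
\<close>

definition vr_params :: "real \<Rightarrow> real \<Rightarrow> real \<Rightarrow> real \<Rightarrow> nat \<Rightarrow> nat \<Rightarrow> adom_params" where
  "vr_params \<kappa> L Lb \<mu> n b = (let r = sqrt (\<mu> / L); K = \<kappa> + 1; \<nu> = \<mu> / 2; \<sigma> = r / 2 in
     \<lparr>eta = 1 / (4 * L * r), alpha = \<mu> / 4, nu = \<nu>,
      tau0 = Lb / (2 * real b * L), tau1 = r / 4, tau2 = r / 4,
      theta = \<nu> / (10 * K * \<sigma>), beta = 1 / (2 * L), sigma1 = \<sigma>, sigma2 = \<sigma>,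
      gamma = \<nu> / (40 * K\<^sup>2 * \<sigma>), delta = 1 / (2 * L) / 16, zeta = 1,
      p1 = min 1 (real b / real n), p2 = 0\<rparr>)"

text \<open>Cramer's rule; the determinant \<open>\<Delta>\<close> is positive.\<close>

lemma implicit_system_iff:
  fixes x y xg yg zg g :: fvec and p :: adom_params
  assumes pos: "0 < eta p" "0 < theta p" "0 \<le> alpha p" "0 \<le> beta p"
  defines "\<Delta> \<equiv> (1 + eta p * alpha p) * (1 + theta p * beta p) + eta p * theta p"
    and "a \<equiv> x + (eta p * alpha p) *\<^sub>R xg - eta p *\<^sub>R (g - nu p *\<^sub>R xg)"
    and "c \<equiv> y + (theta p * beta p) *\<^sub>R (g - nu p *\<^sub>R xg) - theta p *\<^sub>R ((1 / nu p) *\<^sub>R (yg + zg))"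
  shows "implicit_system p x y xg yg zg g q \<longleftrightarrow>
    q = ((1 / \<Delta>) *\<^sub>R ((1 + theta p * beta p) *\<^sub>R a + eta p *\<^sub>R c),
         (1 / \<Delta>) *\<^sub>R ((1 + eta p * alpha p) *\<^sub>R c - theta p *\<^sub>R a))"
proof -
  define s where "s = 1 + eta p * alpha p"
  define t where "t = 1 + theta p * beta p"
  have st: "0 < s" "0 < t" unfolding s_def t_def using pos by (auto intro!: add_pos_nonneg)
  have \<Delta>: "\<Delta> = s * t + eta p * theta p" by (simp add: \<Delta>_def s_def t_def)
  have \<Delta>0: "0 < \<Delta>" unfolding \<Delta> using st pos by (intro add_pos_pos mult_pos_pos)
  obtain x' y' where q: "q = (x', y')" by (cases q)
  have x1: "x' = x + (eta p * alpha p) *\<^sub>R (xg - x') - eta p *\<^sub>R (g - nu p *\<^sub>R xg - y')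
      \<longleftrightarrow> s *\<^sub>R x' - eta p *\<^sub>R y' = a"
    unfolding a_def s_def by (auto simp: algebra_simps)
  have y1: "y' = y + (theta p * beta p) *\<^sub>R (g - nu p *\<^sub>R xg - y')
            - theta p *\<^sub>R ((1 / nu p) *\<^sub>R (yg + zg) + x')
      \<longleftrightarrow> t *\<^sub>R y' + theta p *\<^sub>R x' = c"
    unfolding c_def t_def by (auto simp: algebra_simps)
  have "s *\<^sub>R x' - eta p *\<^sub>R y' = a \<and> t *\<^sub>R y' + theta p *\<^sub>R x' = c
    \<longleftrightarrow> x' = (1 / \<Delta>) *\<^sub>R (t *\<^sub>R a + eta p *\<^sub>R c) \<and> y' = (1 / \<Delta>) *\<^sub>R (s *\<^sub>R c - theta p *\<^sub>R a)"
    (is "?lhs \<longleftrightarrow> ?rhs")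
  proof
    assume ?lhs
    then have a: "a = s *\<^sub>R x' - eta p *\<^sub>R y'" and c: "c = t *\<^sub>R y' + theta p *\<^sub>R x'" by auto
    have "t *\<^sub>R a + eta p *\<^sub>R c = \<Delta> *\<^sub>R x'" "s *\<^sub>R c - theta p *\<^sub>R a = \<Delta> *\<^sub>R y'"
      unfolding \<Delta> a c by (simp_all add: algebra_simps)
    then show ?rhs using \<Delta>0 by simp
  next
    assume rhs: ?rhs
    have "s *\<^sub>R (t *\<^sub>R a + eta p *\<^sub>R c) - eta p *\<^sub>R (s *\<^sub>R c - theta p *\<^sub>R a) = \<Delta> *\<^sub>R a"
      "t *\<^sub>R (s *\<^sub>R c - theta p *\<^sub>R a) + theta p *\<^sub>R (t *\<^sub>R a + eta p *\<^sub>R c) = \<Delta> *\<^sub>R c"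
      unfolding \<Delta> by (simp_all add: algebra_simps)
    then have "(1 / \<Delta>) *\<^sub>R (s *\<^sub>R (t *\<^sub>R a + eta p *\<^sub>R c) - eta p *\<^sub>R (s *\<^sub>R c - theta p *\<^sub>R a)) = a"
      "(1 / \<Delta>) *\<^sub>R (t *\<^sub>R (s *\<^sub>R c - theta p *\<^sub>R a) + theta p *\<^sub>R (t *\<^sub>R a + eta p *\<^sub>R c)) = c"
      using \<Delta>0 by simp_all
    then show ?lhs using rhs
      by (simp add: scaleR_right_diff_distrib[of "1 / \<Delta>"] scaleR_right_distrib[of "1 / \<Delta>"]
          scaleR_left_commute[of "1 / \<Delta>"] del: scaleR_scaleR)
  qed
  then show ?thesis
    unfolding q implicit_system_def x1 y1 s_def[symmetric] t_def[symmetric] prod.case by simp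
qed

lemma scaled_coefficient:
  fixes q c s t :: real
  assumes "q * (1 + c) \<le> c" "s = c * t" "0 \<le> t"
  shows "t \<le> (1 - q) * (t + s)"
  using mult_right_mono[OF assms(1,3)] unfolding assms(2) by (simp add: algebra_simps)

locale adom_setting = finite_sum_problem +
  fixes \<kappa> :: real and b :: nat
  assumes kappa: "1 \<le> \<kappa>" and batch_ge: "Lbar P / L \<le> real b"
    and batch_order: "same_order \<kappa> (real b)
      (max (sqrt (real (comps P) * Lbar P / L)) (real (comps P) * sqrt (\<mu> / L)))"
begin

definition "r = sqrt (\<mu> / L)"
definition "K = \<kappa> + 1"
definition "\<nu> = \<mu> / 2"
definition "\<sigma> = r / 2"
definition "\<tau> = r / 4"
definition "\<tau>0 = Lbar P / (2 * real b * L)"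
definition "\<eta> = 1 / (4 * L * r)"
definition "\<alpha> = \<mu> / 4"
definition "\<beta> = 1 / (2 * L)"
definition "\<theta> = \<nu> / (10 * K * \<sigma>)"
definition "\<gamma> = \<nu> / (40 * K\<^sup>2 * \<sigma>)"
definition "\<delta> = \<beta> / 16"
definition "p = min 1 (real b / real n)"
text \<open>
  \<open>\<Lambda>\<close> is the weight of the snapshot divergence relative to that of \<open>x\<^sub>f\<close>
  in the Lyapunov function, \<open>C\<close> the weight of the stored consensus error, and \<open>\<rho>\<close>
  the contraction rate. Jumps of the snapshot to \<open>x\<^sub>f\<close> charge \<open>\<Lambda> p =
  \<tau>\<^sub>0 + \<tau> / 2\<close> to \<open>x\<^sub>f\<close>, which leaves it the margin \<open>\<tau> /
  2\<close>.
\<close>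

definition "\<Lambda> = (\<tau>0 + \<tau> / 2) / p"
definition "C = 36 * K\<^sup>2 * \<sigma> / \<nu>"
definition "\<rho> = r / (2560 * K\<^sup>2)"
definition "par = vr_params \<kappa> L (Lbar P) \<mu> n b"

lemma par_sel [simp]:
  "eta par = \<eta>" "alpha par = \<alpha>" "nu par = \<nu>" "tau0 par = \<tau>0" "tau1 par = \<tau>" "tau2 par = \<tau>"
  "theta par = \<theta>" "beta par = \<beta>" "sigma1 par = \<sigma>" "sigma2 par = \<sigma>" "gamma par = \<gamma>"
  "delta par = \<delta>" "zeta par = 1" "p1 par = p" "p2 par = 0"
  by (simp_all add: par_def vr_params_def Let_def r_def K_def \<nu>_def \<sigma>_def \<tau>_def \<tau>0_def \<eta>_def
      \<alpha>_def \<beta>_def \<theta>_def \<gamma>_def \<delta>_def p_def)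

lemma L_pos: "0 < L" using mu_le_L dims by linarith

lemma Lbar_pos: "0 < Lbar P" using mu_le_Lbar dims by linarith

lemma r_pos: "0 < r" and r_le: "r \<le> 1" and r_sq: "r\<^sup>2 = \<mu> / L"
  using L_pos dims mu_le_L by (auto simp: r_def)

lemma mu_eq: "\<mu> = r * r * L"
  using r_sq L_pos by (simp add: power2_eq_square field_simps)

lemma K_ge: "2 \<le> K" "\<kappa> \<le> K" using kappa by (simp_all add: K_def)

lemma b_pos: "0 < b"
proof -
  have "0 < Lbar P / L" using Lbar_pos L_pos by simp
  then show ?thesis using batch_ge by (cases b) auto
qed

lemma n_r_le: "real n * r \<le> \<kappa> * real b" and sqrt_n_le: "sqrt (real n * Lbar P / L) \<le> \<kappa> * real b"
  and b_le: "real b \<le> \<kappa> * max (sqrt (real n * Lbar P / L)) (real n * r)"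
  using batch_order by (auto simp: same_order_def r_def)

lemma p_pos: "0 < p" and p_le: "p \<le> 1"
  using b_pos dims by (simp_all add: p_def)

lemma params_pos: "0 < \<nu>" "0 < \<sigma>" "0 < \<tau>" "0 < \<tau>0" "0 < \<eta>" "0 < \<alpha>" "0 < \<beta>" "0 < \<theta>" "0 < \<gamma>" "0 < \<delta>"
  "0 < \<Lambda>" "0 < C" "0 < \<rho>"
  using r_pos dims L_pos Lbar_pos b_pos p_pos K_ge
  by (auto simp: \<nu>_def \<sigma>_def \<tau>_def \<tau>0_def \<eta>_def \<alpha>_def \<beta>_def \<theta>_def \<gamma>_def \<delta>_def \<Lambda>_def C_def \<rho>_def
      intro!: divide_pos_pos add_pos_pos mult_pos_pos)

lemma sigma_le: "\<sigma> \<le> 1" using r_le by (simp add: \<sigma>_def)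

lemma tau0_le: "\<tau>0 \<le> 1 / 2"
proof -
  have "Lbar P \<le> real b * L" using batch_ge L_pos by (simp add: field_simps)
  then show ?thesis using L_pos b_pos by (simp add: \<tau>0_def field_simps)
qed

lemma tau_sum_le: "\<tau> + \<tau>0 \<le> 1" using tau0_le r_le by (simp add: \<tau>_def)

lemma smooth_step: "2 * L * \<tau> * \<eta> \<le> 1"
  using L_pos r_pos by (simp add: \<tau>_def \<eta>_def field_simps)

lemma beta_le: "\<beta> \<le> \<sigma> / \<nu>"
proof -
  have "L * r \<le> 2 * L" using L_pos r_le by simp
  then have "\<beta> \<le> 1 / (L * r)"
    unfolding \<beta>_def using L_pos r_pos by (intro divide_left_mono) auto
  also have "\<dots> = r / \<mu>"
  proof -
    have "1 / (L * R) = R / M" if "M = R * R * L" "0 < R" for R M :: real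
      using that L_pos by (simp add: field_simps)
    from this[OF mu_eq r_pos] show ?thesis .
  qed
  also have "\<dots> = \<sigma> / \<nu>" by (simp add: \<sigma>_def \<nu>_def)
  finally show ?thesis .
qed

lemma theta_inv: "1 / \<theta> = 10 * K * \<sigma> / \<nu>" by (simp add: \<theta>_def)

lemma Lambda_p: "\<Lambda> * p = \<tau>0 + \<tau> / 2" using p_pos by (simp add: \<Lambda>_def)

text \<open>
  This is where the order of the batch size enters: \<open>sqrt (n Lbar / L) \<le> \<kappa> b\<close> gives
  \<open>\<tau>\<^sub>0 \<le> \<kappa>\<^sup>2 p / 2\<close>, and \<open>n sqrt (\<mu> / L) \<le> \<kappa>
  b\<close> gives \<open>\<tau> \<le> \<kappa>\<^sup>2 p / 4\<close>.
\<close>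

lemma Lambda_le: "\<Lambda> \<le> \<kappa>\<^sup>2"
proof -
  have "\<tau>0 \<le> \<kappa>\<^sup>2 / 2 * p \<and> \<tau> \<le> \<kappa>\<^sup>2 / 4 * p"
  proof (cases "real b \<le> real n")
    case True
    then have p: "p = real b / real n" using dims by (simp add: p_def min_def field_simps)
    have "real n * Lbar P / L = (sqrt (real n * Lbar P / L))\<^sup>2" using Lbar_pos L_pos by simp
    also have "\<dots> \<le> (\<kappa> * real b)\<^sup>2"
      using sqrt_n_le Lbar_pos L_pos by (intro power_mono) auto
    finally have "real n * Lbar P / L \<le> \<kappa>\<^sup>2 * (real b)\<^sup>2" by (simp add: power_mult_distrib)
    then have "real n * Lbar P / L / (real n * real b) \<le> \<kappa>\<^sup>2 * (real b)\<^sup>2 / (real n * real b)"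
      by (intro divide_right_mono) auto
    then have "Lbar P / L / real b \<le> \<kappa>\<^sup>2 * (real b / real n)"
      using b_pos dims by (simp add: power2_eq_square)
    moreover have "\<tau>0 = Lbar P / L / real b / 2" by (simp add: \<tau>0_def)
    ultimately have 1: "\<tau>0 \<le> \<kappa>\<^sup>2 / 2 * p" unfolding p by simp
    have "real n * r \<le> \<kappa>\<^sup>2 * real b"
    proof (rule order_trans[OF n_r_le mult_right_mono])
      show "\<kappa> \<le> \<kappa>\<^sup>2" using mult_right_mono[of 1 \<kappa> \<kappa>] kappa by (simp add: power2_eq_square)
    qed simp
    then have "r \<le> \<kappa>\<^sup>2 * (real b / real n)" using dims by (simp add: field_simps)
    then show ?thesis using 1 unfolding p \<tau>_def by simp
  next
    case False
    then have p: "p = 1" using dims by (simp add: p_def min_def field_simps)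
    have "1 \<le> \<kappa>\<^sup>2" using kappa by (simp add: one_le_power)
    then show ?thesis unfolding p using tau0_le r_le by (simp add: \<tau>_def)
  qed
  moreover have "0 \<le> \<kappa>\<^sup>2 * p" using p_pos by simp
  ultimately have "\<tau>0 + \<tau> / 2 \<le> \<kappa>\<^sup>2 * p" by auto
  then show ?thesis using p_pos by (simp add: \<Lambda>_def field_simps)
qed

lemma rho_le: "\<rho> \<le> r / 17" "\<rho> \<le> r / 8" "\<rho> \<le> r / (41 * K)" "\<rho> \<le> r / 4" "\<rho> \<le> 1 / (4 * K)" "\<rho> \<le> r / (8 * \<kappa>\<^sup>2)"
  "\<rho> \<le> 1"
proof -
  have K2: "K \<le> K\<^sup>2" "4 \<le> K\<^sup>2" using K_ge mult_mono[of 2 K 2 K] by (auto simp: power2_eq_square)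
  have le: "\<rho> \<le> r / c" if "0 < c" "c \<le> 2560 * K\<^sup>2" for c
    unfolding \<rho>_def using that r_pos K_ge by (intro divide_left_mono) auto
  show "\<rho> \<le> r / 17" "\<rho> \<le> r / 8" "\<rho> \<le> r / (41 * K)" "\<rho> \<le> r / 4" "\<rho> \<le> 1"
    using le[of 17] le[of 8] le[of "41 * K"] le[of 4] le[of 1] K2 K_ge r_le by auto
  have "\<kappa>\<^sup>2 \<le> K\<^sup>2" using K_ge kappa by (intro power_mono) auto
  then show "\<rho> \<le> r / (8 * \<kappa>\<^sup>2)" using kappa K2 by (intro le) auto
  have "\<rho> \<le> r / (4 * K)" using K2 K_ge by (intro le) auto
  also have "\<dots> \<le> 1 / (4 * K)" using r_le K_ge by (intro divide_right_mono) auto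
  finally show "\<rho> \<le> 1 / (4 * K)" .
qed

text \<open>
  Each of the following inequalities compares the weight of one term of the Lyapunov function after a step with
  \<open>1 - \<rho>\<close> times its weight before.
\<close>

lemma coef_x: "1 / \<eta> \<le> (1 - \<rho>) * (1 / \<eta> + \<alpha>)"
proof -
  have "\<rho> * (1 + r / 16) \<le> (r / 17) * (1 + 1 / 16)"
    using rho_le(1) r_pos r_le params_pos by (intro mult_mono) auto
  then have "\<rho> * (1 + r / 16) \<le> r / 16" by simp
  moreover have "\<alpha> = r / 16 * (1 / \<eta>)"
  proof -
    have "M / 4 = R / 16 * (1 / (1 / (4 * L * R)))" if "M = R * R * L" for R M :: real
      using that by simp
    from this[OF mu_eq] show ?thesis unfolding \<alpha>_def \<eta>_def .
  qed
  ultimately show ?thesis by (rule scaled_coefficient) (simp add: params_pos less_imp_le)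
qed

lemma coef_y: "1 / \<theta> \<le> (1 - \<rho>) * (1 / \<theta> + \<beta> / 2)"
proof -
  have "\<rho> * (1 + r / (40 * K)) \<le> (r / (41 * K)) * (1 + 1 / 40)"
    using rho_le(3) r_pos r_le params_pos K_ge by (intro mult_mono) (auto simp: field_simps)
  also have "\<dots> = r / (40 * K)" by simp
  finally have "\<rho> * (1 + r / (40 * K)) \<le> r / (40 * K)" .
  moreover have "\<beta> / 2 = r / (40 * K) * (1 / \<theta>)"
  proof -
    have "1 / (2 * L) / 2 = R / (40 * K) * (1 / (M / 2 / (10 * K * (R / 2))))"
      if "M = R * R * L" "0 < R" for R M :: real
      using that L_pos K_ge by (simp add: field_simps)
    from this[OF mu_eq r_pos] show ?thesis unfolding \<beta>_def \<theta>_def \<sigma>_def \<nu>_def .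
  qed
  ultimately show ?thesis by (rule scaled_coefficient) (simp add: params_pos less_imp_le)
qed

lemma coef_yf: "1 - \<sigma> \<le> (1 - \<rho>) * (1 - \<sigma> / 2)"
proof -
  have "\<rho> \<le> \<sigma> / 2" using rho_le(4) by (simp add: \<sigma>_def)
  then have "\<rho> * (1 - \<sigma> / 2) \<le> \<sigma> / 2 * 1"
    using params_pos sigma_le by (intro mult_mono) auto
  moreover have "(1 - \<rho>) * (1 - \<sigma> / 2) = 1 - \<sigma> / 2 - \<rho> * (1 - \<sigma> / 2)"
    by (simp only: left_diff_distrib mult_1)
  ultimately show ?thesis by linarith
qed

lemma coef_uf: "1 - \<sigma> \<le> 1 - \<rho>"
  using rho_le(4) r_pos by (simp add: \<sigma>_def)

lemma coef_z: "1 / \<gamma> - \<delta> / 2 = (1 - \<rho>) / \<gamma>"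
proof -
  have "\<delta> / 2 = \<rho> / \<gamma>"
  proof -
    have "1 / (2 * L) / 16 / 2 = R / (2560 * K\<^sup>2) / (M / 2 / (40 * K\<^sup>2 * (R / 2)))"
      if "M = R * R * L" "0 < R" for R M :: real
      using that L_pos K_ge by (simp add: field_simps)
    from this[OF mu_eq r_pos] show ?thesis unfolding \<delta>_def \<beta>_def \<rho>_def \<gamma>_def \<sigma>_def \<nu>_def .
  qed
  then show ?thesis by (simp add: diff_divide_distrib)
qed

lemma coef_m: "1 - 1 / (4 * K) \<le> 1 - \<rho>" using rho_le by simp

lemma coef_xf: "1 - \<tau> - \<tau>0 + \<Lambda> * p \<le> 1 - \<rho>"
  using rho_le by (simp add: Lambda_p \<tau>_def)

lemma coef_om: "\<tau>0 + \<Lambda> * (1 - p) \<le> (1 - \<rho>) * \<Lambda>"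
proof -
  have "\<rho> * \<Lambda> \<le> r / (8 * \<kappa>\<^sup>2) * \<kappa>\<^sup>2"
    using rho_le Lambda_le params_pos r_pos by (intro mult_mono) auto
  also have "\<dots> = \<tau> / 2" using kappa by (simp add: \<tau>_def)
  finally show ?thesis using Lambda_p by (simp add: algebra_simps)
qed

text \<open>The choice of \<open>\<tau>\<^sub>0\<close>: the variance of the noise is covered by the negative snapshot term.\<close>

lemma coef_noise: "(2 * \<eta> + \<beta>) * (4 * Lbar P / real b) \<le> 2 * \<tau>0 / \<tau>"
proof -
  have "\<beta> \<le> 1 / (2 * L * r)" unfolding \<beta>_def using L_pos r_pos r_le by (intro divide_left_mono) auto
  moreover have "2 * \<eta> = 1 / (2 * L * r)" by (simp add: \<eta>_def)
  ultimately have "2 * \<eta> + \<beta> \<le> 1 / (L * r)" by simp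
  then have "(2 * \<eta> + \<beta>) * (4 * Lbar P / real b) \<le> 1 / (L * r) * (4 * Lbar P / real b)"
    using Lbar_pos by (intro mult_right_mono) auto
  also have "\<dots> = 2 * \<tau>0 / \<tau>" by (simp add: \<tau>0_def \<tau>_def mult_ac)
  finally show ?thesis .
qed

lemma admissible_par: "admissible par"
  unfolding admissible_def
  using params_pos p_pos p_le
  by (auto simp: implicit_system_iff less_imp_le)

text \<open>
  Half of the strong convexity is split off into the quadratic of the saddle point problem; \<open>D\<close> is
  the divergence of what remains.
\<close>

definition "gG i u = gradF i u - \<nu> *\<^sub>R u"
definition "D i = bregman (\<lambda>u. node_fun P i u - \<nu> / 2 * (norm u)\<^sup>2) (gG i)"

lemma D_eq: "D i u v = bregman (node_fun P i) (gradF i) u v - \<nu> / 2 * (norm (u - v))\<^sup>2"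
  unfolding D_def gG_def[abs_def] by (rule bregman_quadratic_shift)

lemma D_ge: "i \<in> {1..m} \<Longrightarrow> u \<in> Rd d \<Longrightarrow> v \<in> Rd d \<Longrightarrow> \<alpha> * (norm (u - v))\<^sup>2 \<le> D i u v"
  using node_bregman_ge[of i u v] by (simp add: D_eq \<alpha>_def \<nu>_def algebra_simps)

lemma D_nonneg:
  assumes "i \<in> {1..m}" "u \<in> Rd d" "v \<in> Rd d"
  shows "0 \<le> D i u v"
  using order_trans[OF _ D_ge[OF assms]] params_pos by simp

lemma D_le:
  assumes "i \<in> {1..m}" "u \<in> Rd d" "v \<in> Rd d"
  shows "D i u v \<le> L / 2 * (norm (u - v))\<^sup>2"
proof -
  have "0 \<le> \<nu> / 2 * (norm (u - v))\<^sup>2" using params_pos by simp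
  then show ?thesis unfolding D_eq using smooth_bregman_le[OF node_smooth[OF assms(1)] assms(2,3)] by linarith
qed

lemma gG_in: "i \<in> {1..m} \<Longrightarrow> u \<in> Rd d \<Longrightarrow> gG i u \<in> Rd d"
  by (simp add: gG_def gradF_in del: atLeastAtMost_iff)

lemma D_coercive:
  assumes i: "i \<in> {1..m}" and uv: "u \<in> Rd d" "v \<in> Rd d"
  shows "\<alpha> * (norm (u - v))\<^sup>2 + \<beta> * (norm (gG i u - gG i v))\<^sup>2 \<le> 2 * D i v u"
proof -
  have "(norm (gG i v - gG i u))\<^sup>2 \<le> 2 * L * D i v u"
    unfolding D_def
  proof (rule cocoercive[OF subspace_Rd[of d] _ L_pos _ _ uv(2,1)], unfold D_def[symmetric])
    fix u v assume uv: "u \<in> Rd d" "v \<in> Rd d"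
    show "0 \<le> D i u v" by (rule D_nonneg[OF i uv])
    show "D i u v \<le> L / 2 * (norm (u - v))\<^sup>2" by (rule D_le[OF i uv])
  qed (rule gG_in[OF i])
  then have "\<beta> * (norm (gG i u - gG i v))\<^sup>2 \<le> D i v u"
    using L_pos by (simp add: \<beta>_def norm_minus_commute field_simps)
  moreover have "\<alpha> * (norm (u - v))\<^sup>2 \<le> D i v u"
    using D_ge[OF i uv(2,1)] by (simp add: norm_minus_commute)
  ultimately show ?thesis by simp
qed

lemma bregman_le_D:
  assumes "i \<in> {1..m}" "u \<in> Rd d" "v \<in> Rd d"
  shows "bregman (node_fun P i) (gradF i) u v \<le> 2 * D i u v"
  using D_ge[OF assms] unfolding D_eq \<alpha>_def \<nu>_def by (simp add: field_simps)

end

locale adom_minimizer = adom_setting +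
  fixes ustar :: fvec
  assumes minimizer: "is_minimizer P ustar"
begin

lemma ustar_in: "ustar \<in> Rd d"
  using minimizer by (simp add: is_minimizer_def is_arg_min_def)

lemma sum_gradF_ustar: "(\<Sum>i=1..m. gradF i ustar) = 0"
proof -
  have "is_grad d (\<lambda>u. (\<Sum>i=1..m. node_fun P i u) / 1) ustar ((1 / 1) *\<^sub>R (\<Sum>i=1..m. gradF i ustar))"
    using smooth_is_grad[OF node_smooth ustar_in] by (intro is_grad_average) auto
  then have "is_grad d (\<lambda>u. \<Sum>i=1..m. node_fun P i u) ustar (\<Sum>i=1..m. gradF i ustar)" by simp
  moreover have "(\<Sum>i=1..m. node_fun P i ustar) \<le> (\<Sum>i=1..m. node_fun P i v)" if "v \<in> Rd d" for v
    using minimizer that by (auto simp: is_minimizer_def is_arg_min_def not_less)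
  ultimately show ?thesis using is_grad_minimizer ustar_in by blast
qed

end

section \<open>Transition of the algorithm\<close>

lemma inner_stack_const:
  assumes "(\<Sum>i=1..m. v i) = 0"
  shows "inner (stack m (\<lambda>_. c)) (stack m v) = 0"
  unfolding inner_stack inner_sum_right[symmetric] assms by simp

lemma sum_list_in_Rd: "(\<And>x. x \<in> set xs \<Longrightarrow> f x \<in> Rd d) \<Longrightarrow> (\<Sum>x\<leftarrow>xs. f x) \<in> Rd d"
  by (induction xs) auto

context adom_setting
begin

definition "xg s i = \<tau> *\<^sub>R st_x s i + \<tau>0 *\<^sub>R st_om s i + (1 - \<tau> - \<tau>0) *\<^sub>R st_xf s i"
definition "yg s i = \<sigma> *\<^sub>R st_y s i + (1 - \<sigma>) *\<^sub>R st_yf s i"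
definition "zg s i = \<sigma> *\<^sub>R st_z s i + (1 - \<sigma>) *\<^sub>R st_zf s i"
definition "ug s i = yg s i + zg s i"
definition "res s i = (\<gamma> / \<nu>) *\<^sub>R ug s i + st_m s i"
definition "xy s S i = (THE q. implicit_system par (st_x s i) (st_y s i) (xg s i) (yg s i) (zg s i)
   (grad_estimate P b i (S i) (xg s i) (st_om s i)) q)"
definition "snapshot_pmf s i = pmf_of_list [(st_xf s i, p), (xg s i, 0), (st_om s i, 1 - p - 0)]"

text \<open>The state after one iteration, given the sampled batches \<open>S\<close> and the new snapshots \<open>om'\<close>.\<close>

definition succ_state :: "matrix \<Rightarrow> adom_state \<Rightarrow> (nat \<Rightarrow> nat list) \<Rightarrow> stacked \<Rightarrow> adom_state" where
  "succ_state A s S om' = \<lparr>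
     st_x = (\<lambda>i. fst (xy s S i)),
     st_xf = (\<lambda>i. xg s i + \<tau> *\<^sub>R (fst (xy s S i) - st_x s i)),
     st_om = om',
     st_y = (\<lambda>i. snd (xy s S i)),
     st_yf = (\<lambda>i. yg s i + \<sigma> *\<^sub>R (snd (xy s S i) - st_y s i)),
     st_z = (\<lambda>i. st_z s i + (\<gamma> * \<delta>) *\<^sub>R (zg s i - st_z s i) - kron_apply m A (res s) i),
     st_zf = (\<lambda>i. zg s i - kron_apply m A (ug s) i),
     st_m = (\<lambda>i. res s i - kron_apply m A (res s) i),
     st_calls = (\<lambda>i. st_calls s i + 2 * b + (if om' i \<noteq> st_om s i then n else 0))\<rparr>"

lemma adom_step_eq:
  "adom_step P par b A s = bind_pmf (Pi_pmf {1..m} [] (batch_pmf P b)) (\<lambda>S.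
     bind_pmf (Pi_pmf {1..m} 0 (snapshot_pmf s)) (\<lambda>om'. return_pmf (succ_state A s S om')))"
  by (simp add: adom_step_def Let_def succ_state_def xg_def yg_def zg_def ug_def[abs_def] res_def[abs_def]
      xy_def snapshot_pmf_def[abs_def])

definition "feasible s \<longleftrightarrow> (\<forall>f\<in>{st_x, st_xf, st_om, st_y, st_yf, st_m}. f s \<in> stacked_space d m) \<and>
  st_z s \<in> consensus_perp d m \<and> st_zf s \<in> consensus_perp d m"

lemma feasibleD:
  assumes "feasible s"
  shows "i \<in> {1..m} \<Longrightarrow> st_x s i \<in> Rd d" "i \<in> {1..m} \<Longrightarrow> st_xf s i \<in> Rd d" "i \<in> {1..m} \<Longrightarrow> st_om s i \<in> Rd d"
    "i \<in> {1..m} \<Longrightarrow> st_y s i \<in> Rd d" "i \<in> {1..m} \<Longrightarrow> st_yf s i \<in> Rd d" "i \<in> {1..m} \<Longrightarrow> st_m s i \<in> Rd d"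
    "i \<in> {1..m} \<Longrightarrow> st_z s i \<in> Rd d" "i \<in> {1..m} \<Longrightarrow> st_zf s i \<in> Rd d"
    "i \<in> {1..m} \<Longrightarrow> xg s i \<in> Rd d" "i \<in> {1..m} \<Longrightarrow> yg s i \<in> Rd d" "i \<in> {1..m} \<Longrightarrow> zg s i \<in> Rd d"
    "i \<in> {1..m} \<Longrightarrow> ug s i \<in> Rd d" "i \<in> {1..m} \<Longrightarrow> res s i \<in> Rd d"
    "(\<Sum>i=1..m. st_z s i) = 0" "(\<Sum>i=1..m. st_zf s i) = 0" "(\<Sum>i=1..m. zg s i) = 0"
  using assms
  by (simp_all add: feasible_def stacked_space_def consensus_perp_def xg_def yg_def zg_def ug_def res_def
      sum.distrib flip: scaleR_right.sum)

lemma xy_implicit: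
  "implicit_system par (st_x s i) (st_y s i) (xg s i) (yg s i) (zg s i)
     (grad_estimate P b i (S i) (xg s i) (st_om s i)) (xy s S i)"
  unfolding xy_def
  by (rule theI', use admissible_par in \<open>simp only: admissible_def\<close>)

lemma xy_in:
  assumes s: "feasible s" and i: "i \<in> {1..m}" and S: "set (S i) \<subseteq> {1..n}"
  shows "fst (xy s S i) \<in> Rd d \<and> snd (xy s S i) \<in> Rd d"
proof -
  define g where "g = grad_estimate P b i (S i) (xg s i) (st_om s i)"
  have "g \<in> Rd d"
  proof -
    have "gradf i j (xg s i) \<in> Rd d \<and> gradf i j (st_om s i) \<in> Rd d" if "j \<in> set (S i)" for j
      using gradf_in[OF i] feasibleD(3,9)[OF s i] S that by blast
    then have "(\<Sum>j\<leftarrow>S i. c j *\<^sub>R (gradf i j (xg s i) - gradf i j (st_om s i))) \<in> Rd d" for c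
      by (intro sum_list_in_Rd) simp
    then show ?thesis
      unfolding g_def grad_estimate_def by (simp add: gradF_in[OF i] feasibleD(3)[OF s i])
  qed
  moreover note xy_implicit[of s i S, folded g_def, unfolded implicit_system_iff[of par, simplified, OF params_pos(5,8) less_imp_le[OF params_pos(6)] less_imp_le[OF params_pos(7)]]]
  ultimately show ?thesis using feasibleD[OF s] i by simp
qed

lemma set_batchD: "i \<in> {1..m} \<Longrightarrow> S \<in> set_pmf (batch_pmf P b i) \<Longrightarrow> set S \<subseteq> {1..n}"
  using set_index_pmf[of i] by (auto simp: batch_pmf_eq set_replicate_pmf lists_eq_set)

lemma snapshot_wf: "pmf_of_list_wf [(st_xf s i, p), (xg s i, 0), (st_om s i, 1 - p - 0)]"
  using p_pos p_le by (intro pmf_of_list_wfI) auto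

lemma set_snapshot_pmf: "set_pmf (snapshot_pmf s i) \<subseteq> {st_xf s i, xg s i, st_om s i}"
  using set_pmf_of_list[OF snapshot_wf] by (auto simp: snapshot_pmf_def)

lemma finite_snapshot_pmf: "finite (set_pmf (snapshot_pmf s i))"
  by (rule finite_subset[OF set_snapshot_pmf]) simp

lemma expectation_snapshot_pmf:
  fixes f :: "fvec \<Rightarrow> real"
  shows "measure_pmf.expectation (snapshot_pmf s i) f = p * f (st_xf s i) + (1 - p) * f (st_om s i)"
  by (simp add: snapshot_pmf_def expectation_pmf_of_list[OF snapshot_wf, simplified])

lemma finite_Pi_batch: "finite (set_pmf (Pi_pmf {1..m} [] (batch_pmf P b)))"
  by (intro finite_set_Pi_pmf finite_batch_pmf) auto

lemma finite_Pi_snapshot: "finite (set_pmf (Pi_pmf {1..m} 0 (snapshot_pmf s)))"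
  by (intro finite_set_Pi_pmf finite_snapshot_pmf) auto

lemma finite_adom_step: "finite (set_pmf (adom_step P par b A s))"
  unfolding adom_step_eq set_bind_pmf by (intro finite_UN_I finite_Pi_batch finite_Pi_snapshot) simp

text \<open>
  Batches consist of valid indices and new snapshots are among \<open>x\<^sub>f\<close>,
  \<open>x\<^sub>g\<close> and \<open>\<omega>\<close>, so all iterates stay in \<open>\<real>\<^sup>d\<close>;
  columns of \<open>A\<close> sum to \<open>0\<close>, so \<open>z\<close> and \<open>z\<^sub>f\<close> stay
  orthogonal to the consensus space.
\<close>

lemma feasible_succ:
  assumes s: "feasible s" and A: "gossip_step d m K A"
    and S: "\<And>i. i \<in> {1..m} \<Longrightarrow> S i \<in> set_pmf (batch_pmf P b i)"
    and om: "\<And>i. i \<in> {1..m} \<Longrightarrow> om' i \<in> set_pmf (snapshot_pmf s i)"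
  shows "feasible (succ_state A s S om')"
proof -
  have xy: "fst (xy s S i) \<in> Rd d" "snd (xy s S i) \<in> Rd d" if "i \<in> {1..m}" for i
    using xy_in[of s _ S, OF s that set_batchD[OF that S[OF that]]] by auto
  have om': "om' i \<in> Rd d" if "i \<in> {1..m}" for i
  proof -
    have "om' i \<in> {st_xf s i, xg s i, st_om s i}" using om[OF that] set_snapshot_pmf by blast
    then show ?thesis using feasibleD(2,3,9)[OF s that] by auto
  qed
  have kr: "kron_apply m A (res s) i \<in> Rd d" "kron_apply m A (ug s) i \<in> Rd d" for i
    using feasibleD(12,13)[OF s] unfolding kron_apply_def by (intro Rd_closed; blast)+
  have sr: "(\<Sum>i=1..m. kron_apply m A x i) = 0" for x by (rule gossip_step_sum_kron[OF A])
  show ?thesis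
    using feasibleD[OF s] xy om' kr sr
    by (simp add: feasible_def stacked_space_def consensus_perp_def succ_state_def sum.distrib sum_subtractf
        del: atLeastAtMost_iff flip: scaleR_right.sum)
qed

lemma feasible_step:
  assumes "feasible s" "gossip_step d m K A" "s' \<in> set_pmf (adom_step P par b A s)"
  shows "feasible s'"
proof -
  obtain S om' where S: "S \<in> set_pmf (Pi_pmf {1..m} [] (batch_pmf P b))"
    and om': "om' \<in> set_pmf (Pi_pmf {1..m} 0 (snapshot_pmf s))" and s': "s' = succ_state A s S om'"
    using assms(3) unfolding adom_step_eq set_bind_pmf set_return_pmf by blast
  show ?thesis
    unfolding s'
    by (rule feasible_succ[OF assms(1,2) set_Pi_pmfD[OF _ S] set_Pi_pmfD[OF _ om']]) simp_all
qed

end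

section \<open>The Lyapunov function\<close>

context adom_minimizer
begin

text \<open>The dual part of the saddle point; \<open>y\<^sub>* + z\<^sub>* = - \<nu> x\<^sub>*\<close> lies in the consensus space.\<close>

definition "ys i = gG i ustar"
definition "zs i = - gradF i ustar"

lemma us_eq: "ys i + zs i = - \<nu> *\<^sub>R ustar"
  by (simp add: ys_def zs_def gG_def)

lemma sum_zs: "(\<Sum>i=1..m. zs i) = 0"
  by (simp add: zs_def sum_negf sum_gradF_ustar)

text \<open>
  The Lyapunov function is split into this part, whose value after a step depends only on the batches, and
  \<open>snapshot_potential\<close>, which depends only on the independent snapshot draws. The variable
  \<open>z\<close> enters through the corrected iterate \<open>z - m\<close>, with \<open>m\<close> projected.
\<close>

definition "main_potential s = (1 / \<eta> + \<alpha>) * sqnorm m (\<lambda>i. st_x s i - ustar)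
  + 2 / \<tau> * (\<Sum>i=1..m. D i (st_xf s i) ustar)
  + (1 / \<theta> + \<beta> / 2) * sqnorm m (\<lambda>i. st_y s i - ys i)
  + \<beta> / (2 * \<sigma>) * (1 - \<sigma> / 2) * sqnorm m (\<lambda>i. st_yf s i - ys i)
  + sqnorm m (\<lambda>i. st_yf s i + st_zf s i - (ys i + zs i)) / (\<nu> * \<sigma>)
  + sqnorm m (\<lambda>i. st_z s i - proj_perp m (st_m s) i - zs i) / \<gamma>
  + C * sqnorm m (proj_perp m (st_m s))"

definition "snapshot_potential om = 2 / \<tau> * \<Lambda> * (\<Sum>i=1..m. D i (om i) ustar)"

definition "noise_term s i S =
  2 * inner (noise b i (xg s i) (st_om s i) S)
        (\<beta> *\<^sub>R (gG i (xg s i) - gG i ustar) - (st_x s i - ustar))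
  + (2 * \<eta> + \<beta>) * (norm (noise b i (xg s i) (st_om s i) S))\<^sup>2"

definition "main_bound s = sqnorm m (\<lambda>i. st_x s i - ustar) / \<eta>
  + 2 * (1 - \<tau> - \<tau>0) / \<tau> * (\<Sum>i=1..m. D i (st_xf s i) ustar)
  + 2 * \<tau>0 / \<tau> * (\<Sum>i=1..m. D i (st_om s i) ustar - D i (st_om s i) (xg s i))
  + sqnorm m (\<lambda>i. st_y s i - ys i) / \<theta>
  + \<beta> / (2 * \<sigma>) * (1 - \<sigma>) * sqnorm m (\<lambda>i. st_yf s i - ys i)
  + (1 - \<sigma>) * sqnorm m (\<lambda>i. st_yf s i + st_zf s i - (ys i + zs i)) / (\<nu> * \<sigma>)
  + (1 / \<gamma> - \<delta> / 2) * sqnorm m (\<lambda>i. st_z s i - proj_perp m (st_m s) i - zs i)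
  + C * (1 - 1 / (4 * K)) * sqnorm m (proj_perp m (st_m s))"

text \<open>The nodes interact only through \<open>W\<close>, so the primal estimate is a sum of estimates for the nodes.\<close>

lemma primal_part:
  assumes s: "feasible s" and S: "\<And>i. i \<in> {1..m} \<Longrightarrow> set (S i) \<subseteq> {1..n}"
  defines "X \<equiv> \<lambda>i. fst (xy s S i)" and "Y \<equiv> \<lambda>i. snd (xy s S i)"
  shows "(1 / \<eta> + \<alpha>) * sqnorm m (\<lambda>i. X i - ustar)
      + 2 / \<tau> * (\<Sum>i=1..m. D i (xg s i + \<tau> *\<^sub>R (X i - st_x s i)) ustar)
      + (1 / \<theta> + \<beta>) * sqnorm m (\<lambda>i. Y i - ys i) + sqnorm m (\<lambda>i. Y i - st_y s i) / \<theta>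
    \<le> sqnorm m (\<lambda>i. st_x s i - ustar) / \<eta>
      + 2 * (1 - \<tau> - \<tau>0) / \<tau> * (\<Sum>i=1..m. D i (st_xf s i) ustar)
      + 2 * \<tau>0 / \<tau> * (\<Sum>i=1..m. D i (st_om s i) ustar - D i (st_om s i) (xg s i))
      + sqnorm m (\<lambda>i. st_y s i - ys i) / \<theta>
      - 2 / \<nu> * inner (stack m (ug s) - stack m (\<lambda>i. ys i + zs i)) (stack m Y - stack m ys)
      + (\<Sum>i=1..m. noise_term s i (S i))"
proof -
  have node: "(1 / \<eta> + \<alpha>) * (norm (X i - ustar))\<^sup>2 + 2 / \<tau> * D i (xg s i + \<tau> *\<^sub>R (X i - st_x s i)) ustar
      + (1 / \<theta> + \<beta>) * (norm (Y i - ys i))\<^sup>2 + (norm (Y i - st_y s i))\<^sup>2 / \<theta>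
    \<le> (norm (st_x s i - ustar))\<^sup>2 / \<eta> + 2 * (1 - \<tau> - \<tau>0) / \<tau> * D i (st_xf s i) ustar
      + 2 * \<tau>0 / \<tau> * (D i (st_om s i) ustar - D i (st_om s i) (xg s i))
      + (norm (st_y s i - ys i))\<^sup>2 / \<theta>
      - 2 / \<nu> * inner (ug s i - (ys i + zs i)) (Y i - ys i)
      + (2 * inner (noise b i (xg s i) (st_om s i) (S i))
           (\<beta> *\<^sub>R (gG i (xg s i) - gG i ustar) - (st_x s i - ustar))
         + (2 * \<eta> + \<beta>) * (norm (noise b i (xg s i) (st_om s i) (S i)))\<^sup>2)" if i: "i \<in> {1..m}" for i
  proof -
    have impl: "X i = st_x s i + (\<eta> * \<alpha>) *\<^sub>R (xg s i - X i)
        - \<eta> *\<^sub>R (grad_estimate P b i (S i) (xg s i) (st_om s i) - \<nu> *\<^sub>R xg s i - Y i)"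
      "Y i = st_y s i + (\<theta> * \<beta>) *\<^sub>R (grad_estimate P b i (S i) (xg s i) (st_om s i) - \<nu> *\<^sub>R xg s i - Y i)
        - \<theta> *\<^sub>R ((1 / \<nu>) *\<^sub>R ug s i + X i)"
      using xy_implicit[of s i S]
      by (simp_all only: implicit_system_def X_def Y_def ug_def par_sel split_beta)
    have ge: "grad_estimate P b i (S i) (xg s i) (st_om s i) - \<nu> *\<^sub>R xg s i - Y i
      = gG i (xg s i) - gG i ustar + noise b i (xg s i) (st_om s i) (S i) + ys i - Y i"
      by (simp add: noise_def gG_def ys_def)
    have in_Rd: "xg s i \<in> Rd d" "st_xf s i \<in> Rd d" "xg s i + \<tau> *\<^sub>R (X i - st_x s i) \<in> Rd d"
      using feasibleD[OF s] i xy_in[of s _ S, OF s i S[OF i]] by (auto simp: X_def)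
    have us: "(1 / \<nu>) *\<^sub>R (ys i + zs i) + ustar = 0"
      using params_pos(1) by (simp add: us_eq)
    note step = accelerated_node_step[OF params_pos(5,8) less_imp_le[OF params_pos(6)] less_imp_le[OF params_pos(7)]
      params_pos(3) tau_sum_le smooth_step xg_def impl[unfolded ge] us refl,
      of "\<lambda>u. node_fun P i u - \<nu> / 2 * (norm u)\<^sup>2", folded D_def,
      OF D_nonneg[OF i in_Rd(2,1)] D_le[OF i in_Rd(3,1)] D_coercive[OF i in_Rd(1) ustar_in]]
    then show ?thesis by (simp add: add.assoc)
  qed
  note sum_mono[of "{1..m}", OF node]
  then show ?thesis
    unfolding noise_term_def sqnorm_def stack_diff[symmetric] inner_stack
    by (simp add: sum.distrib sum_subtractf sum_distrib_left[symmetric] sum_divide_distrib[symmetric])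
qed

lemma dual_part:
  fixes S :: "nat \<Rightarrow> nat list" and om' :: stacked
  assumes s: "feasible s" and A: "gossip_step d m K A"
  defines "s' \<equiv> succ_state A s S om'"
  shows "sqnorm m (\<lambda>i. st_yf s' i + st_zf s' i - (ys i + zs i)) / (\<nu> * \<sigma>)
      + \<beta> / (2 * \<sigma>) * (1 - \<sigma> / 2) * sqnorm m (\<lambda>i. st_yf s' i - ys i)
      + sqnorm m (\<lambda>i. st_z s' i - proj_perp m (st_m s') i - zs i) / \<gamma>
      + C * sqnorm m (proj_perp m (st_m s'))
      - 2 / \<nu> * inner (stack m (ug s) - stack m (\<lambda>i. ys i + zs i)) (stack m (st_y s') - stack m ys)
    \<le> (1 - \<sigma>) * sqnorm m (\<lambda>i. st_yf s i + st_zf s i - (ys i + zs i)) / (\<nu> * \<sigma>)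
      + \<beta> / (2 * \<sigma>) * (1 - \<sigma>) * sqnorm m (\<lambda>i. st_yf s i - ys i)
      + (1 / \<gamma> - \<delta> / 2) * sqnorm m (\<lambda>i. st_z s i - proj_perp m (st_m s) i - zs i)
      + C * (1 - 1 / (4 * K)) * sqnorm m (proj_perp m (st_m s))
      + \<beta> / 2 * sqnorm m (\<lambda>i. st_y s' i - ys i) + 10 * K * \<sigma> / \<nu> * sqnorm m (\<lambda>i. st_y s' i - st_y s i)"
proof -
  define pu where "pu = stack m (proj_perp m (ug s))"
  define pm where "pm = stack m (proj_perp m (st_m s))"
  define wu where "wu = stack m (kron_apply m A (ug s))"
  note sel = s'_def succ_state_def
  have sr: "(\<Sum>i=1..m. kron_apply m A x i) = 0" for x by (rule gossip_step_sum_kron[OF A])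
  have ug: "stack m (ug s) = \<sigma> *\<^sub>R (stack m (st_y s) + stack m (st_z s))
      + (1 - \<sigma>) *\<^sub>R (stack m (st_yf s) + stack m (st_zf s))"
    unfolding stack_simps[symmetric] by (intro stack_cong) (simp add: ug_def yg_def zg_def algebra_simps)
  have yg: "stack m (yg s) = \<sigma> *\<^sub>R stack m (st_y s) + (1 - \<sigma>) *\<^sub>R stack m (st_yf s)"
    unfolding stack_simps[symmetric] by (intro stack_cong) (simp add: yg_def)
  have us: "stack m (\<lambda>i. ys i + zs i) = stack m ys + stack m zs" by (rule stack_add)
  have uf': "stack m (\<lambda>i. st_yf s' i + st_zf s' i)
      = stack m (ug s) + \<sigma> *\<^sub>R (stack m (st_y s') - stack m (st_y s)) - wu"
    unfolding wu_def stack_simps[symmetric] by (intro stack_cong) (simp add: sel ug_def)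
  have yf': "stack m (st_yf s') = stack m (yg s) + \<sigma> *\<^sub>R (stack m (st_y s') - stack m (st_y s))"
    unfolding stack_simps[symmetric] by (intro stack_cong) (simp add: sel)
  have res: "proj_perp m (res s) i = (\<gamma> / \<nu>) *\<^sub>R proj_perp m (ug s) i + proj_perp m (st_m s) i" for i
    unfolding res_def[abs_def] by (simp only: proj_perp_add proj_perp_scaleR)
  have m': "proj_perp m (st_m s') i = proj_perp m (res s) i - kron_apply m A (res s) i" for i
    by (simp add: sel proj_perp_diff proj_perp_id[OF sr])
  (* Error feedback: the two applications of A cancel in z' - m', leaving the exact projection. *)
  have zh': "stack m (\<lambda>i. st_z s' i - proj_perp m (st_m s') i) = stack m (st_z s) - pm
      + (\<gamma> * \<delta>) *\<^sub>R (stack m (ug s) - stack m (yg s) - stack m (st_z s)) - (\<gamma> / \<nu>) *\<^sub>R pu"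
    unfolding pm_def pu_def stack_simps[symmetric]
    by (intro stack_cong) (simp add: m' res, simp add: sel ug_def)
  have orth: "inner (stack m (ug s) - stack m (\<lambda>i. ys i + zs i) - pu) (stack m v) = 0"
    if "(\<Sum>i=1..m. v i) = 0" for v
    using inner_proj_perp[OF that, of "ug s"] inner_stack_const[OF that, of "- \<nu> *\<^sub>R ustar"]
    by (simp add: pu_def us_eq inner_diff_left)
  have o1: "inner (stack m (ug s) - stack m (\<lambda>i. ys i + zs i) - pu) wu = 0"
    unfolding wu_def by (rule orth[OF sr])
  have o2: "inner (stack m (ug s) - stack m (\<lambda>i. ys i + zs i) - pu) (stack m (st_z s) - stack m zs) = 0"
    unfolding stack_diff[symmetric, of m "st_z s" zs]
    by (rule orth) (simp add: sum_subtractf feasibleD(14)[OF s] sum_zs)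
  have "ug s \<in> stacked_space d m" "res s \<in> stacked_space d m"
    using feasibleD(12,13)[OF s] by (auto simp: stacked_space_def)
  note contr = gossip_contracts_proj[OF A this(1)] gossip_contracts_proj[OF A this(2)]
  have c1: "(norm (pu - wu))\<^sup>2 \<le> (1 - 1 / K) * (norm pu)\<^sup>2"
    unfolding pu_def wu_def by (rule contr)
  have c2: "(norm (stack m (proj_perp m (st_m s'))))\<^sup>2 \<le> (1 - 1 / K) * (norm (pm + (\<gamma> / \<nu>) *\<^sub>R pu))\<^sup>2"
  proof -
    have "stack m (proj_perp m (st_m s')) = stack m (proj_perp m (res s)) - stack m (kron_apply m A (res s))"
      unfolding stack_simps[symmetric] by (intro stack_cong) (simp add: m')
    moreover have "stack m (proj_perp m (res s)) = pm + (\<gamma> / \<nu>) *\<^sub>R pu"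
      unfolding pm_def pu_def stack_simps[symmetric] by (intro stack_cong) (simp add: res)
    ultimately show ?thesis using contr(2) by simp
  qed
  have "1 \<le> K" using K_ge by simp
  note dual_consensus_step[OF ug yg us \<gamma>_def \<delta>_def C_def params_pos(2) sigma_le params_pos(1,7) beta_le
      this uf' yf' zh' o1 o2 c1 c2]
  then show ?thesis
    unfolding pm_def us[symmetric] stack_add[symmetric] stack_diff[symmetric] norm_stack .
qed

text \<open>
  Adding the primal and dual estimates cancels the coupling term \<open>\<langle>u\<^sub>g - u\<^sub>*, y' -
  y\<^sub>*\<rangle>\<close> and, because \<open>1 / \<theta> = 10 K \<sigma> / \<nu>\<close>, the term
  \<open>|y' - y|\<^sup>2\<close>.
\<close>

lemma main_potential_succ_le:
  assumes s: "feasible s" and A: "gossip_step d m K A" and S: "\<And>i. i \<in> {1..m} \<Longrightarrow> set (S i) \<subseteq> {1..n}"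
  shows "main_potential (succ_state A s S om') \<le> main_bound s + (\<Sum>i=1..m. noise_term s i (S i))"
proof -
  define s' where "s' = succ_state A s S om'"
  have sel: "st_x s' = (\<lambda>i. fst (xy s S i))" "st_y s' = (\<lambda>i. snd (xy s S i))"
    "st_xf s' = (\<lambda>i. xg s i + \<tau> *\<^sub>R (fst (xy s S i) - st_x s i))"
    by (simp_all add: s'_def succ_state_def)
  have th: "10 * K * \<sigma> / \<nu> * q = q / \<theta>" for q using theta_inv by (metis mult.commute mult_1 times_divide_eq_right)
  have sp: "(1 / \<theta> + \<beta>) * q = (1 / \<theta> + \<beta> / 2) * q + \<beta> / 2 * q" for q by (simp add: algebra_simps)
  have combine: "a1 + a2 + y1 + v + u + w + q \<le> r1 + r2 + r3 + r4 + d2 + d1 + d3 + d4 + nz"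
    if "a1 + a2 + (y1 + y2) + dy \<le> r1 + r2 + r3 + r4 - ip + nz"
      "u + v + w + q - ip \<le> d1 + d2 + d3 + d4 + y2 + dy"
    for a1 a2 y1 y2 u v w q dy ip r1 r2 r3 r4 d1 d2 d3 d4 nz :: real
    using that by linarith
  show ?thesis
    unfolding s'_def[symmetric] main_potential_def main_bound_def sel
    by (rule combine[OF primal_part[OF s, of S, unfolded sp]
          dual_part[OF s A, of S om', folded s'_def, unfolded th sel]]) (rule S)
qed

end

context adom_setting
begin

lemma expectation_adom_step:
  fixes h :: "adom_state \<Rightarrow> real"
  shows "measure_pmf.expectation (adom_step P par b A s) h
    = measure_pmf.expectation (Pi_pmf {1..m} [] (batch_pmf P b)) (\<lambda>S.
        measure_pmf.expectation (Pi_pmf {1..m} 0 (snapshot_pmf s)) (\<lambda>om'. h (succ_state A s S om')))"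
proof -
  have inner: "measure_pmf.expectation (bind_pmf (Pi_pmf {1..m} 0 (snapshot_pmf s)) (\<lambda>om'. return_pmf (succ_state A s S om'))) h
     = measure_pmf.expectation (Pi_pmf {1..m} 0 (snapshot_pmf s)) (\<lambda>om'. h (succ_state A s S om'))" for S
    by (subst expectation_bind_finite[OF finite_Pi_snapshot]) simp_all
  show ?thesis
    unfolding adom_step_eq
    by (subst expectation_bind_finite[OF finite_Pi_batch])
       (simp_all only: inner set_bind_pmf set_return_pmf finite_UN[OF finite_Pi_snapshot] finite.intros, simp)
qed

text \<open>
  A snapshot changes with probability at most \<open>p \<le> b / n\<close> and then costs \<open>n\<close>
  calls, so this adds at most \<open>b\<close> to the \<open>2 b\<close> calls of the batch.
\<close>

lemma calls_step:
  assumes i: "i \<in> {1..m}"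
  shows "measure_pmf.expectation (adom_step P par b A s) (\<lambda>s'. real (st_calls s' i))
    \<le> real (st_calls s i) + 3 * real b"
proof -
  note int = integrable_measure_pmf_finite[OF finite_Pi_snapshot]
  have "measure_pmf.expectation (adom_step P par b A s) (\<lambda>s'. real (st_calls s' i))
     = measure_pmf.expectation (Pi_pmf {1..m} 0 (snapshot_pmf s))
         (\<lambda>om'. real (st_calls s i + 2 * b) + (if om' i \<noteq> st_om s i then real n else 0))"
    unfolding expectation_adom_step succ_state_def by (simp add: if_distrib cong: if_cong)
  also have "\<dots> = real (st_calls s i + 2 * b)
      + measure_pmf.expectation (Pi_pmf {1..m} 0 (snapshot_pmf s)) (\<lambda>om'. if om' i \<noteq> st_om s i then real n else 0)"
    by (simp add: int)
  also have "measure_pmf.expectation (Pi_pmf {1..m} 0 (snapshot_pmf s)) (\<lambda>om'. if om' i \<noteq> st_om s i then real n else 0)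
      = measure_pmf.expectation (snapshot_pmf s i) (\<lambda>w. if w \<noteq> st_om s i then real n else 0)"
    using i by (intro expectation_Pi_component[where f = "\<lambda>w. if w \<noteq> st_om s i then real n else 0"]) auto
  also have "\<dots> \<le> p * real n" using p_pos by (simp add: expectation_snapshot_pmf)
  also have "p * real n \<le> real b"
  proof -
    have "p * real n \<le> real b / real n * real n" unfolding p_def by (intro mult_right_mono) auto
    then show ?thesis using dims by simp
  qed
  finally show ?thesis by simp
qed

end

context adom_minimizer
begin

definition "lyapunov s = main_potential s + snapshot_potential (st_om s)"

lemma snapshot_potential_mean:
  "measure_pmf.expectation (Pi_pmf {1..m} 0 (snapshot_pmf s)) snapshot_potential
    = 2 / \<tau> * \<Lambda> * (\<Sum>i=1..m. p * D i (st_xf s i) ustar + (1 - p) * D i (st_om s i) ustar)"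
proof -
  note int = integrable_measure_pmf_finite[OF finite_Pi_snapshot]
  have "measure_pmf.expectation (Pi_pmf {1..m} 0 (snapshot_pmf s)) snapshot_potential
     = 2 / \<tau> * \<Lambda> * (\<Sum>i=1..m. measure_pmf.expectation (Pi_pmf {1..m} 0 (snapshot_pmf s)) (\<lambda>om'. D i (om' i) ustar))"
    unfolding snapshot_potential_def[abs_def] by (simp add: int Bochner_Integration.integral_sum)
  also have "(\<Sum>i=1..m. measure_pmf.expectation (Pi_pmf {1..m} 0 (snapshot_pmf s)) (\<lambda>om'. D i (om' i) ustar))
    = (\<Sum>i=1..m. p * D i (st_xf s i) ustar + (1 - p) * D i (st_om s i) ustar)"
    by (intro sum.cong refl, subst expectation_Pi_component[where f = "\<lambda>w. D _ w ustar"])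
       (auto simp: expectation_snapshot_pmf)
  finally show ?thesis .
qed

lemma noise_term_mean:
  assumes s: "feasible s" and i: "i \<in> {1..m}"
  shows "measure_pmf.expectation (batch_pmf P b i) (noise_term s i)
    \<le> 2 * \<tau>0 / \<tau> * D i (st_om s i) (xg s i)"
proof -
  note int = integrable_measure_pmf_finite[OF finite_batch_pmf[OF i]]
  have xg: "xg s i \<in> Rd d" and om: "st_om s i \<in> Rd d" using feasibleD[OF s] i by blast+
  have Dn: "0 \<le> D i (st_om s i) (xg s i)" by (rule D_nonneg[OF i om xg])
  have pos: "0 \<le> 2 * \<eta> + \<beta>" using params_pos(5,7) by linarith
  have "measure_pmf.expectation (batch_pmf P b i) (noise_term s i)
     = 2 * measure_pmf.expectation (batch_pmf P b i) (\<lambda>S. inner (noise b i (xg s i) (st_om s i) S)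
          (\<beta> *\<^sub>R (gG i (xg s i) - gG i ustar) - (st_x s i - ustar)))
       + (2 * \<eta> + \<beta>) * measure_pmf.expectation (batch_pmf P b i) (\<lambda>S. (norm (noise b i (xg s i) (st_om s i) S))\<^sup>2)"
    unfolding noise_term_def[abs_def] by (simp add: int)
  also have "\<dots> = (2 * \<eta> + \<beta>) * measure_pmf.expectation (batch_pmf P b i) (\<lambda>S. (norm (noise b i (xg s i) (st_om s i) S))\<^sup>2)"
    by (simp add: noise_mean[OF i xg om b_pos])
  also have "\<dots> \<le> (2 * \<eta> + \<beta>) * (2 * Lbar P / real b * (2 * D i (st_om s i) (xg s i)))"
  proof (intro mult_left_mono order_trans[OF noise_variance[OF i xg om b_pos]] bregman_le_D[OF i om xg] pos)
    show "0 \<le> 2 * Lbar P / real b" using Lbar_pos by simp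
  qed
  also have "\<dots> = (2 * \<eta> + \<beta>) * (4 * Lbar P / real b) * D i (st_om s i) (xg s i)" by simp
  also have "\<dots> \<le> 2 * \<tau>0 / \<tau> * D i (st_om s i) (xg s i)"
    by (rule mult_right_mono[OF coef_noise Dn])
  finally show ?thesis .
qed

text \<open>
  After taking expectations, the terms \<open>D(\<omega>, x\<^sub>g)\<close> cancel and every other term is
  compared with its counterpart in the Lyapunov function.
\<close>

lemma lyapunov_terms_contract:
  assumes s: "feasible s"
  shows "main_bound s + (\<Sum>i=1..m. 2 * \<tau>0 / \<tau> * D i (st_om s i) (xg s i))
      + 2 / \<tau> * \<Lambda> * (\<Sum>i=1..m. p * D i (st_xf s i) ustar + (1 - p) * D i (st_om s i) ustar)
    \<le> (1 - \<rho>) * lyapunov s"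
proof -
  define Xf where "Xf = (\<Sum>i=1..m. D i (st_xf s i) ustar)"
  define Om where "Om = (\<Sum>i=1..m. D i (st_om s i) ustar)"
  define R where "R = (\<Sum>i=1..m. D i (st_om s i) (xg s i))"
  have Xf: "0 \<le> Xf" and Om: "0 \<le> Om"
    unfolding Xf_def Om_def
    by (intro sum_nonneg D_nonneg ustar_in feasibleD[OF s]; assumption)+
  have e1: "(\<Sum>i=1..m. 2 * \<tau>0 / \<tau> * D i (st_om s i) (xg s i)) = 2 * \<tau>0 / \<tau> * R"
    unfolding R_def by (simp only: sum_distrib_left)
  have e2: "(\<Sum>i=1..m. p * D i (st_xf s i) ustar + (1 - p) * D i (st_om s i) ustar) = p * Xf + (1 - p) * Om"
    unfolding Xf_def Om_def by (simp only: sum.distrib sum_distrib_left)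
  have e3: "(\<Sum>i=1..m. D i (st_om s i) ustar - D i (st_om s i) (xg s i)) = Om - R"
    unfolding R_def Om_def by (simp only: sum_subtractf)
  note q = sqnorm_nonneg[of m]
  have t1: "sqnorm m x / \<eta> \<le> (1 - \<rho>) * ((1 / \<eta> + \<alpha>) * sqnorm m x)" for x
    using mult_right_mono[OF coef_x q[of x]] by (simp only: mult.assoc) simp
  have t2: "sqnorm m x / \<theta> \<le> (1 - \<rho>) * ((1 / \<theta> + \<beta> / 2) * sqnorm m x)" for x
    using mult_right_mono[OF coef_y q[of x]] by (simp only: mult.assoc) simp
  have t3: "\<beta> / (2 * \<sigma>) * (1 - \<sigma>) * sqnorm m x \<le> (1 - \<rho>) * (\<beta> / (2 * \<sigma>) * (1 - \<sigma> / 2) * sqnorm m x)" for x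
  proof -
    have "0 \<le> \<beta> / (2 * \<sigma>) * sqnorm m x" using params_pos q[of x] by simp
    from mult_right_mono[OF coef_yf this] show ?thesis by (simp only: mult_ac)
  qed
  have t4: "(1 - \<sigma>) * sqnorm m x / (\<nu> * \<sigma>) \<le> (1 - \<rho>) * (sqnorm m x / (\<nu> * \<sigma>))" for x
  proof -
    have "0 \<le> sqnorm m x / (\<nu> * \<sigma>)" using params_pos q[of x] by simp
    from mult_right_mono[OF coef_uf this] show ?thesis by simp
  qed
  have t5: "(1 / \<gamma> - \<delta> / 2) * sqnorm m x \<le> (1 - \<rho>) * (sqnorm m x / \<gamma>)" for x
    unfolding coef_z by simp
  have t6: "C * (1 - 1 / (4 * K)) * sqnorm m x \<le> (1 - \<rho>) * (C * sqnorm m x)" for x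
  proof -
    have "0 \<le> C * sqnorm m x" using params_pos q[of x] by simp
    from mult_right_mono[OF coef_m this] show ?thesis by (simp only: mult_ac)
  qed
  have factor: "2 * a / \<tau> * x + 2 / \<tau> * l * (c * x) = (a + l * c) * (2 / \<tau> * x)" for a c l x
    by (simp add: algebra_simps add_divide_distrib)
  have t7: "2 * (1 - \<tau> - \<tau>0) / \<tau> * Xf + 2 / \<tau> * \<Lambda> * (p * Xf) \<le> (1 - \<rho>) * (2 / \<tau> * Xf)"
  proof -
    have "0 \<le> 2 / \<tau> * Xf" using params_pos Xf by simp
    from mult_right_mono[OF coef_xf this] show ?thesis by (simp only: factor)
  qed
  have t8: "2 * \<tau>0 / \<tau> * Om + 2 / \<tau> * \<Lambda> * ((1 - p) * Om) \<le> (1 - \<rho>) * (2 / \<tau> * \<Lambda> * Om)"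
  proof -
    have "0 \<le> 2 / \<tau> * Om" using params_pos Om by simp
    moreover have "(1 - \<rho>) * \<Lambda> * (2 / \<tau> * Om) = (1 - \<rho>) * (2 / \<tau> * \<Lambda> * Om)" by simp
    ultimately show ?thesis using mult_right_mono[OF coef_om] by (simp only: factor) metis
  qed
  have dist: "(1 - \<rho>) * (a1 + a2 + a3 + a4 + a5 + a6 + a7 + a8)
    = (1 - \<rho>) * a1 + (1 - \<rho>) * a2 + (1 - \<rho>) * a3 + (1 - \<rho>) * a4 + (1 - \<rho>) * a5 + (1 - \<rho>) * a6
      + (1 - \<rho>) * a7 + (1 - \<rho>) * a8" for a1 a2 a3 a4 a5 a6 a7 a8
    by (simp only: distrib_left)
  have combine: "b1 + b2 + c * (Om - R) + b4 + b5 + b6 + b7 + b8 + c * R + l * (pX + pO)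
      \<le> a1 + a2 + a3 + a4 + a5 + a6 + a7 + a8"
    if "b1 \<le> a1" "b2 + l * pX \<le> a2" "b4 \<le> a3" "b5 \<le> a4" "b6 \<le> a5" "b7 \<le> a6" "b8 \<le> a7" "c * Om + l * pO \<le> a8"
    for a1 a2 a3 a4 a5 a6 a7 a8 b1 b2 b4 b5 b6 b7 b8 c l pX pO :: real
  proof -
    have "c * (Om - R) = c * Om - c * R" "l * (pX + pO) = l * pX + l * pO"
      by (simp_all only: right_diff_distrib distrib_left)
    then show ?thesis using that by linarith
  qed
  show ?thesis
    unfolding main_bound_def lyapunov_def main_potential_def snapshot_potential_def dist e1 e2 e3 Xf_def[symmetric] Om_def[symmetric]
    by (rule combine[OF t1 t7 t2 t3 t4 t5 t6 t8])
qed

lemma lyapunov_step: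
  assumes s: "feasible s" and A: "gossip_step d m K A"
  shows "measure_pmf.expectation (adom_step P par b A s) lyapunov \<le> (1 - \<rho>) * lyapunov s"
proof -
  let ?PS = "Pi_pmf {1..m} [] (batch_pmf P b)"
  let ?PO = "Pi_pmf {1..m} 0 (snapshot_pmf s)"
  note intS = integrable_measure_pmf_finite[OF finite_Pi_batch]
  note intO = integrable_measure_pmf_finite[OF finite_Pi_snapshot]
  have le: "lyapunov (succ_state A s S om') \<le> (main_bound s + (\<Sum>i=1..m. noise_term s i (S i))) + snapshot_potential om'"
    if "S \<in> set_pmf ?PS" for S om'
  proof -
    have "main_potential (succ_state A s S om') \<le> main_bound s + (\<Sum>i=1..m. noise_term s i (S i))"
    proof (rule main_potential_succ_le[OF s A])
      show "set (S i) \<subseteq> {1..n}" if "i \<in> {1..m}" for i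
        using set_batchD[OF that set_Pi_pmfD[OF _ \<open>S \<in> set_pmf ?PS\<close> that]] by simp
    qed
    moreover have "st_om (succ_state A s S om') = om'" by (simp add: succ_state_def)
    ultimately show ?thesis by (simp add: lyapunov_def)
  qed
  have "measure_pmf.expectation (adom_step P par b A s) lyapunov
    \<le> measure_pmf.expectation ?PS (\<lambda>S. measure_pmf.expectation ?PO
        (\<lambda>om'. (main_bound s + (\<Sum>i=1..m. noise_term s i (S i))) + snapshot_potential om'))"
    unfolding expectation_adom_step
    by (intro expectation_mono_finite finite_Pi_batch finite_Pi_snapshot le)
  also have "\<dots> = main_bound s + (\<Sum>i=1..m. measure_pmf.expectation ?PS (\<lambda>S. noise_term s i (S i)))
      + measure_pmf.expectation ?PO snapshot_potential"
    by (simp add: intS intO Bochner_Integration.integral_sum)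
  also have "(\<Sum>i=1..m. measure_pmf.expectation ?PS (\<lambda>S. noise_term s i (S i)))
      \<le> (\<Sum>i=1..m. 2 * \<tau>0 / \<tau> * D i (st_om s i) (xg s i))"
  proof (rule sum_mono)
    fix i assume i: "i \<in> {1..m}"
    have "measure_pmf.expectation ?PS (\<lambda>S. noise_term s i (S i)) = measure_pmf.expectation (batch_pmf P b i) (noise_term s i)"
      using i by (intro expectation_Pi_component) auto
    then show "measure_pmf.expectation ?PS (\<lambda>S. noise_term s i (S i)) \<le> 2 * \<tau>0 / \<tau> * D i (st_om s i) (xg s i)"
      using noise_term_mean[OF s i] by simp
  qed
  also note snapshot_potential_mean
  finally show ?thesis using lyapunov_terms_contract[OF s] by linarith
qed

lemma lyapunov_ge:
  assumes s: "feasible s"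
  shows "sqnorm m (\<lambda>i. st_x s i - ustar) / \<eta> \<le> lyapunov s"
proof -
  note q = sqnorm_nonneg[of m]
  have "0 \<le> (\<Sum>i=1..m. D i (st_xf s i) ustar)" "0 \<le> (\<Sum>i=1..m. D i (st_om s i) ustar)"
    by (intro sum_nonneg D_nonneg ustar_in feasibleD[OF s]; assumption)+
  then have Xf: "0 \<le> 2 / \<tau> * (\<Sum>i=1..m. D i (st_xf s i) ustar)"
    "0 \<le> 2 / \<tau> * \<Lambda> * (\<Sum>i=1..m. D i (st_om s i) ustar)"
    using params_pos by simp_all
  have x: "sqnorm m x / \<eta> \<le> (1 / \<eta> + \<alpha>) * sqnorm m x" for x
    using params_pos q[of x] by (simp add: distrib_right)
  have nonneg: "0 \<le> (1 / \<theta> + \<beta> / 2) * sqnorm m x" "0 \<le> \<beta> / (2 * \<sigma>) * (1 - \<sigma> / 2) * sqnorm m x"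
    "0 \<le> sqnorm m x / (\<nu> * \<sigma>)" "0 \<le> sqnorm m x / \<gamma>" "0 \<le> C * sqnorm m x" for x
    using params_pos sigma_le q[of x] by simp_all
  have combine: "a \<le> b + c2 + c3 + c4 + c5 + c6 + c7 + c8"
    if "a \<le> b" "0 \<le> c2" "0 \<le> c3" "0 \<le> c4" "0 \<le> c5" "0 \<le> c6" "0 \<le> c7" "0 \<le> c8"
    for a b c2 c3 c4 c5 c6 c7 c8 :: real
    using that by linarith
  show ?thesis
    unfolding lyapunov_def main_potential_def snapshot_potential_def by (rule combine[OF x Xf(1) nonneg Xf(2)])
qed

end

section \<open>Complexity\<close>

context adom_setting
begin

context
  fixes chi :: real and E :: "nat \<Rightarrow> (nat \<times> nat) set" and W :: "nat \<Rightarrow> matrix" and T :: nat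
  assumes gossip: "gossip_assms (dim_of P) (nodes P) chi E W" and T_order: "same_order \<kappa> (real T) chi"
begin

abbreviation "run s0 N \<equiv> adom_vr P par b W T s0 N"

lemma stage_gossip: "gossip_step d m K (multi_stage m W T k)"
  unfolding K_def using T_order by (intro multi_stage_gossip_step[OF gossip kappa]) (simp add: same_order_def)

lemma finite_run: "finite (set_pmf (run s0 N))"
  by (induction N) (simp_all add: finite_adom_step)

lemma feasible_run: "feasible s0 \<Longrightarrow> s \<in> set_pmf (run s0 N) \<Longrightarrow> feasible s"
proof (induction N arbitrary: s)
  case (Suc N)
  then obtain t where "t \<in> set_pmf (run s0 N)" "s \<in> set_pmf (adom_step P par b (multi_stage m W T N) t)"
    by (auto simp del: atLeastAtMost_iff)
  then show ?case using Suc feasible_step[OF _ stage_gossip] by blast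
qed simp

lemma expectation_run_Suc:
  fixes h :: "adom_state \<Rightarrow> real"
  shows "measure_pmf.expectation (run s0 (Suc N)) h
    = measure_pmf.expectation (run s0 N) (\<lambda>s. measure_pmf.expectation (adom_step P par b (multi_stage m W T N) s) h)"
  by (simp only: adom_vr.simps expectation_bind_finite[OF finite_run finite_adom_step])

lemma calls_run:
  assumes i: "i \<in> {1..m}"
  shows "measure_pmf.expectation (run s0 N) (\<lambda>s. real (st_calls s i))
    \<le> real (st_calls s0 i) + real N * (3 * real b)"
proof (induction N)
  case (Suc N)
  note int = integrable_measure_pmf_finite[OF finite_run]
  have "measure_pmf.expectation (run s0 (Suc N)) (\<lambda>s. real (st_calls s i))
     \<le> measure_pmf.expectation (run s0 N) (\<lambda>s. real (st_calls s i) + 3 * real b)"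
    unfolding expectation_run_Suc by (intro expectation_mono_finite finite_run calls_step i)
  also have "\<dots> = measure_pmf.expectation (run s0 N) (\<lambda>s. real (st_calls s i)) + 3 * real b"
    by (simp add: int)
  finally show ?case using Suc by (simp add: algebra_simps)
qed simp

end

end

context adom_minimizer
begin

lemma lyapunov_run:
  assumes "gossip_assms (dim_of P) (nodes P) chi E W" "same_order \<kappa> (real T) chi" and s0: "feasible s0"
  shows "measure_pmf.expectation (adom_vr P par b W T s0 N) lyapunov \<le> (1 - \<rho>) ^ N * lyapunov s0"
proof (induction N)
  case (Suc N)
  have "measure_pmf.expectation (adom_vr P par b W T s0 (Suc N)) lyapunov
     \<le> measure_pmf.expectation (adom_vr P par b W T s0 N) (\<lambda>s. (1 - \<rho>) * lyapunov s)"
    unfolding expectation_run_Suc[OF assms(1,2)]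
    by (intro expectation_mono_finite finite_run[OF assms(1,2)] lyapunov_step
        feasible_run[OF assms(1,2) s0] stage_gossip[OF assms(1,2)])
  also have "\<dots> = (1 - \<rho>) * measure_pmf.expectation (adom_vr P par b W T s0 N) lyapunov" by simp
  also have "\<dots> \<le> (1 - \<rho>) * ((1 - \<rho>) ^ N * lyapunov s0)"
    using Suc rho_le(7) by (intro mult_left_mono) auto
  finally show ?case by simp
qed simp

lemma feasible_init:
  assumes "x0 \<in> stacked_space d m" "y0 \<in> stacked_space d m" "m0 \<in> stacked_space d m" "z0 \<in> consensus_perp d m"
  shows "feasible (adom_init P x0 y0 z0 m0)"
  using assms by (simp add: feasible_def adom_init_def)

text \<open>
  After \<open>N = \<lceil>ln (B / \<epsilon>) / \<rho>\<rceil>\<close> iterations \<open>(1 - \<rho>)\<^sup>N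
  \<le> \<epsilon> / B\<close>. The summand \<open>exp 1\<close> of \<open>B\<close> makes the logarithm at
  least \<open>1\<close>, so that it also absorbs the rounding of \<open>N\<close> and the \<open>n\<close>
  calls spent on the initial full gradient. In \<open>c\<close>, \<open>15360 = 2 \<cdot> 3 \<cdot>
  2560\<close>: the rounding, the \<open>3 b\<close> calls per iteration, and the constant of
  \<open>\<rho>\<close>.
\<close>

lemma adom_vr_complexity:
  assumes G: "gossip_assms (dim_of P) (nodes P) chi E W" and T: "same_order \<kappa> (real T) chi"
    and s0: "feasible s0" "\<And>i. st_calls s0 i = n"
    and \<epsilon>: "0 < \<epsilon>" "\<epsilon> < 1"
  defines "B \<equiv> exp 1 + \<eta> * lyapunov s0" and "c \<equiv> 1 + 15360 * (\<kappa> + 1)\<^sup>2 * \<kappa>"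
  shows "\<exists>N. measure_pmf.expectation (adom_vr P par b W T s0 N) (\<lambda>s. sqnorm m (\<lambda>i. st_x s i - ustar)) \<le> \<epsilon> \<and>
    (\<forall>i\<in>{1..m}. measure_pmf.expectation (adom_vr P par b W T s0 N) (\<lambda>s. real (st_calls s i))
       \<le> c * (real n + sqrt (real n * Lbar P / \<mu>)) * ln (B / \<epsilon>)) \<and>
    real (N * T) \<le> c * (chi * sqrt (L / \<mu>)) * ln (B / \<epsilon>)"
proof -
  define l where "l = ln (B / \<epsilon>)"
  define N where "N = nat \<lceil>l / \<rho>\<rceil>"
  have lyapunov0: "0 \<le> lyapunov s0"
    using order_trans[OF _ lyapunov_ge[OF s0(1)]] sqnorm_nonneg params_pos(5) by simp
  then have B: "exp 1 \<le> B" using params_pos(5) by (simp add: B_def)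
  then have B0: "0 < B" using exp_gt_zero[of "1::real"] by linarith
  have "exp 1 \<le> B / \<epsilon>"
  proof -
    have "exp 1 * \<epsilon> \<le> B * 1" using B B0 \<epsilon> by (intro mult_mono) auto
    then show ?thesis using \<epsilon> by (simp add: pos_le_divide_eq)
  qed
  then have l1: "1 \<le> l" unfolding l_def using B0 \<epsilon> by (subst ln_ge_iff) auto
  have "0 \<le> l / \<rho>" using l1 params_pos by simp
  then have N_ge: "l / \<rho> \<le> real N" and N_le: "real N \<le> l / \<rho> + 1"
    unfolding N_def by linarith+
  have "1 \<le> l / \<rho>" using l1 rho_le(7) params_pos(13) by (simp add: pos_le_divide_eq)
  with N_le have N2: "real N \<le> 2 * (l / \<rho>)" by linarith
  have inv_\<rho>: "l / \<rho> = 2560 * K\<^sup>2 * l / r" by (simp add: \<rho>_def)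
  have "measure_pmf.expectation (adom_vr P par b W T s0 N) (\<lambda>s. sqnorm m (\<lambda>i. st_x s i - ustar))
     \<le> measure_pmf.expectation (adom_vr P par b W T s0 N) (\<lambda>s. \<eta> * lyapunov s)"
  proof (intro expectation_mono_finite finite_run[OF G T])
    fix s assume "s \<in> set_pmf (adom_vr P par b W T s0 N)"
    then have "feasible s" by (rule feasible_run[OF G T s0(1)])
    from lyapunov_ge[OF this] show "sqnorm m (\<lambda>i. st_x s i - ustar) \<le> \<eta> * lyapunov s"
      using params_pos(5) by (simp add: pos_divide_le_eq mult.commute)
  qed
  also have "\<dots> = \<eta> * measure_pmf.expectation (adom_vr P par b W T s0 N) lyapunov" by simp
  also have "\<dots> \<le> \<eta> * ((1 - \<rho>) ^ N * lyapunov s0)"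
    using lyapunov_run[OF G T s0(1)] params_pos(5) by (intro mult_left_mono) auto
  also have "\<dots> = (1 - \<rho>) ^ N * (\<eta> * lyapunov s0)" by simp
  also have "\<dots> \<le> \<epsilon> / B * B"
  proof (intro mult_mono)
    have "(1 - \<rho>) ^ N \<le> exp (- \<rho>) ^ N"
      using rho_le(7) exp_ge_add_one_self[of "- \<rho>"] by (intro power_mono) auto
    also have "\<dots> = exp (- (\<rho> * real N))" by (simp add: mult.commute flip: exp_of_nat_mult)
    also have "\<dots> \<le> exp (- l)"
      using N_ge params_pos(13) by (simp add: pos_divide_le_eq mult.commute)
    also have "\<dots> = \<epsilon> / B" unfolding l_def using B0 \<epsilon> by (simp add: exp_minus)
    finally show "(1 - \<rho>) ^ N \<le> \<epsilon> / B" .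
    show "\<eta> * lyapunov s0 \<le> B" by (simp add: B_def)
  qed (use B0 \<epsilon> lyapunov0 params_pos in simp_all)
  also have "\<dots> = \<epsilon>" using B0 by simp
  finally have acc: "measure_pmf.expectation (adom_vr P par b W T s0 N) (\<lambda>s. sqnorm m (\<lambda>i. st_x s i - ustar)) \<le> \<epsilon>" .
  define A where "A = real n + sqrt (real n * Lbar P / \<mu>)"
  have A: "0 \<le> A" "real n \<le> A" using Lbar_pos dims by (simp_all add: A_def)
  have br: "real b / r \<le> \<kappa> * A"
  proof -
    have s: "sqrt (real n * Lbar P / L) / r = sqrt (real n * Lbar P / \<mu>)"
      unfolding r_def using L_pos by (simp add: real_sqrt_divide)
    have "max (sqrt (real n * Lbar P / L)) (real n * r) / r \<le> A"
    proof (cases "sqrt (real n * Lbar P / L) \<le> real n * r")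
      case True
      then show ?thesis using r_pos A by (simp add: max_def)
    next
      case False
      then show ?thesis using s by (simp add: max_def A_def)
    qed
    then have "\<kappa> * (max (sqrt (real n * Lbar P / L)) (real n * r) / r) \<le> \<kappa> * A"
      using kappa by (intro mult_left_mono) auto
    moreover have "real b / r \<le> \<kappa> * max (sqrt (real n * Lbar P / L)) (real n * r) / r"
      using b_le r_pos by (intro divide_right_mono) auto
    ultimately show ?thesis by simp
  qed
  have calls: "measure_pmf.expectation (adom_vr P par b W T s0 N) (\<lambda>s. real (st_calls s i)) \<le> c * A * l"
    if i: "i \<in> {1..m}" for i
  proof -
    have "measure_pmf.expectation (adom_vr P par b W T s0 N) (\<lambda>s. real (st_calls s i)) \<le> real n + real N * (3 * real b)"
      using calls_run[OF G T i, of s0 N] s0(2) by simp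
    also have "real N * (3 * real b) \<le> 2 * (l / \<rho>) * (3 * real b)"
      using N2 by (intro mult_right_mono) auto
    also have "\<dots> = 15360 * K\<^sup>2 * l * (real b / r)" unfolding inv_\<rho> by simp
    also have "\<dots> \<le> 15360 * K\<^sup>2 * l * (\<kappa> * A)"
      using br l1 by (intro mult_left_mono) auto
    also have "real n \<le> A * l" using A l1 mult_mono[of "real n" A 1 l] by simp
    finally show ?thesis by (simp add: c_def K_def algebra_simps)
  qed
  have chi: "1 \<le> chi" using G by (simp add: gossip_assms_def)
  have "real (N * T) \<le> 2 * (l / \<rho>) * (\<kappa> * chi)"
    unfolding of_nat_mult using N2 T by (intro mult_mono) (auto simp: same_order_def)
  also have "\<dots> = 5120 * K\<^sup>2 * \<kappa> * (chi * (1 / r) * l)" unfolding inv_\<rho> by simp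
  also have "1 / r = sqrt (L / \<mu>)" unfolding r_def by (simp add: real_sqrt_divide)
  also have "5120 * K\<^sup>2 * \<kappa> * (chi * sqrt (L / \<mu>) * l) \<le> c * (chi * sqrt (L / \<mu>) * l)"
  proof (rule mult_right_mono)
    have "0 \<le> \<kappa> * K\<^sup>2" using kappa by simp
    then show "5120 * K\<^sup>2 * \<kappa> \<le> c" unfolding c_def K_def[symmetric] by simp
    show "0 \<le> chi * sqrt (L / \<mu>) * l" using chi l1 L_pos dims by simp
  qed
  finally have comm: "real (N * T) \<le> c * (chi * sqrt (L / \<mu>)) * l" by (simp add: mult.assoc)
  show ?thesis
    using acc calls comm unfolding l_def A_def by blast
qed

end

theorem corollary4p2:
  fixes \<kappa> :: real
  assumes "1 \<le> \<kappa>"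
  shows
    "\<exists>c>0. \<exists>par :: real \<Rightarrow> real \<Rightarrow> real \<Rightarrow> real \<Rightarrow> nat \<Rightarrow> nat \<Rightarrow> adom_params.
      \<forall>(P :: problem) L \<mu> chi E W (b :: nat) (T :: nat).
        problem_assms P L \<mu> \<and>
        gossip_assms (dim_of P) (nodes P) chi E W \<and>
        Lbar P / L \<le> real b \<and>
        same_order \<kappa> (real b)
          (max (sqrt (real (comps P) * Lbar P / L)) (real (comps P) * sqrt (\<mu> / L))) \<and>
        same_order \<kappa> (real T) chi
        \<longrightarrow>
        (let p = par L (Lbar P) \<mu> chi (comps P) b in
          admissible p \<and>
          (\<forall>ustar x0 y0 z0 m0.
            is_minimizer P ustar \<and>
            x0 \<in> stacked_space (dim_of P) (nodes P) \<and>
            y0 \<in> stacked_space (dim_of P) (nodes P) \<and>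
            m0 \<in> stacked_space (dim_of P) (nodes P) \<and>
            z0 \<in> consensus_perp (dim_of P) (nodes P)
            \<longrightarrow>
            (\<exists>C>0. \<forall>\<epsilon>. 0 < \<epsilon> \<and> \<epsilon> < 1 \<longrightarrow>
              (\<exists>N :: nat.
                let run = adom_vr P p b W T (adom_init P x0 y0 z0 m0) N in
                  measure_pmf.expectation run
                    (\<lambda>s. sqnorm (nodes P) (\<lambda>i. st_x s i - ustar)) \<le> \<epsilon> \<and>
                  (\<forall>i\<in>{1..nodes P}.
                    measure_pmf.expectation run (\<lambda>s. real (st_calls s i))
                      \<le> c * (real (comps P) + sqrt (real (comps P) * Lbar P / \<mu>)) * ln (C / \<epsilon>)) \<and>
                  real (N * T) \<le> c * (chi * sqrt (L / \<mu>)) * ln (C / \<epsilon>)))))"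
proof (intro exI[of _ "1 + 15360 * (\<kappa> + 1)\<^sup>2 * \<kappa>"] conjI
    exI[of _ "\<lambda>L Lb \<mu> chi n b. vr_params \<kappa> L Lb \<mu> n b"] allI impI)
  have "0 \<le> (\<kappa> + 1)\<^sup>2 * \<kappa>" using assms by simp
  then show "0 < 1 + 15360 * (\<kappa> + 1)\<^sup>2 * \<kappa>" by linarith
next
  fix P :: problem and L \<mu> chi :: real and E :: "nat \<Rightarrow> (nat \<times> nat) set" and W :: "nat \<Rightarrow> matrix" and b T :: nat
  assume "problem_assms P L \<mu> \<and> gossip_assms (dim_of P) (nodes P) chi E W \<and>
        Lbar P / L \<le> real b \<and>
        same_order \<kappa> (real b)
          (max (sqrt (real (comps P) * Lbar P / L)) (real (comps P) * sqrt (\<mu> / L))) \<and>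
        same_order \<kappa> (real T) chi"
  then have problem: "problem_assms P L \<mu>" and G: "gossip_assms (dim_of P) (nodes P) chi E W"
    and b: "Lbar P / L \<le> real b" "same_order \<kappa> (real b)
          (max (sqrt (real (comps P) * Lbar P / L)) (real (comps P) * sqrt (\<mu> / L)))"
    and T: "same_order \<kappa> (real T) chi" by blast+
  interpret adom_setting P L \<mu> \<kappa> b
    by unfold_locales (rule problem assms b)+
  show "let p = vr_params \<kappa> L (Lbar P) \<mu> (comps P) b in
          admissible p \<and>
          (\<forall>ustar x0 y0 z0 m0.
            is_minimizer P ustar \<and>
            x0 \<in> stacked_space (dim_of P) (nodes P) \<and>
            y0 \<in> stacked_space (dim_of P) (nodes P) \<and>
            m0 \<in> stacked_space (dim_of P) (nodes P) \<and>
            z0 \<in> consensus_perp (dim_of P) (nodes P)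
            \<longrightarrow>
            (\<exists>C>0. \<forall>\<epsilon>. 0 < \<epsilon> \<and> \<epsilon> < 1 \<longrightarrow>
              (\<exists>N :: nat.
                let run = adom_vr P p b W T (adom_init P x0 y0 z0 m0) N in
                  measure_pmf.expectation run
                    (\<lambda>s. sqnorm (nodes P) (\<lambda>i. st_x s i - ustar)) \<le> \<epsilon> \<and>
                  (\<forall>i\<in>{1..nodes P}.
                    measure_pmf.expectation run (\<lambda>s. real (st_calls s i))
                      \<le> (1 + 15360 * (\<kappa> + 1)\<^sup>2 * \<kappa>)
                        * (real (comps P) + sqrt (real (comps P) * Lbar P / \<mu>)) * ln (C / \<epsilon>)) \<and>
                  real (N * T) \<le> (1 + 15360 * (\<kappa> + 1)\<^sup>2 * \<kappa>) * (chi * sqrt (L / \<mu>)) * ln (C / \<epsilon>))))"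
    unfolding Let_def par_def[symmetric]
  proof (intro conjI admissible_par allI impI)
    fix ustar x0 y0 z0 m0
    assume init: "is_minimizer P ustar \<and>
            x0 \<in> stacked_space (dim_of P) (nodes P) \<and>
            y0 \<in> stacked_space (dim_of P) (nodes P) \<and>
            m0 \<in> stacked_space (dim_of P) (nodes P) \<and>
            z0 \<in> consensus_perp (dim_of P) (nodes P)"
    interpret adom_minimizer P L \<mu> \<kappa> b ustar
      by unfold_locales (use init in blast)
    have s0: "feasible (adom_init P x0 y0 z0 m0)" using init by (intro feasible_init) auto
    have calls0: "st_calls (adom_init P x0 y0 z0 m0) i = n" for i by (simp add: adom_init_def)
    have "0 \<le> lyapunov (adom_init P x0 y0 z0 m0)"
      using order_trans[OF _ lyapunov_ge[OF s0]] sqnorm_nonneg params_pos(5) by simp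
    then have B: "0 < exp 1 + \<eta> * lyapunov (adom_init P x0 y0 z0 m0)"
      using params_pos(5) by (intro add_pos_nonneg) auto
    note complexity = adom_vr_complexity[OF G T s0 calls0]
    show "\<exists>C>0. \<forall>\<epsilon>. 0 < \<epsilon> \<and> \<epsilon> < 1 \<longrightarrow>
              (\<exists>N :: nat.
                  measure_pmf.expectation (adom_vr P par b W T (adom_init P x0 y0 z0 m0) N)
                    (\<lambda>s. sqnorm (nodes P) (\<lambda>i. st_x s i - ustar)) \<le> \<epsilon> \<and>
                  (\<forall>i\<in>{1..nodes P}.
                    measure_pmf.expectation (adom_vr P par b W T (adom_init P x0 y0 z0 m0) N) (\<lambda>s. real (st_calls s i))
                      \<le> (1 + 15360 * (\<kappa> + 1)\<^sup>2 * \<kappa>)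
                        * (real (comps P) + sqrt (real (comps P) * Lbar P / \<mu>)) * ln (C / \<epsilon>)) \<and>
                  real (N * T) \<le> (1 + 15360 * (\<kappa> + 1)\<^sup>2 * \<kappa>) * (chi * sqrt (L / \<mu>)) * ln (C / \<epsilon>))"
      by (intro exI[of _ "exp 1 + \<eta> * lyapunov (adom_init P x0 y0 z0 m0)"] conjI B allI impI)
         (rule complexity, simp_all)
  qed
qed

end
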